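(* Let $(A,S)$ be a QP and $k$ a vertex such that for every vertex $i$, $A_{i,k}=0$ or $A_{k,i}=0$, and such that no cyclic path occurring in the expansion of $S$ starts (and ends) at $k$. Then the right-equivalence class of the QP $\widetilde\mu_k(A,S)=(\widetilde A,\widetilde S)$ is determined by the right-equivalence class of $(A,S)$; i.e. if $(A',S')$ is another QP satisfying the same two conditions at $k$ and right-equivalent to $(A,S)$, then $\widetilde\mu_k(A,S)$ and $\widetilde\mu_k(A',S')$ are right-equivalent.
   Context: Fix a field $K$. A quiver $Q$ has finite vertex set $Q_0$ and arrow set $Q_1$, each arrow $a$ going from $t(a)$ to $h(a)$. Let $R=K^{Q_0}$ with idempotents $e_i$, and $A=K^{Q_1}$ the arrow span, an $R$-bimodule with $A_{i,j}=e_iAe_j$ spanned by arrows from $j$ to $i$. The complete path algebra $R\langle\langle A\rangle\rangle=\prod_{d\ge0}A^d$ consists of (possibly infinite) linear combinations of paths $a_1\cdots a_d$ ($t(a_i)=h(a_{i+1})$; a path from $t(a_d)$ to $h(a_1)$), with concatenation product and the $\mathfrak m$-adic topology, $\mathfrak m=\prod_{d\ge1}A^d$. A path is cyclic if $d\geq1$ and $h(a_1)=t(a_d)$; a potential is a possibly infinite linear combination of cyclic paths; two potentials are cyclically equivalent if their difference lies in the closure of the span of all $a_1\cdots a_d-a_2\cdots a_da_1$ (cyclic paths). A QP $(A,S)$: $Q$ has no loops and no two cyclically equivalent cyclic paths occur in $S$. A right-equivalence between QPs $(A,S),(A',S')$ on the same vertex set is an algebra isomorphism $\varphi:R\langle\langle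 A\rangle\rangle\to R\langle\langle A'\rangle\rangle$ with $\varphi|_R=\mathrm{id}$ and $\varphi(S)$ cyclically equivalent to $S'$. Construction $\widetilde\mu_k(A,S)=(\widetilde A,\widetilde S)$ (under the two conditions at $k$): the quiver of $\widetilde A$ has the same vertices and arrows: (i) every arrow of $Q$ not incident to $k$; (ii) for each arrow $a$ with $h(a)=k$ and each arrow $b$ with $t(b)=k$, a new arrow $[ba]:t(a)\to h(b)$; (iii) for each arrow $c$ incident to $k$, an arrow $c^\star$ with reversed orientation ($a^\star:k\to t(a)$, $b^\star:h(b)\to k$). Then $\widetilde S=[S]+\sum_{a,b\in Q_1,\,h(a)=t(b)=k}[ba]a^\star b^\star$, where $[S]$ is obtained by substituting $[a_pa_{p+1}]$ for each factor $a_pa_{p+1}$ with $t(a_p)=h(a_{p+1})=k$ of every cyclic path $a_1\cdots a_d$ occurring in $S$ (this is independent of the choice of arrow bases). *)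

theory Defs
  imports Main
begin

record ('v, 'a) quiver =
  qverts :: "'v set"
  qarrs  :: "'a set"
  qhead  :: "'a \<Rightarrow> 'v"
  qtail  :: "'a \<Rightarrow> 'v"

text \<open>A path is represented as a pair (i, [a1,...,ad]) meaning the path
  a1 ... ad (a_d traversed first); i is its starting vertex t(a_d), resp. the
  vertex of the trivial path e_i when the list is empty.\<close>
type_synonym ('v, 'a) path = "'v \<times> 'a list"

fun composable :: "('v, 'a) quiver \<Rightarrow> 'a list \<Rightarrow> bool" where
  "composable Q (b # a # rest) = (qtail Q b = qhead Q a \<and> composable Q (a # rest))"
| "composable Q _ = True"

definition valid_path :: "('v, 'a) quiver \<Rightarrow> ('v, 'a) path \<Rightarrow> bool" where
  "valid_path Q p \<longleftrightarrow> fst p \<in> qverts Q \<and>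
     (snd p = [] \<or> (set (snd p) \<subseteq> qarrs Q \<and> composable Q (snd p)
                     \<and> qtail Q (last (snd p)) = fst p))"

definition path_end :: "('v, 'a) quiver \<Rightarrow> ('v, 'a) path \<Rightarrow> 'v" where
  "path_end Q p = (if snd p = [] then fst p else qhead Q (hd (snd p)))"

definition cyclic_path :: "('v, 'a) quiver \<Rightarrow> ('v, 'a) path \<Rightarrow> bool" where
  "cyclic_path Q p \<longleftrightarrow> valid_path Q p \<and> snd p \<noteq> [] \<and> path_end Q p = fst p"

text \<open>Elements of R<<A>>: arbitrary (possibly infinite) K-linear combinations
  of paths, i.e. coefficient functions vanishing outside the valid paths.\<close>
definition cpa :: "('v, 'a) quiver \<Rightarrow> (('v, 'a) path \<Rightarrow> 'k::field) set" where
  "cpa Q = {f. \<forall>p. \<not> valid_path Q p \<longrightarrow> f p = 0}"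

definition cpa_mult :: "('v, 'a) quiver \<Rightarrow> (('v, 'a) path \<Rightarrow> 'k::field)
    \<Rightarrow> (('v, 'a) path \<Rightarrow> 'k) \<Rightarrow> ('v, 'a) path \<Rightarrow> 'k" where
  "cpa_mult Q f g p = (if valid_path Q p then
     (\<Sum>n\<in>{0..length (snd p)}.
        f (if n < length (snd p) then qhead Q (snd p ! n) else fst p, take n (snd p))
        * g (fst p, drop n (snd p)))
     else 0)"

text \<open>Embedding of R = K^{Q_0} (linear combinations of the idempotents e_i).\<close>
definition cpa_R :: "('v, 'a) quiver \<Rightarrow> ('v \<Rightarrow> 'k::field) \<Rightarrow> ('v, 'a) path \<Rightarrow> 'k" where
  "cpa_R Q r p = (if snd p = [] \<and> fst p \<in> qverts Q then r (fst p) else 0)"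

definition alg_iso_R :: "('v, 'a) quiver \<Rightarrow> ('v, 'b) quiver
    \<Rightarrow> ((('v, 'a) path \<Rightarrow> 'k::field) \<Rightarrow> (('v, 'b) path \<Rightarrow> 'k)) \<Rightarrow> bool" where
  "alg_iso_R Q Q' \<phi> \<longleftrightarrow>
     bij_betw \<phi> (cpa Q) (cpa Q') \<and>
     (\<forall>f\<in>cpa Q. \<forall>g\<in>cpa Q. \<phi> (\<lambda>p. f p + g p) = (\<lambda>p. \<phi> f p + \<phi> g p)) \<and>
     (\<forall>f\<in>cpa Q. \<forall>g\<in>cpa Q. \<phi> (cpa_mult Q f g) = cpa_mult Q' (\<phi> f) (\<phi> g)) \<and>
     (\<forall>r. \<phi> (cpa_R Q r) = cpa_R Q' r)"

definition potential :: "('v, 'a) quiver \<Rightarrow> (('v, 'a) path \<Rightarrow> 'k::field) \<Rightarrow> bool" where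
  "potential Q S \<longleftrightarrow> S \<in> cpa Q \<and> (\<forall>p. \<not> cyclic_path Q p \<longrightarrow> S p = 0)"

fun rot :: "('v, 'a) quiver \<Rightarrow> ('v, 'a) path \<Rightarrow> ('v, 'a) path" where
  "rot Q (i, []) = (i, [])"
| "rot Q (i, a # rest) = (qtail Q a, rest @ [a])"

definition delta :: "('v, 'a) path \<Rightarrow> ('v, 'a) path \<Rightarrow> 'k::field" where
  "delta q p = (if p = q then 1 else 0)"

text \<open>f and g are cyclically equivalent iff f - g lies in the m-adic closure of
  the K-span of the elements q - rot q (q cyclic): for every n there is an
  element of that span agreeing with f - g on all paths of length < n.\<close>
definition cyc_equiv :: "('v, 'a) quiver \<Rightarrow> (('v, 'a) path \<Rightarrow> 'k::field)
    \<Rightarrow> (('v, 'a) path \<Rightarrow> 'k) \<Rightarrow> bool" where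
  "cyc_equiv Q f g \<longleftrightarrow>
     (\<forall>n::nat. \<exists>F c. finite F \<and> F \<subseteq> {q. cyclic_path Q q} \<and>
        (\<forall>p. length (snd p) < n \<longrightarrow>
           f p - g p = (\<Sum>q\<in>F. c q * (delta q p - delta (rot Q q) p))))"

text \<open>Two cyclic paths are cyclically equivalent iff one is a rotation of the other.\<close>
definition QP :: "('v, 'a) quiver \<Rightarrow> (('v, 'a) path \<Rightarrow> 'k::field) \<Rightarrow> bool" where
  "QP Q S \<longleftrightarrow> finite (qverts Q) \<and> finite (qarrs Q) \<and>
     (\<forall>a\<in>qarrs Q. qhead Q a \<in> qverts Q \<and> qtail Q a \<in> qverts Q) \<and>
     (\<forall>a\<in>qarrs Q. qhead Q a \<noteq> qtail Q a) \<and>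
     potential Q S \<and>
     (\<forall>p q. cyclic_path Q p \<and> cyclic_path Q q \<and> S p \<noteq> 0 \<and> S q \<noteq> 0 \<and> p \<noteq> q
        \<longrightarrow> (\<forall>n. q \<noteq> (rot Q ^^ n) p))"

definition right_equiv :: "('v, 'a) quiver \<Rightarrow> (('v, 'a) path \<Rightarrow> 'k::field)
    \<Rightarrow> ('v, 'b) quiver \<Rightarrow> (('v, 'b) path \<Rightarrow> 'k) \<Rightarrow> bool" where
  "right_equiv Q S Q' S' \<longleftrightarrow> qverts Q = qverts Q' \<and>
     (\<exists>\<phi>. alg_iso_R Q Q' \<phi> \<and> cyc_equiv Q' (\<phi> S) S')"

definition mut_conds :: "('v, 'a) quiver \<Rightarrow> (('v, 'a) path \<Rightarrow> 'k::field) \<Rightarrow> 'v \<Rightarrow> bool" where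
  "mut_conds Q S k \<longleftrightarrow> k \<in> qverts Q \<and>
     (\<forall>i\<in>qverts Q. (\<not>(\<exists>a\<in>qarrs Q. qtail Q a = k \<and> qhead Q a = i))
                  \<or> (\<not>(\<exists>a\<in>qarrs Q. qtail Q a = i \<and> qhead Q a = k))) \<and>
     (\<forall>p. cyclic_path Q p \<and> S p \<noteq> 0 \<longrightarrow> fst p \<noteq> k)"

datatype 'a marrow = Old 'a | Comp 'a 'a | Star 'a

definition mquiver :: "('v, 'a) quiver \<Rightarrow> 'v \<Rightarrow> ('v, 'a marrow) quiver" where
  "mquiver Q k = \<lparr> qverts = qverts Q,
     qarrs = Old ` {a\<in>qarrs Q. qhead Q a \<noteq> k \<and> qtail Q a \<noteq> k}
           \<union> {Comp b a | a b. a \<in> qarrs Q \<and> b \<in> qarrs Q \<and> qhead Q a = k \<and> qtail Q b = k}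
           \<union> Star ` {c\<in>qarrs Q. qhead Q c = k \<or> qtail Q c = k},
     qhead = (\<lambda>x. case x of Old a \<Rightarrow> qhead Q a | Comp b a \<Rightarrow> qhead Q b
                  | Star c \<Rightarrow> (if qhead Q c = k then qtail Q c else k)),
     qtail = (\<lambda>x. case x of Old a \<Rightarrow> qtail Q a | Comp b a \<Rightarrow> qtail Q a
                  | Star c \<Rightarrow> (if qhead Q c = k then k else qhead Q c)) \<rparr>"

fun msub :: "('v, 'a) quiver \<Rightarrow> 'v \<Rightarrow> 'a list \<Rightarrow> 'a marrow list" where
  "msub Q k (b # a # rest) =
     (if qtail Q b = k \<and> qhead Q a = k then Comp b a # msub Q k rest
      else Old b # msub Q k (a # rest))"
| "msub Q k [a] = [Old a]"
| "msub Q k [] = []"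

text \<open>[S]: coefficient of q is the coefficient in S of the cyclic path that is
  turned into q by the substitution.\<close>
definition bracket_pot :: "('v, 'a) quiver \<Rightarrow> (('v, 'a) path \<Rightarrow> 'k::field) \<Rightarrow> 'v
    \<Rightarrow> ('v, 'a marrow) path \<Rightarrow> 'k" where
  "bracket_pot Q S k q =
     (\<Sum>p\<in>{p. cyclic_path Q p \<and> fst p \<noteq> k \<and> (fst p, msub Q k (snd p)) = q}. S p)"

definition mut_pot :: "('v, 'a) quiver \<Rightarrow> (('v, 'a) path \<Rightarrow> 'k::field) \<Rightarrow> 'v
    \<Rightarrow> ('v, 'a marrow) path \<Rightarrow> 'k" where
  "mut_pot Q S k q = bracket_pot Q S k q +
     (if \<exists>a\<in>qarrs Q. \<exists>b\<in>qarrs Q. qhead Q a = k \<and> qtail Q b = k \<and>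
            q = (qhead Q b, [Comp b a, Star a, Star b]) then 1 else 0)"

end

theory Submission
  imports Defs
begin

text \<open>
  Let \<open>\<phi>\<close> be a right-equivalence with inverse \<open>\<phi>'\<close>. Expanding \<open>\<phi>'(a')\<close> for the arrows
  \<open>a'\<close> into \<open>k\<close> as \<open>\<Sum>\<^sub>a a C\<^bsub>aa'\<^esub>\<close>, and \<open>\<phi>'(b')\<close> for the arrows \<open>b'\<close> out of \<open>k\<close>
  as \<open>\<Sum>\<^sub>b D\<^bsub>b'b\<^esub> b\<close>, gives matrices over the part of the path algebra that starts and ends
  outside \<open>k\<close>, on which the substitution \<open>[\<cdot>]\<close> is multiplicative. Put
  \<open>a\<^sup>* \<mapsto> \<Sum> [\<phi>(C\<^bsub>aa'\<^esub>)] a'\<^sup>*\<close>, \<open>b\<^sup>* \<mapsto> \<Sum> b'\<^sup>* [\<phi>(D\<^bsub>b'b\<^esub>)]\<close>, \<open>c \<mapsto> [\<phi>(c)]\<close> and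
  \<open>[ba] \<mapsto> [\<phi>(b a)]\<close>. The resulting homomorphism \<open>\<Psi>\<close> satisfies \<open>\<Psi>[f] = [\<phi> f]\<close>, the same
  recipe applied to \<open>\<phi>'\<close> inverts it (the matrices for \<open>\<phi>\<close> and \<open>\<phi>'\<close> are mutually inverse up
  to \<open>\<phi>\<close>), and \<open>\<Sum> [ba] a\<^sup>* b\<^sup>*\<close> is mapped to
  \<open>\<Sum> [\<phi>(b) a'] a'\<^sup>* b'\<^sup>* [\<phi>(D\<^bsub>b'b\<^esub>)]\<close>, which becomes \<open>\<Sum> [b'a'] a'\<^sup>* b'\<^sup>*\<close> after moving the last
  factor to the front.
\<close>

section \<open>Path series\<close>

text \<open>The substitution [.] is not multiplicative on the whole algebra: a product cut at k, in
  the middle of a composite, is invisible to it. So a single arrow at k cannot be bracketed, and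
  brackets are split only behind a factor that does not start at k. The matrices on starred arrows
  have to be contragredient: [ba] transforms by the matrices of \<phi> on arrows into and out of k,
  hence the starred arrows must carry the inverse matrices. Expanding \<phi>' yields these inverses,
  and pushing their entries forward by \<phi> places them over \<open>Q'\<close>. The isomorphism is
  given purely algebraically; its continuity comes from the absence of loops. An arrow image lies
  between two different vertices, so it has no constant term, and an expansion along leftmost arrows
  gains one degree per step. The mutated quiver inherits this only because no 2-cycle passes through
  k. Cyclic equivalence is defined by a closure. It is replaced by the vanishing of coefficient sums
  over rotation classes, a condition that survives the bracket because rotations based at k carry no
  coefficient.\<close>

text \<open>A path is encoded by its starting vertex \<open>i\<close> and the list of its arrows, each paired with its
  head. Every such pair is then a path of one universal quiver whose arrows carry their endpoints,
  so the formal series form a ring type, and the algebras of all quivers on the same arrow type are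
  subsets of it.\<close>
definition wend :: "'v \<Rightarrow> ('a \<times> 'v) list \<Rightarrow> 'v" where
  "wend i w = (if w = [] then i else snd (hd w))"

lemma wend_simps [simp]: "wend i [] = i" "wend i (x # w) = snd x"
  by (auto simp: wend_def)

lemma wend_append: "wend i (u @ v) = wend (wend i v) u"
  by (auto simp: wend_def)

typedef ('v, 'a, 'k) pser = "UNIV :: ('v \<Rightarrow> ('a \<times> 'v) list \<Rightarrow> 'k) set"
  morphisms coeff Pser ..

setup_lifting type_definition_pser

lemma pser_eqI: "(\<And>i w. coeff F i w = coeff G i w) \<Longrightarrow> F = G"
  by (metis coeff_inject ext)

lemma coeff_Pser [simp]: "coeff (Pser f) = f"
  by (simp add: Pser_inverse)

text \<open>In a cut \<open>w = u @ v\<close> the part \<open>v\<close> is traversed first, so the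
  left factor starts where \<open>v\<close> ends; hence the vertex argument
  \<open>wend i (drop n w)\<close>.\<close>

definition conv :: "('v \<Rightarrow> ('a \<times> 'v) list \<Rightarrow> 'k::comm_ring) \<Rightarrow> ('v \<Rightarrow> ('a \<times> 'v) list \<Rightarrow> 'k)
    \<Rightarrow> 'v \<Rightarrow> ('a \<times> 'v) list \<Rightarrow> 'k" where
  "conv f g i w = (\<Sum>n\<le>length w. f (wend i (drop n w)) (take n w) * g i (drop n w))"

lemma conv_Nil [simp]: "conv f g i [] = f i [] * g i []"
  by (simp add: conv_def)

lemma conv_Cons: "conv f g i (x # w) = f (snd x) [] * g i (x # w) + conv (\<lambda>j u. f j (x # u)) g i w"
  by (simp add: conv_def sum.atMost_Suc_shift del: sum.atMost_Suc)

lemma conv_add_left: "conv (\<lambda>j u. f j u + f' j u) g i w = conv f g i w + conv f' g i w"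
  by (simp add: conv_def sum.distrib distrib_right)

lemma conv_add_right: "conv f (\<lambda>j u. g j u + g' j u) i w = conv f g i w + conv f g' i w"
  by (simp add: conv_def sum.distrib distrib_left)

lemma conv_scale_left: "conv (\<lambda>j u. c * f j u) g i w = c * conv f g i w"
  by (simp add: conv_def sum_distrib_left mult.assoc)

lemma conv_scale_right: "conv f (\<lambda>j u. c * g j u) i w = c * conv f g i w"
  by (simp add: conv_def sum_distrib_left ac_simps)

text \<open>Peeling off the leftmost letter gives products of the same shape with \<open>f\<close>
  replaced by its left derivative, so an induction on the word with \<open>f\<close> free takes the
  place of reindexing a double sum.\<close>

lemma conv_assoc: "conv (conv f g) h i w = conv f (conv g h) i w"
proof (induction w arbitrary: f g)
  case Nil
  show ?case by (simp add: mult.assoc)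
next
  case (Cons x w)
  have "conv (conv f g) h i (x # w) = f (snd x) [] * g (snd x) [] * h i (x # w)
      + conv (\<lambda>j u. f (snd x) [] * g j (x # u) + conv (\<lambda>j u. f j (x # u)) g j u) h i w"
    by (simp add: conv_Cons)
  also have "\<dots> = f (snd x) [] * conv g h i (x # w) + conv (conv (\<lambda>j u. f j (x # u)) g) h i w"
    by (simp add: conv_Cons conv_add_left conv_scale_left distrib_left mult.assoc)
  also have "\<dots> = conv f (conv g h) i (x # w)"
    by (subst Cons.IH) (simp add: conv_Cons)
  finally show ?case .
qed

lemma conv_snoc:
  "conv f g j (w @ [x]) = conv f (\<lambda>i u. g j (u @ [x])) (snd x) w + f j (w @ [x]) * g j []"
  by (induction w arbitrary: f) (simp_all add: conv_Cons)

instantiation pser :: (type, type, comm_ring) ring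
begin

lift_definition zero_pser :: "('a, 'b, 'c) pser" is "\<lambda>_ _. 0" .
lift_definition plus_pser :: "('a, 'b, 'c) pser \<Rightarrow> ('a, 'b, 'c) pser \<Rightarrow> ('a, 'b, 'c) pser"
  is "\<lambda>f g i w. f i w + g i w" .
lift_definition uminus_pser :: "('a, 'b, 'c) pser \<Rightarrow> ('a, 'b, 'c) pser" is "\<lambda>f i w. - f i w" .
lift_definition minus_pser :: "('a, 'b, 'c) pser \<Rightarrow> ('a, 'b, 'c) pser \<Rightarrow> ('a, 'b, 'c) pser"
  is "\<lambda>f g i w. f i w - g i w" .
lift_definition times_pser :: "('a, 'b, 'c) pser \<Rightarrow> ('a, 'b, 'c) pser \<Rightarrow> ('a, 'b, 'c) pser" is conv .

instance
  by standard (transfer; simp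
    add: fun_eq_iff conv_assoc [abs_def] conv_add_left conv_add_right algebra_simps)+

end

lemma coeff_zero [simp]: "coeff 0 i w = 0" by transfer simp
lemma coeff_add [simp]: "coeff (F + G) i w = coeff F i w + coeff G i w" by transfer simp
lemma coeff_minus [simp]: "coeff (F - G) i w = coeff F i w - coeff G i w" by transfer simp
lemma coeff_times: "coeff (F * G) i w = conv (coeff F) (coeff G) i w" by transfer simp
lemma coeff_sum [simp]: "coeff (sum F A) i w = (\<Sum>x\<in>A. coeff (F x) i w)"
  by (induction A rule: infinite_finite_induct) auto

lemma coeff_times_Nil [simp]: "coeff (F * G) i [] = coeff F i [] * coeff G i []"
  by (simp add: coeff_times)

lift_definition smul :: "'k::comm_ring \<Rightarrow> ('v, 'a, 'k) pser \<Rightarrow> ('v, 'a, 'k) pser"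
  is "\<lambda>c f i w. c * f i w" .

lift_definition vtx :: "'v \<Rightarrow> ('v, 'a, 'k::field) pser"
  is "\<lambda>j i w. if w = [] \<and> i = j then 1 else 0" .

lift_definition lder :: "'a \<times> 'v \<Rightarrow> ('v, 'a, 'k) pser \<Rightarrow> ('v, 'a, 'k) pser"
  is "\<lambda>x f i w. f i (x # w)" .

text \<open>A word stores heads only. Deleting the arrow traversed first loses the start
  \<open>j\<close>, which is therefore passed as an argument, and the shortened word has to start at
  \<open>snd x\<close>.\<close>

lift_definition rder :: "'v \<Rightarrow> 'a \<times> 'v \<Rightarrow> ('v, 'a, 'k::field) pser \<Rightarrow> ('v, 'a, 'k) pser"
  is "\<lambda>j x f i w. if i = snd x then f j (w @ [x]) else 0" .

lift_definition arr :: "('v, 'a) quiver \<Rightarrow> 'a \<Rightarrow> ('v, 'a, 'k::field) pser"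
  is "\<lambda>Q a i w. if i = qtail Q a \<and> w = [(a, qhead Q a)] then 1 else 0" .

lemma coeff_smul [simp]: "coeff (smul c F) i w = c * coeff F i w" by transfer simp
lemma coeff_vtx: "coeff (vtx j) i w = (if w = [] \<and> i = j then 1 else 0)" by transfer simp
lemma coeff_lder [simp]: "coeff (lder x F) i w = coeff F i (x # w)" by transfer simp
lemma coeff_rder: "coeff (rder j x F) i w = (if i = snd x then coeff F j (w @ [x]) else 0)"
  by transfer simp
lemma coeff_arr: "coeff (arr Q a) i w = (if i = qtail Q a \<and> w = [(a, qhead Q a)] then 1 else 0)"
  by transfer simp

lemma smul_mult_left [simp]: "smul c F * G = smul c (F * G)"
  by transfer (simp add: fun_eq_iff conv_scale_left)

lemma smul_mult_right [simp]: "F * smul c G = smul c (F * G)"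
  by transfer (simp add: fun_eq_iff conv_scale_right)

lemma smul_1 [simp]: "smul 1 F = (F :: ('v, 'a, 'k::field) pser)" by (rule pser_eqI) simp

lemma smul_sum: "smul c (sum F A) = (\<Sum>x\<in>A. smul c (F x))"
  by (rule pser_eqI) (simp add: sum_distrib_left)

lemma pser_eq_derI:
  assumes "\<And>i. coeff F i [] = coeff G i []" "\<And>x. lder x F = lder x G"
  shows "F = G"
proof (rule pser_eqI)
  fix i w show "coeff F i w = coeff G i w"
    using assms by (cases w) (auto simp flip: coeff_lder)
qed

lemma lder_add [simp]: "lder x (F + G) = lder x F + lder x G" by (rule pser_eqI) simp
lemma lder_zero [simp]: "lder x 0 = 0" by (rule pser_eqI) simp
lemma lder_smul [simp]: "lder x (smul c F) = smul c (lder x F)" by (rule pser_eqI) simp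
lemma lder_sum: "lder x (sum F A) = (\<Sum>y\<in>A. lder x (F y))" by (rule pser_eqI) simp
lemma rder_sum: "rder j x (sum F A) = (\<Sum>y\<in>A. rder j x (F y))"
  by (rule pser_eqI) (simp add: coeff_rder)

text \<open>The leftmost letter of a product belongs to the left factor unless that factor is
  trivial. This is the rule of the Fox derivative, a derivation twisted by the constant
  term.\<close>

lemma lder_mult: "lder x (F * G) = smul (coeff F (snd x) []) (lder x G) + lder x F * G"
proof (rule pser_eqI)
  fix i w
  have "(\<lambda>j u. coeff F j (x # u)) = coeff (lder x F)" by (simp add: fun_eq_iff)
  then show "coeff (lder x (F * G)) i w
        = coeff (smul (coeff F (snd x) []) (lder x G) + lder x F * G) i w"
    by (simp add: coeff_times conv_Cons)
qed

lemma rder_mult: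
  assumes "\<And>i. coeff G i [] = 0"
  shows "rder j x (F * G) = F * rder j x G"
proof -
  have "conv (coeff F) (\<lambda>i u. coeff G j (u @ [x])) (snd x) w
        = conv (coeff F) (coeff (rder j x G)) (snd x) w" for w
    by (simp add: conv_def coeff_rder)
  moreover have "conv (coeff F) (coeff (rder j x G)) i w = 0" if "i \<noteq> snd x" for i w
    using that by (simp add: conv_def coeff_rder)
  ultimately show ?thesis
    by (intro pser_eqI) (auto simp: coeff_rder coeff_times conv_snoc assms)
qed

lemma lder_arr: "lder x (arr Q a) = (if x = (a, qhead Q a) then vtx (qtail Q a) else 0)"
  by (rule pser_eqI) (auto simp: coeff_arr coeff_vtx)

lemma lder_vtx [simp]: "lder x (vtx i) = 0"
  by (rule pser_eqI) (simp add: coeff_vtx)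

lemma coeff_arr_Nil [simp]: "coeff (arr Q a) i [] = 0" by (simp add: coeff_arr)

lemma rder_arr: "rder (qtail Q b) (b, qhead Q b) (arr Q a) = (if a = b then vtx (qhead Q b) else 0)"
  by (rule pser_eqI) (auto simp: coeff_arr coeff_vtx coeff_rder)

lemma coeff_vtx_times: "coeff (vtx j * F) i w = (if wend i w = j then coeff F i w else 0)"
proof -
  have *: "conv (\<lambda>i w. 0) f i w = 0" for f :: "'e \<Rightarrow> ('f \<times> 'e) list \<Rightarrow> 'g::comm_ring" and i w
    by (simp add: conv_def)
  show ?thesis by (cases w) (auto simp: coeff_times conv_Cons coeff_vtx *)
qed

lemma coeff_times_vtx: "coeff (F * vtx j) i w = (if i = j then coeff F i w else 0)"
proof -
  have "coeff (F * vtx j) i w = (\<Sum>n\<le>length w. if n = length w then (if i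
        = j then coeff F i w else 0) else 0)"
    unfolding coeff_times conv_def by (rule sum.cong) (auto simp: coeff_vtx)
  then show ?thesis by simp
qed

lemma coeff_arr_times_Cons:
  "coeff (arr Q a * F) i (x # w) = (if x = (a, qhead Q a) \<and> wend i w
        = qtail Q a then coeff F i w else 0)"
proof -
  have "coeff (arr Q a * F) i (x # w) = coeff (lder x (arr Q a * F)) i w" by simp
  also have "\<dots> = (if x = (a, qhead Q a) \<and> wend i w = qtail Q a then coeff F i w else 0)"
    unfolding lder_mult lder_arr by (auto simp: coeff_vtx_times)
  finally show ?thesis .
qed

lemma coeff_times_arr_snoc:
  "coeff (F * arr Q a) i (w @ [x]) = (if x = (a, qhead Q a) \<and> i
        = qtail Q a then coeff F (qhead Q a) w else 0)"
proof -
  have "coeff (F * arr Q a) i (w @ [x]) = coeff (rder i x (F * arr Q a)) (snd x) w"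
    by (simp add: coeff_rder)
  also have "rder i x (F * arr Q a) = F * rder i x (arr Q a)" by (rule rder_mult) simp
  also have "rder i x (arr Q a) = (if x = (a, qhead Q a) \<and> i
        = qtail Q a then vtx (qhead Q a) else 0)"
    by (rule pser_eqI) (auto simp: coeff_rder coeff_arr coeff_vtx)
  finally show ?thesis by (auto simp: coeff_times_vtx)
qed

section \<open>The filtration by powers of the arrow ideal, and endpoint components\<close>

definition order_ge :: "nat \<Rightarrow> ('v, 'a, 'k::comm_ring) pser \<Rightarrow> bool" where
  "order_ge n F \<longleftrightarrow> (\<forall>i w. length w < n \<longrightarrow> coeff F i w = 0)"

lemma order_ge_0 [simp]: "order_ge 0 F" by (simp add: order_ge_def)
lemma order_ge_add: "order_ge n F \<Longrightarrow> order_ge n G \<Longrightarrow> order_ge n (F + G)" by (simp add: order_ge_def)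
lemma order_ge_sum: "(\<And>x. x \<in> A \<Longrightarrow> order_ge n (F x)) \<Longrightarrow> order_ge n (sum F A)"
  by (simp add: order_ge_def)
lemma order_ge_1: "order_ge 1 F \<longleftrightarrow> (\<forall>i. coeff F i [] = 0)" by (simp add: order_ge_def)

lemma order_ge_Suc_mult:
  assumes "order_ge 1 X" "order_ge n F" shows "order_ge (Suc n) (X * F)"
  unfolding order_ge_def
proof (intro allI impI)
  fix i and w :: "('b \<times> 'a) list" assume "length w < Suc n"
  have "coeff X (wend i (drop m w)) (take m w) * coeff F i (drop m w) = 0" if "m \<le> length w" for m
  proof (cases "m = 0")
    case True then show ?thesis using assms(1) by (simp add: order_ge_def)
  next
    case False
    then have "length (drop m w) < n" using that \<open>length w < Suc n\<close> by simp
    then show ?thesis using assms(2) by (simp add: order_ge_def)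
  qed
  then show "coeff (X * F) i w = 0" by (simp add: coeff_times conv_def)
qed

text \<open>The filtration is separated, since each coefficient sits in one degree; identities of
  series may thus be proved modulo all powers of the arrow ideal.\<close>

lemma order_ge_eqI: "(\<And>n. order_ge n (F - G)) \<Longrightarrow> F = G"
  by (rule pser_eqI) (metis coeff_minus lessI order_ge_def right_minus_eq)

definition between :: "'v \<Rightarrow> 'v \<Rightarrow> ('v, 'a, 'k::comm_ring) pser \<Rightarrow> bool" where
  "between i j F \<longleftrightarrow> (\<forall>l w. coeff F l w \<noteq> 0 \<longrightarrow> wend l w = i \<and> l = j)"

text \<open>As a ring identity the condition is preserved by every homomorphism that fixes the
  idempotents.\<close>

lemma between_iff: "between i j (F :: ('v, 'a, 'k::field) pser) \<longleftrightarrow> vtx i * F * vtx j = F"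
proof
  assume "between i j F"
  then show "vtx i * F * vtx j = F"
    by (intro pser_eqI) (auto simp: between_def coeff_vtx_times coeff_times_vtx)
next
  assume *: "vtx i * F * vtx j = F"
  have "coeff F l w = (if wend l w = i \<and> l = j then coeff F l w else 0)" for l w
    by (subst * [symmetric]) (auto simp: coeff_vtx_times coeff_times_vtx)
  then show "between i j F" unfolding between_def by metis
qed

lemma between_arr: "between (qhead Q a) (qtail Q a) (arr Q a)" by (auto simp: between_def coeff_arr)

lemma vtx_between: "between i j F \<Longrightarrow> vtx i * F = F"
  by (rule pser_eqI) (auto simp: coeff_vtx_times between_def)
lemma between_vtx: "between i j F \<Longrightarrow> F * vtx j = F"
  by (rule pser_eqI) (auto simp: coeff_times_vtx between_def)

lemma between_mult: "between i j F \<Longrightarrow> between j l G \<Longrightarrow>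
      between i l (F * (G :: ('v, 'a, 'k::field) pser))"
proof -
  assume *: "between i j F" "between j l G"
  have "vtx i * (F * G) * vtx l = (vtx i * F) * (G * vtx l)" by (simp only: mult.assoc)
  then show ?thesis using * by (simp add: between_iff [of i l] vtx_between between_vtx)
qed

lemma between_sum: "(\<And>x. x \<in> A \<Longrightarrow> between i j (F x)) \<Longrightarrow> between i j (sum F A)"
  unfolding between_def coeff_sum by (meson sum.not_neutral_contains_not_neutral)

lemma between_vtxI: "between i i (vtx i)" by (auto simp: between_def coeff_vtx)

fun qpath :: "('v, 'a) quiver \<Rightarrow> 'v \<Rightarrow> ('a \<times> 'v) list \<Rightarrow> bool" where
  "qpath Q i [] \<longleftrightarrow> i \<in> qverts Q"
| "qpath Q i (x # w) \<longleftrightarrow> fst x \<in> qarrs Q \<and> snd x = qhead Q (fst x) \<and> qtail Q (fst x)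
      = wend i w \<and> qpath Q i w"

section \<open>Complete path algebras and their homomorphisms\<close>

definition path_series :: "('v, 'a) quiver \<Rightarrow> ('v, 'a, 'k::field) pser set" where
  "path_series Q = {F. \<forall>i w. coeff F i w \<noteq> 0 \<longrightarrow> qpath Q i w}"

lemma path_series_D: "F \<in> path_series Q \<Longrightarrow> coeff F i w \<noteq> 0 \<Longrightarrow> qpath Q i w"
  by (simp add: path_series_def)

locale loopfree =
  fixes Q :: "('v, 'a) quiver"
  assumes finite_verts: "finite (qverts Q)" and finite_arrs: "finite (qarrs Q)"
    and ends_in: "a \<in> qarrs Q \<Longrightarrow> qhead Q a \<in> qverts Q \<and> qtail Q a \<in> qverts Q"
    and no_loop: "a \<in> qarrs Q \<Longrightarrow> qhead Q a \<noteq> qtail Q a"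

lemma zero_path_series [simp]: "0 \<in> path_series Q" by (simp add: path_series_def)
lemma add_path_series: "F \<in> path_series Q \<Longrightarrow> G \<in> path_series Q \<Longrightarrow> F + G \<in> path_series Q"
  by (auto simp: path_series_def) force
lemma smul_path_series: "F \<in> path_series Q \<Longrightarrow> smul c F \<in> path_series Q"
  by (auto simp: path_series_def)
lemma sum_path_series: "(\<And>x. x \<in> A \<Longrightarrow> F x \<in> path_series Q) \<Longrightarrow> sum F A \<in> path_series Q"
  by (induction A rule: infinite_finite_induct) (auto intro: add_path_series)
lemma vtx_path_series: "i \<in> qverts Q \<Longrightarrow> vtx i \<in> path_series Q"
  by (auto simp: path_series_def coeff_vtx)
lemma (in loopfree) arr_path_series: "a \<in> qarrs Q \<Longrightarrow> arr Q a \<in> path_series Q" using ends_in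
  by (auto simp: path_series_def coeff_arr)
lemma lder_path_series: "F \<in> path_series Q \<Longrightarrow> lder x F \<in> path_series Q"
  by (fastforce simp: path_series_def)

lemma qpath_append: "qpath Q (wend i v) u \<Longrightarrow> qpath Q i v \<Longrightarrow> qpath Q i (u @ v)"
  by (induction u) (auto simp: wend_append)

lemma (in loopfree) qpath_snocD: "qpath Q j (w @ [x]) \<Longrightarrow> qpath Q (snd x) w"
  by (induction w) (auto simp: wend_append ends_in)

lemma (in loopfree) rder_path_series: "F \<in> path_series Q \<Longrightarrow> rder j x F \<in> path_series Q"
proof -
  assume "F \<in> path_series Q"
  then have "qpath Q (snd x) w" if "coeff F j (w @ [x]) \<noteq> 0" for w
    using that by (intro qpath_snocD [of j]) (auto simp: path_series_def)
  then show ?thesis by (simp add: path_series_def coeff_rder)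
qed

lemma mult_path_series: assumes "F \<in> path_series Q" "G \<in> path_series Q"
  shows "F * G \<in> path_series Q"
proof -
  have "qpath Q i w" if nz: "coeff (F * G) i w \<noteq> 0" for i w
  proof -
    obtain n where "coeff F (wend i (drop n w)) (take n w) * coeff G i (drop n w) \<noteq> 0"
      using sum.not_neutral_contains_not_neutral [OF nz [unfolded coeff_times conv_def]] by blast
    then have "qpath Q (wend i (drop n w)) (take n w)" "qpath Q i (drop n w)"
      using assms by (auto simp: path_series_def)
    then show ?thesis using qpath_append [of Q i "drop n w" "take n w"] by simp
  qed
  then show ?thesis by (simp add: path_series_def)
qed

text \<open>The two arrow types are independent: a homomorphism over R does not change the R-part,
  so it is extracted in one algebra and read in the other.\<close>

definition Rpart :: "'v set \<Rightarrow> ('v, 'a, 'k::field) pser \<Rightarrow> ('v, 'b, 'k) pser" where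
  "Rpart V F = (\<Sum>i\<in>V. smul (coeff F i []) (vtx i))"

lemma coeff_Rpart: "finite V \<Longrightarrow> coeff (Rpart V F) i w = (if w = [] \<and> i \<in> V then coeff F i [] else 0)"
proof -
  assume "finite V"
  have "coeff (Rpart V F) i w = (\<Sum>j\<in>V. if j = i then (if w = [] then coeff F i [] else 0) else 0)"
    unfolding Rpart_def coeff_sum by (rule sum.cong) (auto simp: coeff_vtx)
  then show ?thesis using \<open>finite V\<close> by simp
qed

abbreviation la :: "('v, 'a) quiver \<Rightarrow> 'a \<Rightarrow> ('v, 'a, 'k) pser \<Rightarrow> ('v, 'a, 'k) pser" where
  "la Q a F \<equiv> lder (a, qhead Q a) F"

abbreviation ra :: "('v, 'a) quiver \<Rightarrow> 'a \<Rightarrow> ('v, 'a, 'k::field) pser \<Rightarrow> ('v, 'a, 'k) pser" where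
  "ra Q a F \<equiv> rder (qtail Q a) (a, qhead Q a) F"

context loopfree
begin

text \<open>A nontrivial path has exactly one leftmost arrow. Read as a recursion, this expansion
  underlies both existence and uniqueness of homomorphisms.\<close>

lemma la_decomp:
  fixes F :: "('v, 'a, 'k::field) pser"
  assumes "F \<in> path_series Q"
  shows "F = Rpart (qverts Q) F + (\<Sum>a\<in>qarrs Q. arr Q a * la Q a F)"
proof (rule pser_eqI)
  fix i w
  show "coeff F i w = coeff (Rpart (qverts Q) F + (\<Sum>a\<in>qarrs Q. arr Q a * la Q a F)) i w"
  proof (cases w)
    case Nil
    then show ?thesis using path_series_D [OF assms, of i "[]"]
      by (auto simp: coeff_Rpart finite_verts)
  next
    case (Cons x u)
    obtain c h where [simp]: "x = (c, h)" by (cases x)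
    have "coeff (Rpart (qverts Q) F + (\<Sum>a\<in>qarrs Q. arr Q a * la Q a F)) i w
        = (\<Sum>a\<in>qarrs Q.
          if a = fst x then
          (if snd x = qhead Q a \<and> wend i u = qtail Q a then coeff F i w else 0) else 0)"
      using Cons by (auto simp: coeff_Rpart finite_verts coeff_arr_times_Cons intro!: sum.cong)
    also have "\<dots> = coeff F i w"
      using path_series_D [OF assms, of i w] Cons
        by (cases "coeff F i w = 0") (auto simp: finite_arrs)
    finally show ?thesis by simp
  qed
qed

lemma ra_decomp:
  fixes F :: "('v, 'a, 'k::field) pser"
  assumes "F \<in> path_series Q" "order_ge 1 F"
  shows "F = (\<Sum>a\<in>qarrs Q. ra Q a F * arr Q a)"
proof (rule pser_eqI)
  fix i w
  show "coeff F i w = coeff (\<Sum>a\<in>qarrs Q. ra Q a F * arr Q a) i w"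
  proof (cases w rule: rev_cases)
    case Nil
    then show ?thesis using assms(2) by (auto simp: order_ge_def)
  next
    case (snoc u x)
    obtain c h where [simp]: "x = (c, h)" by (cases x)
    have "coeff (\<Sum>a\<in>qarrs Q. ra Q a F * arr Q a) i w
        = (\<Sum>a\<in>qarrs Q.
          if a = fst x then (if snd x = qhead Q a \<and> i = qtail Q a then coeff F i w else 0) else 0)"
      using snoc by (auto simp: coeff_times_arr_snoc coeff_rder intro!: sum.cong)
    also have "\<dots> = coeff F i w"
    proof -
      have "fst x \<in> qarrs Q \<and> snd x = qhead Q (fst x) \<and> i = qtail Q (fst x)"
        if "qpath Q i (u @ [x])" for u
        using that by (induction u) auto
      from this [of u] have "c \<in> qarrs Q \<and> h = qhead Q c \<and> i = qtail Q c" if "coeff F i w \<noteq> 0"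
        using path_series_D [OF assms(1) that] snoc by auto
      then show ?thesis by (cases "coeff F i w = 0") (auto simp: finite_arrs)
    qed
    finally show ?thesis by simp
  qed
qed

lemma between_la: "F \<in> path_series Q \<Longrightarrow> between i j F \<Longrightarrow> between (qtail Q a) j (la Q a F)"
  unfolding between_def by (auto dest: path_series_D)

lemma la_other: "between i j F \<Longrightarrow> qhead Q a \<noteq> i \<Longrightarrow> la Q a F = 0"
proof (rule pser_eqI)
  fix l w assume *: "between i j F" "qhead Q a \<noteq> i"
  have "coeff F l ((a, qhead Q a) # w) = 0"
  proof (rule ccontr)
    assume "coeff F l ((a, qhead Q a) # w) \<noteq> 0"
    then have "wend l ((a, qhead Q a) # w) = i" using *(1) unfolding between_def by blast
    then show False using *(2) by simp
  qed
  then show "coeff (la Q a F) l w = coeff 0 l w" by simp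
qed

lemma between_ra: "between i j F \<Longrightarrow> between i (qhead Q a) (ra Q a F)"
proof -
  assume "between i j F"
  have "wend (qhead Q a) w = i" if "coeff F (qtail Q a) (w @ [(a, qhead Q a)]) \<noteq> 0" for w
  proof -
    have "wend (qtail Q a) (w @ [(a, qhead Q a)]) = i"
      using that \<open>between i j F\<close> unfolding between_def by blast
    then show ?thesis by (simp add: wend_append)
  qed
  then show ?thesis by (simp add: between_def coeff_rder)
qed

lemma ra_other: "between i j F \<Longrightarrow> qtail Q a \<noteq> j \<Longrightarrow> ra Q a F = 0"
  by (rule pser_eqI) (auto simp: between_def coeff_rder)

end

text \<open>Scalars enter through the fixed elements c e_i, which gives linearity over K; continuity
  will follow from the values on arrows.\<close>

definition pa_hom :: "('v, 'a) quiver \<Rightarrow> ('v, 'b) quiver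
    \<Rightarrow> (('v, 'a, 'k::field) pser \<Rightarrow> ('v, 'b, 'k) pser) \<Rightarrow> bool" where
  "pa_hom Q Q' \<psi> \<longleftrightarrow>
     (\<forall>F\<in>path_series Q. \<psi> F \<in> path_series Q') \<and>
     (\<forall>F\<in>path_series Q. \<forall>G\<in>path_series Q. \<psi> (F + G) = \<psi> F + \<psi> G) \<and>
     (\<forall>F\<in>path_series Q. \<forall>G\<in>path_series Q. \<psi> (F * G) = \<psi> F * \<psi> G) \<and>
     (\<forall>c. \<forall>i\<in>qverts Q. \<psi> (smul c (vtx i)) = smul c (vtx i))"

text \<open>A constant term is carried by a trivial path, whose ends coincide. In a loop-free quiver
  this puts the images of all arrows into the arrow ideal.\<close>

lemma between_imp_order_ge_1: "between i j F \<Longrightarrow> i \<noteq> j \<Longrightarrow> order_ge 1 F"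
  unfolding between_def order_ge_1 using wend_simps(1) by metis

locale pser_hom = loopfree Q for Q :: "('v, 'a) quiver" +
  fixes Q' :: "('v, 'b) quiver" and \<psi> :: "('v, 'a, 'k::field) pser \<Rightarrow> ('v, 'b, 'k) pser"
  assumes hom: "pa_hom Q Q' \<psi>"
begin

lemma hom_in_path_series: "F \<in> path_series Q \<Longrightarrow> \<psi> F \<in> path_series Q'" using hom
  by (simp add: pa_hom_def)
lemma hom_add: "F \<in> path_series Q \<Longrightarrow> G \<in> path_series Q \<Longrightarrow> \<psi> (F + G) = \<psi> F + \<psi> G" using hom
  by (simp add: pa_hom_def)
lemma hom_mult: "F \<in> path_series Q \<Longrightarrow> G \<in> path_series Q \<Longrightarrow> \<psi> (F * G) = \<psi> F * \<psi> G" using hom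
  by (simp add: pa_hom_def)
lemma hom_svtx: "i \<in> qverts Q \<Longrightarrow> \<psi> (smul c (vtx i)) = smul c (vtx i)" using hom
  by (simp add: pa_hom_def)
lemma hom_vtx: "i \<in> qverts Q \<Longrightarrow> \<psi> (vtx i) = vtx i" using hom_svtx [of i 1] by simp
lemma hom_zero: "\<psi> 0 = 0" using hom_add [of 0 0] by simp

lemma hom_sum: "(\<And>x. x \<in> A \<Longrightarrow> F x \<in> path_series Q) \<Longrightarrow> \<psi> (sum F A) = (\<Sum>x\<in>A. \<psi> (F x))"
  by (induction A rule: infinite_finite_induct) (auto simp: hom_zero hom_add sum_path_series)

lemma hom_Rpart: "\<psi> (Rpart (qverts Q) F) = Rpart (qverts Q) F"
  unfolding Rpart_def by (subst hom_sum) (auto simp: hom_svtx smul_path_series vtx_path_series)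

lemma hom_between:
  assumes "F \<in> path_series Q" "between i j F" "i \<in> qverts Q" "j \<in> qverts Q"
  shows "between i j (\<psi> F)"
proof -
  have "\<psi> (vtx i * F * vtx j) = vtx i * \<psi> F * vtx j"
    using assms by (simp add: hom_mult hom_vtx mult_path_series vtx_path_series)
  then show ?thesis using assms(2) by (simp add: between_iff)
qed

lemma between_image_arr: "a \<in> qarrs Q \<Longrightarrow> between (qhead Q a) (qtail Q a) (\<psi> (arr Q a))"
  by (simp add: hom_between between_arr arr_path_series ends_in)

lemma hom_order_ge_arr: "a \<in> qarrs Q \<Longrightarrow> order_ge 1 (\<psi> (arr Q a))"
  using between_imp_order_ge_1 [OF between_image_arr no_loop] .

lemma hom_decomp:
  assumes "F \<in> path_series Q"
  shows "\<psi> F = Rpart (qverts Q) F + (\<Sum>a\<in>qarrs Q. \<psi> (arr Q a) * \<psi> (la Q a F))"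
proof -
  have "\<psi> F = \<psi> (Rpart (qverts Q) F + (\<Sum>a\<in>qarrs Q. arr Q a * la Q a F))"
    using la_decomp [OF assms] by simp
  also have "\<dots> = \<psi> (Rpart (qverts Q) F) + \<psi> (\<Sum>a\<in>qarrs Q. arr Q a * la Q a F)"
    by (rule hom_add) (auto
      simp: Rpart_def intro!: sum_path_series smul_path_series vtx_path_series mult_path_series arr_path_series lder_path_series assms)
  also have "\<psi> (\<Sum>a\<in>qarrs Q. arr Q a * la Q a F) = (\<Sum>a\<in>qarrs Q. \<psi> (arr Q a * la Q a F))"
    by (rule hom_sum) (auto intro!: mult_path_series arr_path_series lder_path_series assms)
  also have "\<dots> = (\<Sum>a\<in>qarrs Q. \<psi> (arr Q a) * \<psi> (la Q a F))"
    by (intro sum.cong refl hom_mult) (auto intro!: arr_path_series lder_path_series assms)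
  finally show ?thesis by (simp add: hom_Rpart)
qed

end

text \<open>Expanding along the leftmost arrow expresses the difference of the two maps at F by
  their differences at the derivatives of F, each behind an arrow image without constant term. Every
  round gains one degree, so the values on arrows determine the map on infinite series as
  well.\<close>

lemma pa_hom_eqI:
  assumes "loopfree Q" "pa_hom Q Q1 \<psi>1" "pa_hom Q Q2 \<psi>2"
    and "\<And>a. a \<in> qarrs Q \<Longrightarrow> \<psi>1 (arr Q a) = \<psi>2 (arr Q a)" and "F \<in> path_series Q"
  shows "\<psi>1 F = \<psi>2 F"
proof -
  interpret A: pser_hom Q Q1 \<psi>1 using assms by (simp add: pser_hom_def pser_hom_axioms_def)
  interpret B: pser_hom Q Q2 \<psi>2 using assms by (simp add: pser_hom_def pser_hom_axioms_def)
  have "F \<in> path_series Q \<Longrightarrow> order_ge n (\<psi>1 F - \<psi>2 F)" for n F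
  proof (induction n arbitrary: F)
    case (Suc n)
    have "\<psi>1 F - \<psi>2 F = (\<Sum>a\<in>qarrs Q. \<psi>1 (arr Q a) * (\<psi>1 (la Q a F) - \<psi>2 (la Q a F)))"
      by (simp add: A.hom_decomp [OF Suc.prems] B.hom_decomp [OF Suc.prems] assms(4) right_diff_distrib sum_subtractf)
    then show ?case
      by (auto intro!: order_ge_sum order_ge_Suc_mult A.hom_order_ge_arr Suc lder_path_series)
  qed simp
  then show ?thesis using assms(5) by (blast intro: order_ge_eqI)
qed

text \<open>A homomorphism with prescribed arrow images is the limit of the iteration of
  \<open>F = F\<^sub>0 + \<Sum>\<^sub>a a \<partial>\<^sub>aF\<close>; arrow images have no constant term because there are no loops.\<close>
primrec ext_approx :: "('v, 'a) quiver \<Rightarrow> ('a \<Rightarrow> ('v, 'b, 'k::field) pser) \<Rightarrow> nat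
    \<Rightarrow> ('v, 'a, 'k) pser \<Rightarrow> ('v, 'b, 'k) pser" where
  "ext_approx Q x 0 F = 0"
| "ext_approx Q x (Suc n) F = Rpart (qverts Q) F + (\<Sum>a\<in>qarrs Q. x a * ext_approx Q x n (la Q a F))"

text \<open>The coefficient of a word of length n no longer changes from approximation n + 1 on, so
  the limit is read off there.\<close>

definition pa_ext :: "('v, 'a) quiver \<Rightarrow> ('a \<Rightarrow> ('v, 'b, 'k::field) pser)
    \<Rightarrow> ('v, 'a, 'k) pser \<Rightarrow> ('v, 'b, 'k) pser" where
  "pa_ext Q x F = Pser (\<lambda>i w. coeff (ext_approx Q x (Suc (length w)) F) i w)"

locale pa_extension = loopfree Q for Q :: "('v, 'a) quiver" +
  fixes Q' :: "('v, 'b) quiver" and x :: "'a \<Rightarrow> ('v, 'b, 'k::field) pser"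
  assumes verts: "qverts Q' = qverts Q"
    and x_path_series: "a \<in> qarrs Q \<Longrightarrow> x a \<in> path_series Q'"
    and x_between: "a \<in> qarrs Q \<Longrightarrow> between (qhead Q a) (qtail Q a) (x a)"
begin

lemma x_ord: "a \<in> qarrs Q \<Longrightarrow> order_ge 1 (x a)"
  using between_imp_order_ge_1 [OF x_between no_loop] .

lemma approx_step: "order_ge n (ext_approx Q x (Suc n) F - ext_approx Q x n F)"
proof (induction n arbitrary: F)
  case (Suc n)
  have "ext_approx Q x (Suc (Suc n)) F - ext_approx Q x (Suc n) F =
     (\<Sum>a\<in>qarrs Q. x a * (ext_approx Q x (Suc n) (la Q a F) - ext_approx Q x n (la Q a F)))"
    by (simp only: ext_approx.simps(2) [of Q x _ F] add_diff_cancel_left right_diff_distrib sum_subtractf)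
  then show ?case by (simp only:) (intro order_ge_sum order_ge_Suc_mult x_ord Suc.IH)
qed simp

lemma approx_ge: "length w < n \<Longrightarrow> coeff (ext_approx Q x n F) i w = coeff (pa_ext Q x F) i w"
proof (induction n)
  case (Suc n)
  show ?case
  proof (cases "length w = n")
    case True then show ?thesis by (simp add: pa_ext_def del: ext_approx.simps)
  next
    case False
    then have "length w < n" using Suc.prems by simp
    then show ?thesis using Suc.IH approx_step [of n F]
      by (simp add: order_ge_def del: ext_approx.simps)
  qed
qed simp

lemma approx_ord: "order_ge n (ext_approx Q x n F - pa_ext Q x F)"
  by (simp add: order_ge_def approx_ge)

text \<open>The recursion passes to the limit: for every n, both sides agree with approximation n +
  1 in all degrees up to n.\<close>

lemma ext_decomp: "pa_ext Q x F = Rpart (qverts Q) F + (\<Sum>a\<in>qarrs Q. x a * pa_ext Q x (la Q a F))"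
  (is "_ = ?R")
proof (rule order_ge_eqI)
  fix n
  have "ext_approx Q x (Suc n) F - ?R
        = (\<Sum>a\<in>qarrs Q. x a * (ext_approx Q x n (la Q a F) - pa_ext Q x (la Q a F)))"
    by (simp add: right_diff_distrib sum_subtractf)
  then have "order_ge (Suc n) (ext_approx Q x (Suc n) F - ?R)"
    by (simp only:) (intro order_ge_sum order_ge_Suc_mult x_ord approx_ord)
  with approx_ord [of "Suc n" F] show "order_ge n (pa_ext Q x F - ?R)"
    by (simp add: order_ge_def del: ext_approx.simps)
qed

lemma approx_add: "ext_approx Q x n (F + G) = ext_approx Q x n F + ext_approx Q x n G"
proof (induction n arbitrary: F G)
  case (Suc n)
  have "Rpart (qverts Q) (F + G) = (Rpart (qverts Q) F + Rpart (qverts Q) G :: ('v, 'b, 'k) pser)"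
    by (rule pser_eqI) (simp add: coeff_Rpart finite_verts)
  then show ?case by (simp add: Suc.IH distrib_left sum.distrib)
qed simp

lemma approx_smul: "ext_approx Q x n (smul c F) = smul c (ext_approx Q x n F)"
proof (induction n arbitrary: F)
  case (Suc n)
  have "Rpart (qverts Q) (smul c F) = (smul c (Rpart (qverts Q) F) :: ('v, 'b, 'k) pser)"
    by (rule pser_eqI) (simp add: coeff_Rpart finite_verts)
  moreover have "smul c (F + G) = smul c F + smul c G" for F G :: "('v, 'b, 'k) pser"
    by (rule pser_eqI) (simp add: distrib_left)
  ultimately show ?case by (simp add: Suc.IH smul_sum)
qed (simp add: pser_eqI)

lemma ext_add: "pa_ext Q x (F + G) = pa_ext Q x F + pa_ext Q x G"
  by (rule pser_eqI) (simp add: pa_ext_def approx_add del: ext_approx.simps)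

lemma ext_smul: "pa_ext Q x (smul c F) = smul c (pa_ext Q x F)"
  by (rule pser_eqI) (simp add: pa_ext_def approx_smul del: ext_approx.simps)

lemma ext_zero: "pa_ext Q x 0 = 0" using ext_add [of 0 0] by simp

lemma approx_path_series: "ext_approx Q x n F \<in> path_series Q'"
  by (induction n arbitrary: F)
    (auto simp: Rpart_def verts intro!: add_path_series sum_path_series smul_path_series vtx_path_series mult_path_series x_path_series)

lemma ext_path_series: "pa_ext Q x F \<in> path_series Q'"
  using approx_path_series unfolding path_series_def pa_ext_def by (auto simp del: ext_approx.simps)

lemma vtx_x: "a \<in> qarrs Q \<Longrightarrow> vtx i * x a = (if i = qhead Q a then x a else 0)"
  using x_between [of a] by (intro pser_eqI) (auto simp: coeff_vtx_times between_def)

lemma Rpart_x: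
  assumes "a \<in> qarrs Q"
  shows "Rpart (qverts Q) F * x a = smul (coeff F (qhead Q a) []) (x a)"
proof -
  have "Rpart (qverts Q) F * x a = (\<Sum>i\<in>qverts Q. smul (coeff F i []) (vtx i * x a))"
    by (simp add: Rpart_def sum_distrib_right)
  also have "\<dots> = (\<Sum>i\<in>qverts Q. if i = qhead Q a then smul (coeff F i []) (x a) else 0)"
    by (rule sum.cong) (auto simp: vtx_x assms intro: pser_eqI)
  finally show ?thesis using ends_in [OF assms] by (simp add: finite_verts)
qed

text \<open>After expansion the constant parts cancel, and there remains the same multiplicative
  defect for the derivatives \<open>la Q a F\<close> with G unchanged, each behind a factor
  \<open>x a\<close> of positive order. So the induction runs over the order of the defect, with F
  varying.\<close>

lemma ext_mult: "pa_ext Q x (F * G) = pa_ext Q x F * pa_ext Q x G"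
proof (rule order_ge_eqI)
  fix n
  show "order_ge n (pa_ext Q x (F * G) - pa_ext Q x F * pa_ext Q x G)"
  proof (induction n arbitrary: F)
    case (Suc n)
    let ?E = "pa_ext Q x" and ?R = "\<lambda>F. Rpart (qverts Q) F :: ('v, 'b, 'k) pser"
    have R: "?R (F * G) = ?R F * ?R G"
    proof (rule pser_eqI)
      fix i and w :: "('b \<times> 'v) list"
      have *: "coeff (?R F * ?R G) i (y # u) = 0" for y u
        unfolding coeff_lder [symmetric] lder_mult
        by (simp add: coeff_Rpart finite_verts coeff_times conv_def)
      show "coeff (?R (F * G)) i w = coeff (?R F * ?R G) i w"
        by (cases w) (simp_all add: * coeff_Rpart finite_verts)
    qed
    \<comment> \<open>The constant part of F acts on \<open>x a\<close> only through the head of a;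
      this is exactly the twisted term of \<open>lder_mult\<close>.\<close>
    have "?R F * (\<Sum>a\<in>qarrs Q. x a * ?E (la Q a G)) = (\<Sum>a\<in>qarrs Q. (?R F * x a) * ?E (la Q a G))"
      by (simp add: sum_distrib_left mult.assoc)
    also have "\<dots> = (\<Sum>a\<in>qarrs Q. smul (coeff F (qhead Q a) []) (x a * ?E (la Q a G)))"
      by (intro sum.cong refl) (simp add: Rpart_x)
    finally have 1: "?R F * (\<Sum>a\<in>qarrs Q. x a * ?E (la Q a G)) = \<dots>" .
    have "?E (F * G) = ?R F * ?R G + (\<Sum>a\<in>qarrs Q. x a * ?E (la Q a (F * G)))"
      by (subst ext_decomp) (simp add: R)
    also have "\<dots>
          = ?R F * ?R G + (\<Sum>a\<in>qarrs Q. smul (coeff F (qhead Q a) []) (x a * ?E (la Q a G)) + x a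
          * ?E (la Q a F * G))"
      by (simp add: lder_mult ext_add ext_smul distrib_left)
    finally have A: "?E (F * G)
          = ?R F * ?R G + ?R F * (\<Sum>a\<in>qarrs Q. x a * ?E (la Q a G)) + (\<Sum>a\<in>qarrs Q. x a * ?E (la Q a F
          * G))"
      by (simp add: sum.distrib 1 add.assoc)
    have "?E F * ?E G = ?R F * ?E G + (\<Sum>a\<in>qarrs Q. x a * (?E (la Q a F) * ?E G))"
      by (subst ext_decomp [of F]) (simp add: distrib_right sum_distrib_right mult.assoc)
    also have "?R F * ?E G = ?R F * ?R G + ?R F * (\<Sum>a\<in>qarrs Q. x a * ?E (la Q a G))"
      by (subst ext_decomp [of G]) (simp add: distrib_left)
    finally have "?E (F * G) - ?E F * ?E G
          = (\<Sum>a\<in>qarrs Q. x a * (?E (la Q a F * G) - ?E (la Q a F) * ?E G))"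
      by (simp add: A right_diff_distrib sum_subtractf)
    then show ?case by (simp only:) (intro order_ge_sum order_ge_Suc_mult x_ord Suc.IH)
  qed simp
qed

lemma ext_svtx: "i \<in> qverts Q \<Longrightarrow> pa_ext Q x (smul c (vtx i)) = smul c (vtx i)"
  by (subst ext_decomp) (auto simp: ext_smul ext_zero intro!: pser_eqI
    simp: coeff_Rpart finite_verts coeff_vtx)

lemma ext_hom: "pa_hom Q Q' (pa_ext Q x)"
  by (simp add: pa_hom_def ext_path_series ext_add ext_mult ext_svtx)

lemma ext_arr: assumes "a \<in> qarrs Q" shows "pa_ext Q x (arr Q a) = x a"
proof -
  have "pa_ext Q x (arr Q a) = (\<Sum>b\<in>qarrs Q. x b * pa_ext Q x (la Q b (arr Q a)))"
    by (subst ext_decomp) (auto simp: Rpart_def intro!: pser_eqI)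
  also have "\<dots> = (\<Sum>b\<in>qarrs Q. if b = a then x a * vtx (qtail Q a) else 0)"
    using ext_svtx [of "qtail Q a" 1] ends_in [OF assms]
    by (intro sum.cong) (auto simp: lder_arr ext_zero)
  also have "\<dots> = x a" using assms by (simp add: finite_arrs between_vtx [OF x_between])
  finally show ?thesis .
qed

end

section \<open>The bracket map\<close>

lemma mquiver_verts [simp]: "qverts (mquiver Q k) = qverts Q" by (simp add: mquiver_def)

lemma mquiver_arrs [simp]:
  "Old a \<in> qarrs (mquiver Q k) \<longleftrightarrow> a \<in> qarrs Q \<and> qhead Q a \<noteq> k \<and> qtail Q a \<noteq> k"
  "Comp b a \<in> qarrs (mquiver Q k) \<longleftrightarrow> a \<in> qarrs Q \<and> b \<in> qarrs Q \<and> qhead Q a = k \<and> qtail Q b = k"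
  "Star c \<in> qarrs (mquiver Q k) \<longleftrightarrow> c \<in> qarrs Q \<and> (qhead Q c = k \<or> qtail Q c = k)"
  by (auto simp: mquiver_def)

lemma mquiver_ends [simp]:
  "qhead (mquiver Q k) (Old a) = qhead Q a" "qtail (mquiver Q k) (Old a) = qtail Q a"
  "qhead (mquiver Q k) (Comp b a) = qhead Q b" "qtail (mquiver Q k) (Comp b a) = qtail Q a"
  "qhead (mquiver Q k) (Star a) = (if qhead Q a = k then qtail Q a else k)"
  "qtail (mquiver Q k) (Star a) = (if qhead Q a = k then k else qhead Q a)"
  by (auto simp: mquiver_def)

text \<open>The substitution is encoded by its inverse, which expands letters; coefficients can then
  be pulled back along it. A starred arrow has no expansion: the empty word is a dummy value,
  excluded by \<open>ok_letter\<close>.\<close>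

fun unbracket_letter :: "'v \<Rightarrow> 'a marrow \<times> 'v \<Rightarrow> ('a \<times> 'v) list" where
  "unbracket_letter k (Old a, h) = [(a, h)]"
| "unbracket_letter k (Comp b a, h) = [(b, h), (a, k)]"
| "unbracket_letter k (Star a, h) = []"

text \<open>Arrows at k may occur only inside composites. The condition on tails decides whether the
  next arrow of the underlying path opens a composite, which makes expansion injective on admissible
  words.\<close>

fun ok_letter :: "('v, 'a) quiver \<Rightarrow> 'v \<Rightarrow> 'a marrow \<times> 'v \<Rightarrow> bool" where
  "ok_letter Q k (Old a, h) \<longleftrightarrow> h \<noteq> k \<and> qtail Q a \<noteq> k"
| "ok_letter Q k (Comp b a, h) \<longleftrightarrow> qtail Q b = k"
| "ok_letter Q k (Star a, h) \<longleftrightarrow> False"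

definition unbracket :: "'v \<Rightarrow> ('a marrow \<times> 'v) list \<Rightarrow> ('a \<times> 'v) list" where
  "unbracket k w = concat (map (unbracket_letter k) w)"

lemma unbracket_simps [simp]: "unbracket k [] = []" "unbracket k (x # w)
      = unbracket_letter k x @ unbracket k w"
  "unbracket k (u @ v) = unbracket k u @ unbracket k v"
  by (simp_all add: unbracket_def)

lemma unbracket_eq_Nil: "list_all (ok_letter Q k) w \<Longrightarrow> unbracket k w = [] \<longleftrightarrow> w = []"
  by (cases w; cases "hd w"; cases "fst (hd w)") auto

lemma wend_unbracket: "list_all (ok_letter Q k) w \<Longrightarrow> wend i (unbracket k w) = wend i w"
  by (cases w; cases "hd w"; cases "fst (hd w)") auto

text \<open>The substitution is extended from potentials to all series. In a loop-free quiver a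
  nontrivial path with an end at k is not the expansion of any admissible word, so it is simply
  dropped.\<close>

definition bracket :: "('v, 'a) quiver \<Rightarrow> 'v \<Rightarrow> ('v, 'a, 'k::field) pser \<Rightarrow> ('v, 'a marrow, 'k) pser" where
  "bracket Q k F = Pser (\<lambda>i w. if list_all (ok_letter Q k) w then coeff F i (unbracket k w) else 0)"

lemma coeff_bracket: "coeff (bracket Q k F) i w
      = (if list_all (ok_letter Q k) w then coeff F i (unbracket k w) else 0)"
  by (simp add: bracket_def)

lemma bracket_add [simp]: "bracket Q k (F + G) = bracket Q k F + bracket Q k G"
  by (rule pser_eqI) (simp add: coeff_bracket)
lemma bracket_zero [simp]: "bracket Q k 0 = 0" by (rule pser_eqI) (simp add: coeff_bracket)
lemma bracket_minus: "bracket Q k (F - G) = bracket Q k F - bracket Q k G"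
  by (rule pser_eqI) (simp add: coeff_bracket)
lemma bracket_smul [simp]: "bracket Q k (smul c F) = smul c (bracket Q k F)"
  by (rule pser_eqI) (simp add: coeff_bracket)
lemma bracket_sum: "bracket Q k (sum F A) = (\<Sum>x\<in>A. bracket Q k (F x))"
  by (induction A rule: infinite_finite_induct) auto

lemma bracket_vtx [simp]: "bracket Q k (vtx i) = vtx i"
  by (rule pser_eqI) (auto simp: coeff_bracket coeff_vtx unbracket_eq_Nil)

lemma between_bracket: "between i j F \<Longrightarrow> between i j (bracket Q k F)"
  unfolding between_def coeff_bracket using wend_unbracket by metis

lemma lder_bracket:
  "lder (Old a, h) (bracket Q k F)
        = (if ok_letter Q k (Old a, h) then bracket Q k (lder (a, h) F) else 0)"
  "lder (Comp b a, h) (bracket Q k F) = (if qtail Q b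
        = k then bracket Q k (lder (a, k) (lder (b, h) F)) else 0)"
  "lder (Star a, h) (bracket Q k F) = 0"
  by (rule pser_eqI; auto simp: coeff_bracket)+

text \<open>A splitting of the underlying path inside some \<open>[ba]\<close> contributes nothing, as the left factor
  would start at \<open>k\<close>.\<close>
lemma bracket_mult:
  fixes F G :: "('v, 'a, 'k::field) pser"
  assumes "\<And>w. coeff F k w = 0"
  shows "bracket Q k (F * G) = bracket Q k F * bracket Q k G"
proof -
  have "coeff (bracket Q k (F * G)) i w = coeff (bracket Q k F * bracket Q k G) i w"
    if "\<And>w. coeff F k w = 0" for i w and F :: "('v, 'a, 'k) pser"
    using that
  proof (induction w arbitrary: F)
    case Nil
    then show ?case by (simp add: coeff_bracket)
  next
    case (Cons x w)
    obtain m h where x: "x = (m, h)" by (cases x)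
    have "coeff (lder x (bracket Q k (F * G))) i w
          = coeff (lder x (bracket Q k F * bracket Q k G)) i w"
    proof (cases m)
      case (Old a)
      have "coeff (bracket Q k (lder (a, h) F * G)) i w
            = coeff (bracket Q k (lder (a, h) F) * bracket Q k G) i w"
        by (rule Cons.IH) (simp add: Cons.prems)
      then show ?thesis unfolding x Old lder_bracket lder_mult
        by (auto simp: coeff_bracket [of _ _ F])
    next
      case (Comp b a)
      have "coeff (bracket Q k (lder (a, k) (lder (b, h) F) * G)) i w
          = coeff (bracket Q k (lder (a, k) (lder (b, h) F)) * bracket Q k G) i w"
        by (rule Cons.IH) (simp add: Cons.prems)
      then show ?thesis unfolding x Comp lder_bracket lder_mult
        by (auto simp: coeff_bracket [of _ _ F] lder_mult Cons.prems)
    next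
      case (Star a)
      then show ?thesis unfolding x Star lder_bracket lder_mult by simp
    qed
    then show ?case by simp
  qed
  then show ?thesis using assms by (blast intro: pser_eqI)
qed

section \<open>The corner (1 - e_k) . (1 - e_k), on which the bracket is multiplicative\<close>

definition corner :: "'v \<Rightarrow> ('v, 'a, 'k::field) pser \<Rightarrow> bool" where
  "corner k F \<longleftrightarrow> (\<forall>i w. coeff F i w \<noteq> 0 \<longrightarrow> i \<noteq> k \<and> wend i w \<noteq> k)"

lemma corner_start: "corner k F \<Longrightarrow> coeff F k w = 0" unfolding corner_def by blast
lemma corner_end: "corner k F \<Longrightarrow> wend i w = k \<Longrightarrow> coeff F i w = 0" unfolding corner_def by blast

text \<open>The equational form shows that homomorphisms fixing e_k preserve the corner, and that
  the corner is closed under products.\<close>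

lemma corner_iff: "corner k F \<longleftrightarrow> vtx k * F = 0 \<and> F * vtx k = 0"
proof
  assume "corner k F"
  then show "vtx k * F = 0 \<and> F * vtx k = 0"
    by (auto intro!: pser_eqI simp: coeff_vtx_times coeff_times_vtx corner_start corner_end)
next
  assume *: "vtx k * F = 0 \<and> F * vtx k = 0"
  show "corner k F" unfolding corner_def
  proof (intro allI impI)
    fix i w assume "coeff F i w \<noteq> 0"
    then show "i \<noteq> k \<and> wend i w \<noteq> k"
      using coeff_vtx_times [of k F i w] coeff_times_vtx [of F k i w] * by auto
  qed
qed

lemma between_corner: "between i j F \<Longrightarrow> i \<noteq> k \<Longrightarrow> j \<noteq> k \<Longrightarrow> corner k F"
  unfolding between_def corner_def by metis

lemma corner_zero [simp]: "corner k 0" by (simp add: corner_def)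
lemma corner_add: "corner k F \<Longrightarrow> corner k G \<Longrightarrow> corner k (F + G)"
  by (simp add: corner_iff distrib_left distrib_right)
lemma corner_mult: "corner k F \<Longrightarrow> corner k G \<Longrightarrow> corner k (F * G)"
  by (simp add: corner_iff mult.assoc) (simp add: mult.assoc [symmetric])
lemma corner_smul: "corner k F \<Longrightarrow> corner k (smul c F)" by (auto simp: corner_def)
lemma corner_sum: "(\<And>x. x \<in> A \<Longrightarrow> corner k (F x)) \<Longrightarrow> corner k (sum F A)"
  by (induction A rule: infinite_finite_induct) (auto intro: corner_add)

lemma bracket_corner_mult: "corner k F \<Longrightarrow> bracket Q k (F * G) = bracket Q k F * bracket Q k G"
  by (simp add: bracket_mult corner_start)

section \<open>Generators of the corner, and uniqueness of homomorphisms on it\<close>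

locale mutable_quiver = loopfree Q for Q :: "('v, 'a) quiver" +
  fixes k :: 'v
  assumes k_in: "k \<in> qverts Q"
    and no_2cycle: "a \<in> qarrs Q \<Longrightarrow> b \<in> qarrs Q \<Longrightarrow> qhead Q a = k \<Longrightarrow> qtail Q b = k \<Longrightarrow>
          qtail Q a \<noteq> qhead Q b"
begin

abbreviation "Mid \<equiv> {a \<in> qarrs Q. qhead Q a \<noteq> k \<and> qtail Q a \<noteq> k}"
abbreviation "Ins \<equiv> {a \<in> qarrs Q. qhead Q a = k}"
abbreviation "Outs \<equiv> {b \<in> qarrs Q. qtail Q b = k}"

text \<open>[ba] would be a loop precisely if a and b formed a 2-cycle at k, which the first
  condition at k forbids. Being loop-free, the mutated quiver admits the extension and uniqueness
  results above.\<close>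

lemma loopfree_mquiver: "loopfree (mquiver Q k)"
proof
  show "finite (qverts (mquiver Q k))" by (simp add: finite_verts)
  have "{Comp b a | a b. a \<in> qarrs Q \<and> b \<in> qarrs Q \<and> qhead Q a = k \<and> qtail Q b = k}
      \<subseteq> (\<lambda>(a, b). Comp b a) ` (qarrs Q \<times> qarrs Q)" by auto
  then have "finite {Comp b a | a b. a \<in> qarrs Q \<and> b \<in> qarrs Q \<and> qhead Q a = k \<and> qtail Q b = k}"
    using finite_arrs finite_subset by blast
  then show "finite (qarrs (mquiver Q k))" by (simp add: mquiver_def finite_arrs)
next
  fix a assume "a \<in> qarrs (mquiver Q k)"
  then show "qhead (mquiver Q k) a \<in> qverts (mquiver Q k) \<and> qtail (mquiver Q k) a
        \<in> qverts (mquiver Q k)"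
    using ends_in k_in by (cases a) auto
next
  fix a assume a: "a \<in> qarrs (mquiver Q k)"
  then show "qhead (mquiver Q k) a \<noteq> qtail (mquiver Q k) a"
  proof (cases a)
    case (Comp b c)
    then show ?thesis using a no_2cycle [of c b] by auto
  qed (use a no_loop in force)+
qed

lemma qpath_unbracket: "list_all (ok_letter Q k) w \<Longrightarrow> qpath Q i (unbracket k w) \<Longrightarrow>
      qpath (mquiver Q k) i w"
proof (induction w)
  case (Cons x w)
  obtain m h where "x = (m, h)" by (cases x)
  then show ?case using Cons by (cases m) (auto simp: wend_unbracket)
qed simp

lemma bracket_path_series: "F \<in> path_series Q \<Longrightarrow> bracket Q k F \<in> path_series (mquiver Q k)"
  using qpath_unbracket by (auto simp: path_series_def coeff_bracket)

lemma bracket_Mid: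
  assumes "a \<in> Mid"
    shows "bracket Q k (arr Q a) = (arr (mquiver Q k) (Old a) :: ('v, 'a marrow, 'k::field) pser)"
proof (rule pser_eq_derI)
  fix x :: "'a marrow \<times> 'v"
  obtain m h where x: "x = (m, h)" by (cases x)
  show "lder x (bracket Q k (arr Q a))
        = lder x (arr (mquiver Q k) (Old a) :: ('v, 'a marrow, 'k) pser)"
    using assms unfolding x by (cases m) (auto simp: lder_bracket lder_arr)
qed (simp add: coeff_bracket)

lemma bracket_Comp:
  assumes "a \<in> Ins" "b \<in> Outs"
  shows "bracket Q k (arr Q b * arr Q a)
        = (arr (mquiver Q k) (Comp b a) :: ('v, 'a marrow, 'k::field) pser)"
proof (rule pser_eq_derI)
  fix x :: "'a marrow \<times> 'v"
  obtain m h where x: "x = (m, h)" by (cases x)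
  show "lder x (bracket Q k (arr Q b * arr Q a))
        = lder x (arr (mquiver Q k) (Comp b a) :: ('v, 'a marrow, 'k) pser)"
    using assms unfolding x
      by (cases m) (auto
      simp: lder_bracket lder_arr lder_mult coeff_vtx vtx_between [OF between_arr] intro!: pser_eqI)
qed (simp add: coeff_bracket)

abbreviation "Cor \<equiv> {F \<in> path_series Q. corner k F}"

lemma corner_arr: "a \<in> Mid \<Longrightarrow> arr Q a \<in> Cor"
  by (auto simp: arr_path_series intro: between_corner [OF between_arr])

lemma between_path2: "a \<in> Ins \<Longrightarrow> b \<in> Outs \<Longrightarrow> between (qhead Q b) (qtail Q a) (arr Q b * arr Q a)"
  by (rule between_mult [where j = k]) (use between_arr [of Q a] between_arr [of Q b] in auto)

lemma corner_arr2: assumes "a \<in> Ins" "b \<in> Outs" shows "arr Q b * arr Q a \<in> Cor"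
proof -
  have "qhead Q b \<noteq> k" "qtail Q a \<noteq> k" using assms no_loop [of a] no_loop [of b] by auto
  then show ?thesis using assms between_corner [OF between_path2]
    by (auto simp: arr_path_series mult_path_series)
qed

text \<open>A path with both ends off k is trivial, or its leftmost arrow avoids k, or its leftmost
  arrow leaves k and the arrow traversed just before enters k. So the corner is generated by arrows
  off k and length-two paths through k.\<close>

lemma corner_decomp:
  fixes F :: "('v, 'a, 'k::field) pser"
  assumes "F \<in> Cor"
  shows "F = Rpart (qverts Q) F + (\<Sum>a\<in>Mid. arr Q a * la Q a F)
    + (\<Sum>b\<in>Outs. \<Sum>a\<in>Ins. arr Q b * arr Q a * la Q a (la Q b F))"
proof -
  have F: "F \<in> path_series Q" "corner k F" using assms by auto
  have z: "la Q a F = 0" if "qhead Q a = k" for a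
  proof (rule pser_eqI)
    fix i w
    show "coeff (la Q a F) i w = coeff 0 i w" using that by (simp add: corner_end [OF F(2)])
  qed
  have 1: "(\<Sum>a\<in>qarrs Q. arr Q a * la Q a F)
        = (\<Sum>a\<in>Mid. arr Q a * la Q a F) + (\<Sum>a\<in>Outs. arr Q a * la Q a F)"
  proof -
    have "(\<Sum>a\<in>qarrs Q. arr Q a * la Q a F) = (\<Sum>a\<in>Mid \<union> Outs. arr Q a * la Q a F)"
      by (rule sum.mono_neutral_right) (auto simp: finite_arrs z)
    also have "\<dots> = (\<Sum>a\<in>Mid. arr Q a * la Q a F) + (\<Sum>a\<in>Outs. arr Q a * la Q a F)"
      by (rule sum.union_disjoint) (auto simp: finite_arrs)
    finally show ?thesis .
  qed
  have 2: "arr Q b * la Q b F = (\<Sum>a\<in>Ins. arr Q b * arr Q a * la Q a (la Q b F))" if b: "b \<in> Outs"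
    for b
  proof -
    have G: "la Q b F \<in> path_series Q" by (simp add: F lder_path_series)
    \<comment> \<open>The remainder ends at k and starts elsewhere; so it has no constant term, and
      its leftmost arrow enters k.\<close>
    have pe: "wend i w = k \<and> i \<noteq> k" if "coeff (la Q b F) i w \<noteq> 0" for i w
      using that b F path_series_D [OF F(1), of i "(b, qhead Q b) # w"] by (auto simp: corner_def)
    have "Rpart (qverts Q) (la Q b F) = (0 :: ('v, 'a, 'k) pser)"
      using pe by (intro pser_eqI) (force simp: coeff_Rpart finite_verts)
    then have "la Q b F = (\<Sum>a\<in>qarrs Q. arr Q a * la Q a (la Q b F))"
      using la_decomp [OF G] by simp
    also have "\<dots> = (\<Sum>a\<in>Ins. arr Q a * la Q a (la Q b F))"
    proof (rule sum.mono_neutral_right)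
      have "la Q a (la Q b F) = 0" if "qhead Q a \<noteq> k" for a
      proof (rule pser_eqI)
        fix i w
        show "coeff (la Q a (la Q b F)) i w = coeff 0 i w" using pe [of i "(a, qhead Q a) # w"] that
          by auto
      qed
      then show "\<forall>i\<in>qarrs Q - Ins. arr Q i * la Q i (la Q b F) = 0" by auto
    qed (auto simp: finite_arrs)
    finally show ?thesis by (metis (no_types, lifting) mult.assoc sum.cong sum_distrib_left)
  qed
  show ?thesis
    by (subst la_decomp [OF F(1)]) (simp add: 1 2 add.assoc)
qed

lemma corner_la: "F \<in> Cor \<Longrightarrow> a \<in> Mid \<Longrightarrow> la Q a F \<in> Cor"
  by (auto simp: lder_path_series corner_def dest: path_series_D)

lemma corner_la2:
  assumes "F \<in> Cor" "a \<in> Ins" "b \<in> Outs" shows "la Q a (la Q b F) \<in> Cor"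
proof -
  have "i \<noteq> k \<and> wend i w \<noteq> k" if "coeff F i ((b, qhead Q b) # (a, qhead Q a) # w) \<noteq> 0" for i w
    using path_series_D [OF _ that, of Q] that assms no_loop [of a] by (auto simp: corner_def)
  then show ?thesis using assms by (auto simp: lder_path_series corner_def)
qed

text \<open>The maps to be compared, F to \<Psi>[F] and F to [\<phi> F], are multiplicative on the
  corner, where brackets of products split; the notion of homomorphism is relativised
  accordingly.\<close>

definition corner_hom :: "(('v, 'a, 'k::field) pser \<Rightarrow> ('v, 'c, 'k) pser) \<Rightarrow> bool" where
  "corner_hom \<psi> \<longleftrightarrow> (\<forall>F\<in>Cor. \<forall>G\<in>Cor. \<psi> (F + G) = \<psi> F + \<psi> G \<and> \<psi> (F * G) = \<psi> F * \<psi> G)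
     \<and> (\<forall>i\<in>qverts Q. \<forall>c. \<psi> (smul c (vtx i)) = smul c (vtx i))"

lemma Rpart_Cor:
  assumes "F \<in> Cor" shows "Rpart (qverts Q) F \<in> Cor"
proof -
  have "corner k (Rpart (qverts Q) F)"
    using assms by (auto simp: corner_def coeff_Rpart finite_verts)
  then show ?thesis
    by (auto simp: Rpart_def intro!: sum_path_series smul_path_series vtx_path_series)
qed

lemma corner_hom_sum:
  assumes "corner_hom \<psi>" "\<And>x. x \<in> A \<Longrightarrow> F x \<in> Cor"
  shows "\<psi> (sum F A) = (\<Sum>x\<in>A. \<psi> (F x))"
proof -
  have z: "\<psi> 0 = 0"
  proof -
    have "0 \<in> Cor" by simp
    then have "\<psi> (0 + 0) = \<psi> 0 + \<psi> 0" using assms(1) unfolding corner_hom_def by blast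
    then show ?thesis by simp
  qed
  have "(\<forall>x\<in>A. F x \<in> Cor) \<longrightarrow> \<psi> (sum F A) = (\<Sum>x\<in>A. \<psi> (F x))"
  proof (induction A rule: infinite_finite_induct)
    case (insert y A)
    show ?case
    proof
      assume *: "\<forall>x\<in>insert y A. F x \<in> Cor"
      then have "sum F A \<in> Cor" by (auto intro: sum_path_series corner_sum)
      then have "\<psi> (F y + sum F A) = \<psi> (F y) + \<psi> (sum F A)"
        using assms(1) * by (auto simp: corner_hom_def)
      then show "\<psi> (sum F (insert y A)) = (\<Sum>x\<in>insert y A. \<psi> (F x))"
        using insert * by simp
    qed
  qed (auto simp: z)
  then show ?thesis using assms(2) by auto
qed

lemma Cor_mult: "F \<in> Cor \<Longrightarrow> G \<in> Cor \<Longrightarrow> F * G \<in> Cor" by (simp add: mult_path_series corner_mult)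
lemma Cor_sum: "(\<And>x. x \<in> A \<Longrightarrow> F x \<in> Cor) \<Longrightarrow> sum F A \<in> Cor" by (simp add: sum_path_series corner_sum)
lemma Cor_add: "F \<in> Cor \<Longrightarrow> G \<in> Cor \<Longrightarrow> F + G \<in> Cor" by (simp add: add_path_series corner_add)

lemma corner_hom_decomp:
  fixes F :: "('v, 'a, 'k::field) pser"
  assumes h: "corner_hom \<psi>" and F: "F \<in> Cor"
  shows "\<psi> F = Rpart (qverts Q) F + (\<Sum>a\<in>Mid. \<psi> (arr Q a) * \<psi> (la Q a F))
    + (\<Sum>b\<in>Outs. \<Sum>a\<in>Ins. \<psi> (arr Q b * arr Q a) * \<psi> (la Q a (la Q b F)))"
proof -
  let ?M = "\<Sum>a\<in>Mid. arr Q a * la Q a F"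
    and ?T = "\<Sum>b\<in>Outs. \<Sum>a\<in>Ins. arr Q b * arr Q a * la Q a (la Q b F)"
    and ?R = "Rpart (qverts Q) F :: ('v, 'a, 'k) pser"
  have m: "\<psi> (F * G) = \<psi> F * \<psi> G" if "F \<in> Cor" "G \<in> Cor" for F G using h that
    by (auto simp: corner_hom_def)
  have a: "\<psi> (F + G) = \<psi> F + \<psi> G" if "F \<in> Cor" "G \<in> Cor" for F G using h that
    by (auto simp: corner_hom_def)
  have M: "arr Q a * la Q a F \<in> Cor" if "a \<in> Mid" for a
    by (rule Cor_mult [OF corner_arr [OF that] corner_la [OF F that]])
  have T: "arr Q b * arr Q a * la Q a (la Q b F) \<in> Cor" if "a \<in> Ins" "b \<in> Outs" for a b
    by (rule Cor_mult [OF corner_arr2 [OF that] corner_la2 [OF F that]])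
  have r: "\<psi> ?R = Rpart (qverts Q) F"
  proof -
    \<comment> \<open>The idempotent e_k lies outside the corner, but its coefficient in F is
      zero.\<close>
    have c: "smul (coeff F i []) (vtx i) \<in> Cor" if "i \<in> qverts Q" for i
    proof (cases "i = k")
      case True
      then have "coeff F i [] = 0" using F by (simp add: corner_start)
      then show ?thesis using that
        by (auto simp: corner_def intro: smul_path_series vtx_path_series)
    next
      case False then show ?thesis using that
        by (auto intro!: smul_path_series vtx_path_series corner_smul between_corner [OF between_vtxI])
    qed
    have "\<psi> ?R = (\<Sum>i\<in>qverts Q. \<psi> (smul (coeff F i []) (vtx i)))"
      unfolding Rpart_def by (rule corner_hom_sum [OF h c])
    also have "\<dots> = (\<Sum>i\<in>qverts Q. smul (coeff F i []) (vtx i))" using h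
      by (auto simp: corner_hom_def)
    finally show ?thesis by (simp add: Rpart_def)
  qed
  have "\<psi> F = \<psi> (?R + ?M + ?T)" by (subst corner_decomp [OF F]) (rule refl)
  also have "\<dots> = \<psi> ?R + \<psi> ?M + \<psi> ?T"
    using Rpart_Cor [OF F] Cor_sum [of Mid, OF M] Cor_sum [of Outs, OF Cor_sum [of Ins, OF T]]
    by (simp only: a Cor_add)
  also have "\<psi> ?M = (\<Sum>a\<in>Mid. \<psi> (arr Q a) * \<psi> (la Q a F))"
  proof -
    have "\<psi> ?M = (\<Sum>a\<in>Mid. \<psi> (arr Q a * la Q a F))" by (rule corner_hom_sum [OF h M])
    also have "\<dots> = (\<Sum>a\<in>Mid. \<psi> (arr Q a) * \<psi> (la Q a F))"
      by (intro sum.cong refl m corner_arr corner_la [OF F])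
    finally show ?thesis .
  qed
  also have "\<psi> ?T = (\<Sum>b\<in>Outs. \<Sum>a\<in>Ins. \<psi> (arr Q b * arr Q a) * \<psi> (la Q a (la Q b F)))"
  proof -
    have "\<psi> ?T = (\<Sum>b\<in>Outs. \<psi> (\<Sum>a\<in>Ins. arr Q b * arr Q a * la Q a (la Q b F)))"
      by (rule corner_hom_sum [OF h]) (rule Cor_sum, rule T)
    also have "\<dots> = (\<Sum>b\<in>Outs. \<Sum>a\<in>Ins. \<psi> (arr Q b * arr Q a * la Q a (la Q b F)))"
      by (intro sum.cong refl corner_hom_sum [OF h] T)
    also have "\<dots> = (\<Sum>b\<in>Outs. \<Sum>a\<in>Ins. \<psi> (arr Q b * arr Q a) * \<psi> (la Q a (la Q b F)))"
      by (intro sum.cong refl m corner_arr2 corner_la2 [OF F])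
    finally show ?thesis .
  qed
  finally show ?thesis by (simp add: r)
qed

text \<open>The same degree argument as for path algebras, run along the generators of the corner: a
  length-two path through k counts as one step, and positive order of its image suffices.\<close>

lemma corner_hom_eqI:
  fixes \<psi>1 \<psi>2 :: "('v, 'a, 'k::field) pser \<Rightarrow> ('v, 'c, 'k) pser"
  assumes h: "corner_hom \<psi>1" "corner_hom \<psi>2"
    and M: "\<And>a. a \<in> Mid \<Longrightarrow> \<psi>1 (arr Q a) = \<psi>2 (arr Q a) \<and> order_ge 1 (\<psi>1 (arr Q a))"
    and T: "\<And>a b. a \<in> Ins \<Longrightarrow> b \<in> Outs \<Longrightarrow>
          \<psi>1 (arr Q b * arr Q a) = \<psi>2 (arr Q b * arr Q a) \<and> order_ge 1 (\<psi>1 (arr Q b * arr Q a))"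
    and "F \<in> Cor"
  shows "\<psi>1 F = \<psi>2 F"
proof -
  have "F \<in> Cor \<Longrightarrow> order_ge n (\<psi>1 F - \<psi>2 F)" for n F
  proof (induction n arbitrary: F)
    case (Suc n)
    have 1: "(\<Sum>a\<in>Mid. \<psi>2 (arr Q a) * \<psi>2 (la Q a F)) = (\<Sum>a\<in>Mid. \<psi>1 (arr Q a) * \<psi>2 (la Q a F))"
      by (rule sum.cong) (auto simp: M)
    have 2: "(\<Sum>b\<in>Outs. \<Sum>a\<in>Ins. \<psi>2 (arr Q b * arr Q a) * \<psi>2 (la Q a (la Q b F)))
      = (\<Sum>b\<in>Outs. \<Sum>a\<in>Ins. \<psi>1 (arr Q b * arr Q a) * \<psi>2 (la Q a (la Q b F)))"
      by (intro sum.cong) (auto simp: T)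
    have "\<psi>1 F - \<psi>2 F = (\<Sum>a\<in>Mid. \<psi>1 (arr Q a) * (\<psi>1 (la Q a F) - \<psi>2 (la Q a F)))
      + (\<Sum>b\<in>Outs. \<Sum>a\<in>Ins. \<psi>1 (arr Q b * arr Q a) * (\<psi>1 (la Q a (la Q b F)) - \<psi>2 (la Q a
        (la Q b F))))"
      unfolding corner_hom_decomp [OF h(1) Suc.prems] corner_hom_decomp [OF h(2) Suc.prems] 1 2
      by (simp add: right_diff_distrib sum_subtractf)
    moreover have "order_ge (Suc n) \<dots>"
      by (intro order_ge_add order_ge_sum order_ge_Suc_mult Suc.IH corner_la corner_la2 Suc.prems M [THEN conjunct2] T [THEN conjunct2])
    ultimately show ?case by simp
  qed simp
  then show ?thesis using \<open>F \<in> Cor\<close> by (blast intro: order_ge_eqI)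
qed

end

section \<open>Extending an isomorphism to the mutated quivers\<close>

text \<open>Coefficients taken from \<phi>' and mapped by \<phi> make the sum of \<phi>(a) \<phi>(C)
  over a collapse to \<phi>(\<phi>'(a')) = a'. An arrow into k stands left of its coefficient
  (\<open>la\<close>), an arrow out of k stands right of it (\<open>ra\<close>); reversing the
  orientation puts the starred arrow on the other side.\<close>

fun mut_image :: "('v, 'a) quiver \<Rightarrow> ('v, 'b) quiver \<Rightarrow> 'v
    \<Rightarrow> (('v, 'a, 'k::field) pser \<Rightarrow> ('v, 'b, 'k) pser) \<Rightarrow> (('v, 'b, 'k) pser \<Rightarrow> ('v, 'a, 'k) pser)
    \<Rightarrow> 'a marrow \<Rightarrow> ('v, 'b marrow, 'k) pser" where
  "mut_image Q Q' k \<phi> \<phi>' (Old a) = bracket Q' k (\<phi> (arr Q a))"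
| "mut_image Q Q' k \<phi> \<phi>' (Comp b a) = bracket Q' k (\<phi> (arr Q b * arr Q a))"
| "mut_image Q Q' k \<phi> \<phi>' (Star c) =
     (if qhead Q c = k
      then \<Sum>a\<in>{a \<in> qarrs Q'. qhead Q' a = k}.
             bracket Q' k (\<phi> (la Q c (\<phi>' (arr Q' a)))) * arr (mquiver Q' k) (Star a)
      else \<Sum>b\<in>{b \<in> qarrs Q'. qtail Q' b = k}.
             arr (mquiver Q' k) (Star b) * bracket Q' k (\<phi> (ra Q c (\<phi>' (arr Q' b)))))"

definition mut_hom :: "('v, 'a) quiver \<Rightarrow> ('v, 'b) quiver \<Rightarrow> 'v
    \<Rightarrow> (('v, 'a, 'k::field) pser \<Rightarrow> ('v, 'b, 'k) pser) \<Rightarrow> (('v, 'b, 'k) pser \<Rightarrow> ('v, 'a, 'k) pser)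
    \<Rightarrow> ('v, 'a marrow, 'k) pser \<Rightarrow> ('v, 'b marrow, 'k) pser" where
  "mut_hom Q Q' k \<phi> \<phi>' = pa_ext (mquiver Q k) (mut_image Q Q' k \<phi> \<phi>')"

locale mutable_pair = A: mutable_quiver Q k + B: mutable_quiver Q' k
  for Q :: "('v, 'a) quiver" and Q' :: "('v, 'b) quiver" and k +
  fixes \<phi> :: "('v, 'a, 'k::field) pser \<Rightarrow> ('v, 'b, 'k) pser" and \<phi>'
  assumes verts_eq: "qverts Q' = qverts Q"
    and hom_phi: "pa_hom Q Q' \<phi>" and hom_phi': "pa_hom Q' Q \<phi>'"
    and inv1: "F \<in> path_series Q \<Longrightarrow> \<phi>' (\<phi> F) = F" and inv2: "G \<in> path_series Q' \<Longrightarrow> \<phi> (\<phi>' G) = G"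
begin

text \<open>The data are symmetric, so each fact about the map built from \<phi> also holds for its
  candidate inverse, built from \<phi>'.\<close>

lemma flip: "mutable_pair Q' Q k \<phi>' \<phi>"
  using A.mutable_quiver_axioms B.mutable_quiver_axioms hom_phi hom_phi' inv1 inv2 verts_eq
  by (simp add: mutable_pair_def mutable_pair_axioms_def)

sublocale P: pser_hom Q Q' \<phi> by unfold_locales (rule hom_phi)
sublocale P': pser_hom Q' Q \<phi>' by unfold_locales (rule hom_phi')

lemma phi_Cor: assumes "F \<in> A.Cor" shows "\<phi> F \<in> B.Cor"
proof -
  have "\<phi> (vtx k * F) = vtx k * \<phi> F" "\<phi> (F * vtx k) = \<phi> F * vtx k"
    using assms A.k_in by (auto simp: P.hom_mult vtx_path_series P.hom_vtx)
  then show ?thesis using assms by (auto simp: corner_iff P.hom_zero P.hom_in_path_series)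
qed

text \<open>An entry runs between the tails of two arrows into k. Without loops neither tail is k,
  so the entries lie in the corner although the arrows do not, and a bracket can be split behind
  them.\<close>

lemma In_matrix:
  assumes "a \<in> A.Ins" "c \<in> B.Ins"
  shows "between (qtail Q a) (qtail Q' c) (la Q a (\<phi>' (arr Q' c)))"
    and "la Q a (\<phi>' (arr Q' c)) \<in> A.Cor" and "la Q a (\<phi>' (arr Q' c)) \<in> path_series Q"
proof -
  have P: "\<phi>' (arr Q' c) \<in> path_series Q" using assms
    by (simp add: P'.hom_in_path_series B.arr_path_series)
  show "la Q a (\<phi>' (arr Q' c)) \<in> path_series Q" using P by (rule lder_path_series)
  show 1: "between (qtail Q a) (qtail Q' c) (la Q a (\<phi>' (arr Q' c)))"
    by (rule A.between_la [OF P P'.between_image_arr]) (use assms in simp)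
  have "qtail Q a \<noteq> k" "qtail Q' c \<noteq> k" using assms A.no_loop [of a] B.no_loop [of c] by auto
  then show "la Q a (\<phi>' (arr Q' c)) \<in> A.Cor" using between_corner [OF 1] P
    by (simp add: lder_path_series)
qed

lemma Out_matrix:
  assumes "b \<in> A.Outs" "d \<in> B.Outs"
  shows "between (qhead Q' d) (qhead Q b) (ra Q b (\<phi>' (arr Q' d)))"
    and "ra Q b (\<phi>' (arr Q' d)) \<in> A.Cor" and "ra Q b (\<phi>' (arr Q' d)) \<in> path_series Q"
proof -
  have P: "\<phi>' (arr Q' d) \<in> path_series Q" using assms
    by (simp add: P'.hom_in_path_series B.arr_path_series)
  show "ra Q b (\<phi>' (arr Q' d)) \<in> path_series Q" using P by (rule A.rder_path_series)
  show 1: "between (qhead Q' d) (qhead Q b) (ra Q b (\<phi>' (arr Q' d)))"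
    by (rule A.between_ra [OF P'.between_image_arr]) (use assms in simp)
  have "qhead Q b \<noteq> k" "qhead Q' d \<noteq> k" using assms A.no_loop [of b] B.no_loop [of d] by auto
  then show "ra Q b (\<phi>' (arr Q' d)) \<in> A.Cor" using between_corner [OF 1] P
    by (simp add: A.rder_path_series)
qed

text \<open>The image ends at k and, the arrow being no loop, has no constant term; hence the
  leftmost arrow of each of its paths enters k.\<close>

lemma In_matrix_sum:
  assumes "c \<in> B.Ins"
  shows "\<phi>' (arr Q' c) = (\<Sum>a\<in>A.Ins. arr Q a * la Q a (\<phi>' (arr Q' c)))"
proof -
  let ?F = "\<phi>' (arr Q' c)"
  have c: "c \<in> qarrs Q'" "qhead Q' c = k" using assms by auto
  have P: "?F \<in> path_series Q" using c by (simp add: P'.hom_in_path_series B.arr_path_series)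
  have "Rpart (qverts Q) ?F = (0 :: ('v, 'a, 'k) pser)"
    using P'.hom_order_ge_arr [OF c(1)]
      by (intro pser_eqI) (auto simp: coeff_Rpart A.finite_verts order_ge_def)
  then have "?F = (\<Sum>a\<in>qarrs Q. arr Q a * la Q a ?F)" using A.la_decomp [OF P] by simp
  also have "\<dots> = (\<Sum>a\<in>A.Ins. arr Q a * la Q a ?F)"
    using A.la_other [OF P'.between_image_arr [OF c(1)]] c
    by (intro sum.mono_neutral_right) (auto simp: A.finite_arrs)
  finally show ?thesis .
qed

lemma Out_matrix_sum:
  assumes "d \<in> B.Outs"
  shows "\<phi>' (arr Q' d) = (\<Sum>b\<in>A.Outs. ra Q b (\<phi>' (arr Q' d)) * arr Q b)"
proof -
  let ?F = "\<phi>' (arr Q' d)"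
  have d: "d \<in> qarrs Q'" "qtail Q' d = k" using assms by auto
  have P: "?F \<in> path_series Q" using d by (simp add: P'.hom_in_path_series B.arr_path_series)
  have "?F = (\<Sum>b\<in>qarrs Q. ra Q b ?F * arr Q b)"
    using A.ra_decomp [OF P P'.hom_order_ge_arr [OF d(1)]] .
  also have "\<dots> = (\<Sum>b\<in>A.Outs. ra Q b ?F * arr Q b)"
    using A.ra_other [OF P'.between_image_arr [OF d(1)]] d
    by (intro sum.mono_neutral_right) (auto simp: A.finite_arrs)
  finally show ?thesis .
qed

abbreviation "\<Psi> \<equiv> mut_hom Q Q' k \<phi> \<phi>'"

lemma bracket_phi_path_series: "F \<in> path_series Q \<Longrightarrow> bracket Q' k (\<phi> F) \<in> path_series (mquiver Q' k)"
  by (intro B.bracket_path_series P.hom_in_path_series)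

lemma Star_path_series:
  "c \<in> B.Ins \<Longrightarrow> arr (mquiver Q' k) (Star c) \<in> path_series (mquiver Q' k)"
  "d \<in> B.Outs \<Longrightarrow> arr (mquiver Q' k) (Star d) \<in> path_series (mquiver Q' k)"
  by (rule loopfree.arr_path_series [OF B.loopfree_mquiver], simp)+

sublocale E: pa_extension "mquiver Q k" "mquiver Q' k" "mut_image Q Q' k \<phi> \<phi>'"
proof -
  interpret L: loopfree "mquiver Q k" by (rule A.loopfree_mquiver)
  show "pa_extension (mquiver Q k) (mquiver Q' k) (mut_image Q Q' k \<phi> \<phi>')"
  proof
    fix m assume m: "m \<in> qarrs (mquiver Q k)"
    show "mut_image Q Q' k \<phi> \<phi>' m \<in> path_series (mquiver Q' k)"
    proof (cases m)
      case (Star c)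
      show ?thesis
      proof (cases "qhead Q c = k")
        case True
        then have "c \<in> A.Ins" using m Star by simp
        then show ?thesis unfolding Star mut_image.simps(3) if_P [OF True]
          by (intro sum_path_series mult_path_series bracket_phi_path_series In_matrix(3) Star_path_series(1))
      next
        case False
        then have "c \<in> A.Outs" using m Star by simp
        then show ?thesis unfolding Star mut_image.simps(3) if_not_P [OF False]
          by (intro sum_path_series mult_path_series bracket_phi_path_series Out_matrix(3) Star_path_series(2))
      qed
    qed (use m in \<open>auto intro!: bracket_phi_path_series A.arr_path_series mult_path_series\<close>)
    show "between (qhead (mquiver Q k) m) (qtail (mquiver Q k) m) (mut_image Q Q' k \<phi> \<phi>' m)"
    proof (cases m)
      case (Old a)
      then show ?thesis using m by (auto intro!: between_bracket P.between_image_arr)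
    next
      case (Comp b a)
      then have ab: "a \<in> A.Ins" "b \<in> A.Outs" using m by auto
      then have "between (qhead Q b) (qtail Q a) (\<phi> (arr Q b * arr Q a))"
        by (intro P.hom_between A.between_path2) (auto
          simp: A.arr_path_series mult_path_series A.ends_in)
      then show ?thesis using Comp by (simp add: between_bracket)
    next
      case (Star c)
      show ?thesis
      proof (cases "qhead Q c = k")
        case True
        then have c: "c \<in> A.Ins" using m Star by auto
        have "between (qtail Q c) k (bracket Q' k (\<phi> (la Q c (\<phi>' (arr Q' a))))
              * arr (mquiver Q' k) (Star a))" if a: "a \<in> B.Ins" for a
        proof (rule between_mult)
          show "between (qtail Q c) (qtail Q' a) (bracket Q' k (\<phi> (la Q c (\<phi>' (arr Q' a)))))"
            using In_matrix [OF c a] a c A.ends_in [of c] B.ends_in [of a] verts_eq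
              by (intro between_bracket P.hom_between) auto
          show "between (qtail Q' a) k (arr (mquiver Q' k) (Star a))"
            using a between_arr [of "mquiver Q' k" "Star a"] by simp
        qed
        then show ?thesis using Star True by (auto intro!: between_sum)
      next
        case False
        then have c: "c \<in> A.Outs" using m Star by auto
        have "between k (qhead Q c) (arr (mquiver Q' k) (Star b)
              * bracket Q' k (\<phi> (ra Q c (\<phi>' (arr Q' b)))))" if b: "b \<in> B.Outs" for b
        proof (rule between_mult)
          show "between (qhead Q' b) (qhead Q c) (bracket Q' k (\<phi> (ra Q c (\<phi>' (arr Q' b)))))"
            using Out_matrix [OF c b] b c A.ends_in [of c] B.ends_in [of b] verts_eq
              by (intro between_bracket P.hom_between) auto
          show "between k (qhead Q' b) (arr (mquiver Q' k) (Star b))"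
            using b B.no_loop [of b] between_arr [of "mquiver Q' k" "Star b"] by auto
        qed
        then show ?thesis using Star False by (auto intro!: between_sum)
      qed
    qed
  qed (simp add: verts_eq)
qed

lemma Psi_hom: "pa_hom (mquiver Q k) (mquiver Q' k) \<Psi>"
  unfolding mut_hom_def by (rule E.ext_hom)

sublocale H: pser_hom "mquiver Q k" "mquiver Q' k" \<Psi>
  by unfold_locales (rule Psi_hom)

lemma Psi_arr: "m \<in> qarrs (mquiver Q k) \<Longrightarrow> \<Psi> (arr (mquiver Q k) m) = mut_image Q Q' k \<phi> \<phi>' m"
  unfolding mut_hom_def by (rule E.ext_arr)

text \<open>On the generators of the corner this is the choice made in \<open>mut_image\<close>.
  Arrows at k are seen by the bracket only in pairs, so uniqueness has to be invoked on the corner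
  and not on the path algebra.\<close>

lemma intertwine: assumes "F \<in> A.Cor" shows "\<Psi> (bracket Q k F) = bracket Q' k (\<phi> F)"
proof (rule A.corner_hom_eqI [where ?\<psi>1.0 = "\<lambda>F. \<Psi> (bracket Q k F)"
  and ?\<psi>2.0 = "\<lambda>F. bracket Q' k (\<phi> F)", OF _ _ _ _ assms])
  show "A.corner_hom (\<lambda>F. \<Psi> (bracket Q k F))"
    unfolding A.corner_hom_def
      by (auto simp: H.hom_add H.hom_mult bracket_corner_mult A.bracket_path_series H.hom_svtx)
  have "corner k (\<phi> F)" if "F \<in> path_series Q" "corner k F" for F using phi_Cor that by auto
  then show "A.corner_hom (\<lambda>F. bracket Q' k (\<phi> F))"
    unfolding A.corner_hom_def by (auto simp: P.hom_add P.hom_mult bracket_corner_mult P.hom_svtx)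
next
  fix a assume a: "a \<in> A.Mid"
  then have "Old a \<in> qarrs (mquiver Q k)" by simp
  then show "\<Psi> (bracket Q k (arr Q a))
        = bracket Q' k (\<phi> (arr Q a)) \<and> order_ge 1 (\<Psi> (bracket Q k (arr Q a)))"
    using E.x_ord by (simp only: A.bracket_Mid [OF a] Psi_arr) simp
next
  fix a b assume ab: "a \<in> A.Ins" "b \<in> A.Outs"
  then have "Comp b a \<in> qarrs (mquiver Q k)" by simp
  then show "\<Psi> (bracket Q k (arr Q b * arr Q a))
        = bracket Q' k (\<phi> (arr Q b * arr Q a)) \<and> order_ge 1 (\<Psi> (bracket Q k (arr Q b * arr Q a)))"
    using E.x_ord by (simp only: A.bracket_Comp [OF ab] Psi_arr) simp
qed

abbreviation "\<Psi>' \<equiv> mut_hom Q' Q k \<phi>' \<phi>"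

lemma Psi'_star_In: "c \<in> B.Ins \<Longrightarrow> \<Psi>' (arr (mquiver Q' k) (Star c)) =
    (\<Sum>a\<in>A.Ins. bracket Q k (\<phi>' (la Q' c (\<phi> (arr Q a)))) * arr (mquiver Q k) (Star a))"
  by (subst mutable_pair.Psi_arr [OF flip]) auto

lemma Psi'_star_Out: "d \<in> B.Outs \<Longrightarrow> \<Psi>' (arr (mquiver Q' k) (Star d)) =
    (\<Sum>b\<in>A.Outs. arr (mquiver Q k) (Star b) * bracket Q k (\<phi>' (ra Q' d (\<phi> (arr Q b)))))"
  using B.no_loop [of d] by (subst mutable_pair.Psi_arr [OF flip]) auto

text \<open>For unstarred arrows, \<open>intertwine\<close> is used in both directions. For a
  starred arrow the composite is given by a product of two coefficient matrices, which is the
  identity because it computes a derivative of \<phi>'(\<phi>(a2)) = a2.\<close>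

lemma Psi_inverse_arr:
  assumes m: "m \<in> qarrs (mquiver Q k)"
  shows "\<Psi>' (\<Psi> (arr (mquiver Q k) m)) = arr (mquiver Q k) m"
proof -
  interpret R: mutable_pair Q' Q k \<phi>' \<phi> by (rule flip)
  show ?thesis
  proof (cases m)
    case (Old a)
    then have a: "a \<in> A.Mid" using m by auto
    have "\<Psi>' (\<Psi> (bracket Q k (arr Q a))) = bracket Q k (arr Q a)"
      using intertwine [OF A.corner_arr [OF a]] R.intertwine [OF phi_Cor [OF A.corner_arr [OF a]]] a
      by (simp add: inv1 A.arr_path_series)
    then show ?thesis unfolding Old A.bracket_Mid [OF a] .
  next
    case (Comp b a)
    then have ab: "a \<in> A.Ins" "b \<in> A.Outs" using m by auto
    have "\<Psi>' (\<Psi> (bracket Q k (arr Q b * arr Q a))) = bracket Q k (arr Q b * arr Q a)"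
      using intertwine [OF A.corner_arr2 [OF ab]] R.intertwine [OF phi_Cor [OF A.corner_arr2 [OF ab]]] ab
      by (simp add: inv1 A.arr_path_series mult_path_series)
    then show ?thesis unfolding Comp A.bracket_Comp [OF ab] .
  next
    case (Star c)
    show ?thesis
    proof (cases "qhead Q c = k")
      case True
      then have c: "c \<in> A.Ins" using m Star by auto
      let ?M = "\<lambda>a. la Q c (\<phi>' (arr Q' a))" and ?N = "\<lambda>a a2. \<phi>' (la Q' a (\<phi> (arr Q a2)))"
      let ?S = "\<lambda>a. arr (mquiver Q k) (Star a)"
      \<comment> \<open>Since \<open>\<phi>' (arr Q' a)\<close> has no constant term,
        \<open>la Q c\<close> of a product falls on this left factor alone; the sum under the
        derivative is then \<phi>'(\<phi>(a2)).\<close>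
      have MN: "(\<Sum>a\<in>B.Ins. ?M a * ?N a a2) = (if c = a2 then vtx (qtail Q c) else 0)"
        if a2: "a2 \<in> A.Ins" for a2
      proof -
        have "?M a * ?N a a2 = la Q c (\<phi>' (arr Q' a) * ?N a a2)" if a: "a \<in> B.Ins" for a
        proof -
          have "coeff (\<phi>' (arr Q' a)) i [] = 0" for i using P'.hom_order_ge_arr [of a] a
            by (simp add: order_ge_def)
          then show ?thesis by (simp add: lder_mult pser_eqI)
        qed
        then have "(\<Sum>a\<in>B.Ins. ?M a * ?N a a2) = la Q c (\<Sum>a\<in>B.Ins. \<phi>' (arr Q' a) * ?N a a2)"
          by (simp add: lder_sum)
        also have "(\<Sum>a\<in>B.Ins. \<phi>' (arr Q' a) * ?N a a2)
              = (\<Sum>a\<in>B.Ins. \<phi>' (arr Q' a * la Q' a (\<phi> (arr Q a2))))"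
          using a2 by (intro sum.cong refl P'.hom_mult [symmetric]) (auto
            simp: B.arr_path_series A.arr_path_series lder_path_series P.hom_in_path_series)
        also have "\<dots> = \<phi>' (\<Sum>a\<in>B.Ins. arr Q' a * la Q' a (\<phi> (arr Q a2)))"
          using a2 by (intro P'.hom_sum [symmetric]) (auto
            simp: B.arr_path_series A.arr_path_series lder_path_series P.hom_in_path_series mult_path_series)
        also have "\<dots> = arr Q a2" using R.In_matrix_sum [OF a2] a2
          by (simp add: inv1 A.arr_path_series)
        finally show ?thesis using c a2 by (auto simp: lder_arr)
      qed
      have "\<Psi>' (\<Psi> (?S c)) = \<Psi>' (\<Sum>a\<in>B.Ins. bracket Q' k (\<phi> (?M a)) * arr (mquiver Q' k) (Star a))"
        using m Star True by (subst Psi_arr) auto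
      also have "\<dots> = (\<Sum>a\<in>B.Ins. \<Psi>' (bracket Q' k (\<phi> (?M a)) * arr (mquiver Q' k) (Star a)))"
        by (intro R.H.hom_sum mult_path_series bracket_phi_path_series Star_path_series(1) In_matrix(3) c)
      also have "\<dots> = (\<Sum>a\<in>B.Ins. \<Psi>' (bracket Q' k (\<phi> (?M a))) * \<Psi>' (arr (mquiver Q' k) (Star a)))"
        by (intro sum.cong refl R.H.hom_mult bracket_phi_path_series Star_path_series(1) In_matrix(3) c)
      also have "\<dots> = (\<Sum>a\<in>B.Ins. bracket Q k (?M a) * (\<Sum>a2\<in>A.Ins. bracket Q k (?N a a2) * ?S a2))"
      proof (rule sum.cong [OF refl])
        fix a assume a: "a \<in> B.Ins"
        have "\<Psi>' (bracket Q' k (\<phi> (?M a))) = bracket Q k (?M a)"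
          using R.intertwine [OF phi_Cor [OF In_matrix(2) [OF c a]]] In_matrix(3) [OF c a]
            by (simp add: inv1)
        then show "\<Psi>' (bracket Q' k (\<phi> (?M a))) * \<Psi>' (arr (mquiver Q' k) (Star a)) =
          bracket Q k (?M a) * (\<Sum>a2\<in>A.Ins. bracket Q k
            (?N a a2) * ?S a2)" using Psi'_star_In [OF a] by simp
      qed
      also have "\<dots> = (\<Sum>a\<in>B.Ins. \<Sum>a2\<in>A.Ins. bracket Q k (?M a * ?N a a2) * ?S a2)"
        using In_matrix(2) [OF c]
          by (intro sum.cong refl) (simp add: sum_distrib_left mult.assoc bracket_corner_mult)
      also have "\<dots> = (\<Sum>a2\<in>A.Ins. bracket Q k (\<Sum>a\<in>B.Ins. ?M a * ?N a a2) * ?S a2)"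
        by (subst sum.swap) (simp add: bracket_sum sum_distrib_right)
      also have "\<dots> = (\<Sum>a2\<in>A.Ins. if c = a2 then vtx (qtail Q c) * ?S c else 0)"
        by (intro sum.cong refl, simp only: MN) simp
      also have "\<dots> = vtx (qtail Q c) * ?S c" using c by (simp add: A.finite_arrs)
      also have "\<dots> = ?S c" using vtx_between [OF between_arr [of "mquiver Q k" "Star c"]] True
        by simp
      finally show ?thesis using Star by simp
    next
      case False
      then have c: "c \<in> A.Outs" using m Star by auto
      let ?M = "\<lambda>b. ra Q c (\<phi>' (arr Q' b))" and ?N = "\<lambda>b b2. \<phi>' (ra Q' b (\<phi> (arr Q b2)))"
      let ?S = "\<lambda>a. arr (mquiver Q k) (Star a)"
      \<comment> \<open>Coefficients now stand right of the starred arrows, so the matrices multiply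
        in the opposite order and the derivative acts from the right.\<close>
      have MN: "(\<Sum>b\<in>B.Outs. ?N b b2 * ?M b) = (if c = b2 then vtx (qhead Q c) else 0)"
        if b2: "b2 \<in> A.Outs" for b2
      proof -
        have "?N b b2 * ?M b = ra Q c (?N b b2 * \<phi>' (arr Q' b))" if b: "b \<in> B.Outs" for b
        proof -
          have "coeff (\<phi>' (arr Q' b)) i [] = 0" for i using P'.hom_order_ge_arr [of b] b
            by (simp add: order_ge_def)
          then show ?thesis by (simp add: rder_mult)
        qed
        then have "(\<Sum>b\<in>B.Outs. ?N b b2 * ?M b) = ra Q c (\<Sum>b\<in>B.Outs. ?N b b2 * \<phi>' (arr Q' b))"
          by (simp add: rder_sum)
        also have "(\<Sum>b\<in>B.Outs. ?N b b2 * \<phi>' (arr Q' b))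
              = (\<Sum>b\<in>B.Outs. \<phi>' (ra Q' b (\<phi> (arr Q b2)) * arr Q' b))"
          using b2 by (intro sum.cong refl P'.hom_mult [symmetric]) (auto
            simp: B.arr_path_series A.arr_path_series B.rder_path_series P.hom_in_path_series)
        also have "\<dots> = \<phi>' (\<Sum>b\<in>B.Outs. ra Q' b (\<phi> (arr Q b2)) * arr Q' b)"
          using b2 by (intro P'.hom_sum [symmetric]) (auto
            simp: B.arr_path_series A.arr_path_series B.rder_path_series P.hom_in_path_series mult_path_series)
        also have "\<dots> = arr Q b2" using R.Out_matrix_sum [OF b2] b2
          by (simp add: inv1 A.arr_path_series)
        finally show ?thesis using c b2 by (auto simp: rder_arr)
      qed
      \<comment> \<open>Here the entry contributed by \<open>\<Psi>'\<close> is the left factor, so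
        it is the one that has to lie in the corner for the bracket to split.\<close>
      have N: "corner k (?N b b2)" if "b \<in> B.Outs" "b2 \<in> A.Outs" for b b2
        using R.phi_Cor [OF R.Out_matrix(2) [OF that]] by simp
      have "\<Psi>' (\<Psi> (?S c)) = \<Psi>' (\<Sum>b\<in>B.Outs. arr (mquiver Q' k) (Star b) * bracket Q' k (\<phi> (?M b)))"
        using m Star False by (subst Psi_arr) auto
      also have "\<dots> = (\<Sum>b\<in>B.Outs. \<Psi>' (arr (mquiver Q' k) (Star b) * bracket Q' k (\<phi> (?M b))))"
        by (intro R.H.hom_sum mult_path_series bracket_phi_path_series Star_path_series(2) Out_matrix(3) c)
      also have "\<dots> = (\<Sum>b\<in>B.Outs. \<Psi>' (arr (mquiver Q' k) (Star b)) * \<Psi>' (bracket Q' k (\<phi> (?M b))))"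
        by (intro sum.cong refl R.H.hom_mult bracket_phi_path_series Star_path_series(2) Out_matrix(3) c)
      also have "\<dots> = (\<Sum>b\<in>B.Outs. (\<Sum>b2\<in>A.Outs. ?S b2 * bracket Q k (?N b b2)) * bracket Q k (?M b))"
      proof (rule sum.cong [OF refl])
        fix b assume b: "b \<in> B.Outs"
        have "\<Psi>' (bracket Q' k (\<phi> (?M b))) = bracket Q k (?M b)"
          using R.intertwine [OF phi_Cor [OF Out_matrix(2) [OF c b]]] Out_matrix(3) [OF c b]
            by (simp add: inv1)
        then show "\<Psi>' (arr (mquiver Q' k) (Star b)) * \<Psi>' (bracket Q' k (\<phi> (?M b))) =
          (\<Sum>b2\<in>A.Outs. ?S b2 * bracket Q k (?N b b2)) * bracket Q k
            (?M b)" using Psi'_star_Out [OF b] by simp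
      qed
      also have "\<dots> = (\<Sum>b\<in>B.Outs. \<Sum>b2\<in>A.Outs. ?S b2 * bracket Q k (?N b b2 * ?M b))"
        unfolding sum_distrib_right
          by (intro sum.cong refl, simp only: bracket_corner_mult [OF N] mult.assoc)
      also have "\<dots> = (\<Sum>b2\<in>A.Outs. ?S b2 * bracket Q k (\<Sum>b\<in>B.Outs. ?N b b2 * ?M b))"
        by (subst sum.swap) (simp add: bracket_sum sum_distrib_left)
      also have "\<dots> = (\<Sum>b2\<in>A.Outs. if c = b2 then ?S c * vtx (qhead Q c) else 0)"
        by (intro sum.cong refl, simp only: MN) simp
      also have "\<dots> = ?S c * vtx (qhead Q c)" using c by (simp add: A.finite_arrs)
      also have "\<dots> = ?S c" using between_vtx [OF between_arr [of "mquiver Q k" "Star c"]] False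
        by simp
      finally show ?thesis using Star by simp
    qed
  qed
qed

lemma Psi_inverse: assumes "F \<in> path_series (mquiver Q k)" shows "\<Psi>' (\<Psi> F) = F"
proof -
  interpret R: mutable_pair Q' Q k \<phi>' \<phi> by (rule flip)
  have "pa_hom (mquiver Q k) (mquiver Q k) (\<lambda>F. \<Psi>' (\<Psi> F))"
    using verts_eq
      by (auto simp: pa_hom_def R.H.hom_in_path_series H.hom_in_path_series H.hom_add R.H.hom_add H.hom_mult R.H.hom_mult H.hom_svtx R.H.hom_svtx)
  moreover have "pa_hom (mquiver Q k) (mquiver Q k) (\<lambda>F. F)" by (simp add: pa_hom_def)
  ultimately show ?thesis
    by (rule pa_hom_eqI [OF A.loopfree_mquiver, where ?\<psi>1.0 = "\<lambda>F. \<Psi>' (\<Psi> F)" and ?\<psi>2.0 = "\<lambda>F. F"])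
      (simp_all only: Psi_inverse_arr assms)
qed

end

section \<open>Cyclic equivalence\<close>

definition rotations :: "'x list \<Rightarrow> 'x list set" where
  "rotations w = range (\<lambda>n. rotate n w)"

lemma rotations_refl: "w \<in> rotations w" unfolding rotations_def by (rule range_eqI [of _ _ 0]) simp

lemma rotations_rotate: "u \<in> rotations w \<Longrightarrow> rotate n u \<in> rotations w"
  unfolding rotations_def by (auto simp: rotate_rotate)

lemma finite_rotations: "finite (rotations w)"
proof -
  have "rotations w \<subseteq> {u. set u \<subseteq> set w \<and> length u = length w}" by (auto simp: rotations_def)
  then show ?thesis using finite_lists_length_eq [of "set w"] finite_subset by blast
qed

lemma rotations_append: "u @ v \<in> rotations w \<Longrightarrow> v @ u \<in> rotations w"
  using rotations_rotate [of "u @ v" w "length u"] by (simp add: rotate_append)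

lemma rotationsE: assumes "u \<in> rotations w" obtains v1 v2 where "w = v1 @ v2" "u = v2 @ v1"
proof -
  obtain n where "u = rotate n w" using assms by (auto simp: rotations_def)
  then have "u = drop (n mod length w) w @ take (n mod length w) w" by (simp add: rotate_drop_take)
  then show thesis using that [of "take (n mod length w) w" "drop (n mod length w) w"] by simp
qed

lemma rotations_appendI: "v2 @ v1 \<in> rotations (v1 @ v2)"
  using rotations_append rotations_refl by blast

lemma rotations_sym: "u \<in> rotations w \<Longrightarrow> w \<in> rotations u"
  by (metis rotationsE rotations_appendI)

lemma rotations_trans: "u \<in> rotations v \<Longrightarrow> v \<in> rotations w \<Longrightarrow> u \<in> rotations w"
  by (auto simp: rotations_def rotate_rotate)

text \<open>The sum runs over the set of rotations, not over rotation amounts: a periodic cyclic path would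
  otherwise be counted with a multiplicity that may vanish in \<open>K\<close>.\<close>
definition cycsum :: "('v, 'a, 'k::field) pser \<Rightarrow> ('a \<times> 'v) list \<Rightarrow> 'k" where
  "cycsum F w = (\<Sum>u\<in>rotations w. coeff F (snd (hd u)) u)"

text \<open>The closure of the span of rotation differences, described by the functionals that
  vanish on it. Each condition is a finite sum, so infinite series need no approximation.\<close>

definition cyc_null :: "('v, 'a, 'k::field) pser \<Rightarrow> bool" where
  "cyc_null F \<longleftrightarrow> (\<forall>i w. w = [] \<or> wend i w \<noteq> i \<longrightarrow> coeff F i w = 0) \<and> (\<forall>w. w \<noteq> [] \<longrightarrow> cycsum F w = 0)"

lemma cyc_null_zero [simp]: "cyc_null 0" by (simp add: cyc_null_def cycsum_def)
lemma cyc_null_add: "cyc_null F \<Longrightarrow> cyc_null G \<Longrightarrow> cyc_null (F + G)"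
  by (simp add: cyc_null_def cycsum_def sum.distrib)
lemma cyc_null_sum: "(\<And>x. x \<in> A \<Longrightarrow> cyc_null (F x)) \<Longrightarrow> cyc_null (sum F A)"
  by (induction A rule: infinite_finite_induct) (auto intro: cyc_null_add)

text \<open>A summand is a rotation of w together with a cut, that is, a pair (u, v) with
  \<open>u @ v\<close> in the class of w. Exchanging the factors becomes exchanging u and v; the
  vertices are read cyclically so that an empty part is no exception.\<close>

lemma cycsum_mult:
  assumes "w \<noteq> []"
  shows "cycsum (X * Y) w =
    (\<Sum>(u, v)\<in>{(u, v). u @ v \<in> rotations w}. coeff X (snd (hd (v @ u))) u * coeff Y (snd (hd
      (u @ v))) v)"
proof -
  have "cycsum (X * Y) w = (\<Sum>t\<in>rotations w. \<Sum>n\<le>length t.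
      coeff X (wend (snd (hd t)) (drop n t)) (take n t) * coeff Y (snd (hd t)) (drop n t))"
    by (simp add: cycsum_def coeff_times conv_def)
  also have "\<dots> = (\<Sum>(t, n)\<in>Sigma (rotations w) (\<lambda>t. {..length t}).
      coeff X (wend (snd (hd t)) (drop n t)) (take n t) * coeff Y (snd (hd t)) (drop n t))"
    by (rule sum.Sigma) (auto simp: finite_rotations)
  also have "\<dots> = (\<Sum>(u, v)\<in>{(u, v). u @ v
        \<in> rotations w}. coeff X (snd (hd (v @ u))) u * coeff Y (snd (hd (u @ v))) v)"
  proof (rule sum.reindex_bij_witness [where j = "\<lambda>(t, n). (take n t, drop n t)"
    and i = "\<lambda>(u, v). (u @ v, length u)"])
    fix p assume "p \<in> Sigma (rotations w) (\<lambda>t. {..length t})"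
    then obtain t n where p: "p = (t, n)" "t \<in> rotations w" "n \<le> length t" by auto
    have "wend (snd (hd t)) (drop n t) = snd (hd (drop n t @ take n t))"
      by (cases "drop n t = []") (simp_all add: wend_def)
    then show "(case case p of (t, n) \<Rightarrow> (take n t, drop n t) of (u, v) \<Rightarrow>
          coeff X (snd (hd (v @ u))) u * coeff Y (snd (hd (u @ v))) v) =
        (case p of (t, n) \<Rightarrow> coeff X (wend (snd (hd t)) (drop n t)) (take n t) * coeff Y (snd (hd t))
          (drop n t))"
      using p by simp
  qed auto
  finally show ?thesis .
qed

text \<open>Swapping the two parts of each cut matches the terms of both products. The endpoints
  confine the products to closed paths, and on trivial paths the terms cancel by commutativity of
  K.\<close>

lemma cyc_null_commutator:
  assumes X: "between i j X" and Y: "between j i Y"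
  shows "cyc_null (X * Y - Y * X)"
  unfolding cyc_null_def
proof (intro conjI allI impI)
  fix w :: "('b \<times> 'a) list" assume w: "w \<noteq> []"
  have "cycsum (X * Y) w = cycsum (Y * X) w"
    unfolding cycsum_mult [OF w]
    by (rule sum.reindex_bij_witness [where j = prod.swap and i = prod.swap])
      (auto intro: rotations_append simp: mult.commute)
  then show "cycsum (X * Y - Y * X) w = 0" by (simp add: cycsum_def sum_subtractf)
next
  fix l and w :: "('b \<times> 'a) list" assume l: "w = [] \<or> wend l w \<noteq> l"
  have "between i i (X * Y)" "between j j (Y * X)" using X Y by (auto intro: between_mult)
  then show "coeff (X * Y - Y * X) l w = 0"
    using l unfolding between_def by (cases "w = []") (simp_all add: mult.commute, metis)
qed

text \<open>A cut that does not come from a cut of w falls between the b and the a of some [ba]; its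
  right part then begins with a, whose recorded head is k.\<close>

lemma unbracket_split:
  "unbracket k w = v1 @ v2 \<Longrightarrow>
        (\<exists>w1 w2. w = w1 @ w2 \<and> v1 = unbracket k w1 \<and> v2 = unbracket k w2) \<or> (v2 \<noteq> [] \<and> snd (hd v2)
        = k)"
proof (induction w arbitrary: v1)
  case (Cons x w)
  show ?case
  proof (cases "v1 = []")
    case True
    then have "x # w = [] @ (x # w) \<and> v1 = unbracket k [] \<and> v2 = unbracket k (x # w)"
      using Cons.prems by simp
    then show ?thesis by blast
  next
    case False
    have *: ?thesis if "v1 = unbracket_letter k x @ v" for v
    proof -
      have "unbracket k w = v @ v2" using Cons.prems that by simp
      from Cons.IH [OF this] show ?thesis
      proof
        assume "\<exists>w1 w2. w = w1 @ w2 \<and> v = unbracket k w1 \<and> v2 = unbracket k w2"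
        then obtain w1 w2 where "w = w1 @ w2" "v = unbracket k w1" "v2 = unbracket k w2" by blast
        then have "x # w = (x # w1) @ w2 \<and> v1 = unbracket k (x # w1) \<and> v2 = unbracket k w2"
          using that by simp
        then show ?thesis by blast
      qed simp
    qed
    obtain m h where x: "x = (m, h)" by (cases x)
    show ?thesis
    proof (cases m)
      case (Comp b a)
      then show ?thesis using Cons.prems False * x
        by (auto simp: Cons_eq_append_conv append_eq_Cons_conv)
    qed (use Cons.prems False * x in \<open>auto simp: Cons_eq_append_conv\<close>)
  qed
qed simp

text \<open>The tail of the leading arrow separates the cases: a composite opens with an arrow
  leaving k, and an old arrow never leaves k.\<close>

lemma unbracket_inj: "list_all (ok_letter Q k) w \<Longrightarrow> list_all (ok_letter Q k) u \<Longrightarrow>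
      unbracket k w = unbracket k u \<Longrightarrow> w = u"
proof (induction w arbitrary: u)
  case Nil
  then show ?case using unbracket_eq_Nil [of Q k u] by simp
next
  case (Cons x w)
  then have "u \<noteq> []" using unbracket_eq_Nil [of Q k "x # w"] by auto
  then obtain y v where u: "u = y # v" by (cases u) auto
  obtain m h where x: "x = (m, h)" by (cases x)
  obtain n g where y: "y = (n, g)" by (cases y)
  have IH: "unbracket k w = unbracket k v \<Longrightarrow> w = v" by (rule Cons.IH) (use Cons.prems u in simp_all)
  have "ok_letter Q k (m, h)" "ok_letter Q k (n, g)" "unbracket_letter k (m, h) @ unbracket k w
        = unbracket_letter k (n, g) @ unbracket k v"
    using Cons.prems u x y by simp_all
  then show ?case unfolding x y u using IH by (cases m; cases n) simp_all
qed

text \<open>Expansion embeds the rotation class of w into the class of its expansion. The rotations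
  that are missed cut some composite, so they are based at k, where F has no coefficients; the two
  class sums therefore agree.\<close>

lemma cyc_null_bracket:
  fixes F :: "('v, 'a, 'k::field) pser"
  assumes F: "cyc_null F" and k: "\<And>w. coeff F k w = 0"
  shows "cyc_null (bracket Q k F)"
  unfolding cyc_null_def
proof (intro conjI allI impI)
  fix i and w :: "('a marrow \<times> 'v) list" assume *: "w = [] \<or> wend i w \<noteq> i"
  show "coeff (bracket Q k F) i w = 0"
  proof (cases "list_all (ok_letter Q k) w")
    case True
    then have "unbracket k w = [] \<or> wend i (unbracket k w) \<noteq> i" using * wend_unbracket [OF True]
      by auto
    then show ?thesis using F by (auto simp: coeff_bracket cyc_null_def)
  qed (simp add: coeff_bracket)
next
  fix w :: "('a marrow \<times> 'v) list" assume w: "w \<noteq> []"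
  show "cycsum (bracket Q k F) w = 0"
  proof (cases "list_all (ok_letter Q k) w")
    case False
    then have "\<not> list_all (ok_letter Q k) u" if "u \<in> rotations w" for u using that
      by (auto simp: rotations_def list_all_iff)
    then show ?thesis by (simp add: cycsum_def coeff_bracket)
  next
    case True
    have ok: "list_all (ok_letter Q k) u" "u \<noteq> []" if "u \<in> rotations w" for u using that True w
      by (auto simp: rotations_def list_all_iff)
    have "cycsum (bracket Q k F) w
          = (\<Sum>u\<in>rotations w. coeff F (snd (hd (unbracket k u))) (unbracket k u))"
      unfolding cycsum_def
    proof (rule sum.cong [OF refl])
      fix u assume u: "u \<in> rotations w"
      have "wend undefined (unbracket k u) = wend undefined u"
        using wend_unbracket [OF ok(1) [OF u]] .
      then have "snd (hd (unbracket k u)) = snd (hd u)"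
        using ok [OF u] unbracket_eq_Nil [OF ok(1) [OF u]] by (simp add: wend_def)
      then show "coeff (bracket Q k F) (snd (hd u)) u
            = coeff F (snd (hd (unbracket k u))) (unbracket k u)" using ok [OF u]
        by (simp add: coeff_bracket)
    qed
    also have "\<dots> = (\<Sum>v\<in>unbracket k ` rotations w. coeff F (snd (hd v)) v)"
      by (subst sum.reindex) (auto intro: inj_onI unbracket_inj [OF ok(1) ok(1)])
    also have "\<dots> = (\<Sum>v\<in>rotations (unbracket k w). coeff F (snd (hd v)) v)"
    proof (rule sum.mono_neutral_left)
      show "unbracket k ` rotations w \<subseteq> rotations (unbracket k w)"
      proof
        fix v assume "v \<in> unbracket k ` rotations w"
        then obtain u where "u \<in> rotations w" "v = unbracket k u" by auto
        then show "v \<in> rotations (unbracket k w)" by (elim rotationsE) (simp add: rotations_appendI)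
      qed
      show "\<forall>v\<in>rotations (unbracket k w) - unbracket k ` rotations w. coeff F (snd (hd v)) v = 0"
      proof
        fix v assume v: "v \<in> rotations (unbracket k w) - unbracket k ` rotations w"
        then obtain v1 v2 where v12: "unbracket k w = v1 @ v2" "v = v2 @ v1"
          by (elim DiffE rotationsE)
        from unbracket_split [OF v12(1)] show "coeff F (snd (hd v)) v = 0"
        proof
          assume "\<exists>w1 w2. w = w1 @ w2 \<and> v1 = unbracket k w1 \<and> v2 = unbracket k w2"
          then obtain w1 w2 where "w = w1 @ w2" "v1 = unbracket k w1" "v2 = unbracket k w2" by blast
          then have "v = unbracket k (w2 @ w1)" "w2 @ w1 \<in> rotations w" using v12
            by (auto simp: rotations_appendI)
          then show ?thesis using v by blast
        next
          assume "v2 \<noteq> [] \<and> snd (hd v2) = k"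
          then show ?thesis using v12 k by simp
        qed
      qed
    qed (simp add: finite_rotations)
    also have "\<dots> = 0" using F w unbracket_eq_Nil [OF True] by (simp add: cyc_null_def cycsum_def)
    finally show ?thesis .
  qed
qed

definition starpot :: "('v, 'a) quiver \<Rightarrow> 'v \<Rightarrow> ('v, 'a marrow, 'k::field) pser" where
  "starpot Q k = (\<Sum>b\<in>{b \<in> qarrs Q. qtail Q b = k}. \<Sum>a\<in>{a \<in> qarrs Q. qhead Q a = k}.
     arr (mquiver Q k) (Comp b a) * arr (mquiver Q k) (Star a) * arr (mquiver Q k) (Star b))"

lemma (in mutable_quiver) starpot_path_series: "starpot Q k \<in> path_series (mquiver Q k)"
  unfolding starpot_def
    by (intro sum_path_series mult_path_series loopfree.arr_path_series [OF loopfree_mquiver]) auto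

context mutable_pair
begin

lemma Psi_starpot: "cyc_null (\<Psi> (starpot Q k) - starpot Q' k)"
proof -
  note arr_path_series = loopfree.arr_path_series [OF A.loopfree_mquiver]
  let ?C = "\<lambda>a c. \<phi> (la Q a (\<phi>' (arr Q' c)))" and ?D = "\<lambda>b d. \<phi> (ra Q b (\<phi>' (arr Q' d)))"
  let ?S = "\<lambda>c. arr (mquiver Q' k) (Star c)" and ?B = "bracket Q' k"
  let ?Z = "\<lambda>b c d. ?B (\<phi> (arr Q b) * arr Q' c) * ?S c * ?S d" and ?W = "\<lambda>b d. ?B (?D b d)"
  have SI: "\<Psi> (arr (mquiver Q k) (Star a)) = (\<Sum>c\<in>B.Ins. ?B (?C a c) * ?S c)" if "a \<in> A.Ins" for a
    using that by (subst Psi_arr) auto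
  have SO: "\<Psi> (arr (mquiver Q k) (Star b)) = (\<Sum>d\<in>B.Outs. ?S d * ?B (?D b d))" if "b \<in> A.Outs" for b
    using that A.no_loop [of b] by (subst Psi_arr) auto
  have PC: "arr (mquiver Q k) (Comp b a)
        \<in> (path_series (mquiver Q k) :: ('v, 'a marrow, 'k) pser set)" if "a \<in> A.Ins" "b \<in> A.Outs"
    for a b
    using that by (intro arr_path_series) simp
  have PI: "arr (mquiver Q k) (Star a)
        \<in> (path_series (mquiver Q k) :: ('v, 'a marrow, 'k) pser set)" if "a \<in> A.Ins" for a
    using that by (intro arr_path_series) simp
  have PO: "arr (mquiver Q k) (Star b)
        \<in> (path_series (mquiver Q k) :: ('v, 'a marrow, 'k) pser set)" if "b \<in> A.Outs" for b
    using that by (intro arr_path_series) simp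
  \<comment> \<open>The entries C recombine under \<phi> to the single arrow \<open>c\<close>. Both
    \<open>\<phi> (arr Q b)\<close> and \<open>arr Q' c\<close> touch k, so the sum must be formed
    inside one bracket of their product.\<close>
  have key: "(\<Sum>a\<in>A.Ins. ?B (\<phi> (arr Q b * arr Q a)) * ?B (?C a c)) = ?B (\<phi> (arr Q b) * arr Q' c)"
    if b: "b \<in> A.Outs" and c: "c \<in> B.Ins" for b c
  proof -
    have "(\<Sum>a\<in>A.Ins. ?B (\<phi> (arr Q b * arr Q a)) * ?B (?C a c))
          = (\<Sum>a\<in>A.Ins. ?B (\<phi> (arr Q b) * \<phi> (arr Q a * la Q a (\<phi>' (arr Q' c)))))"
    proof (rule sum.cong [OF refl])
      fix a assume a: "a \<in> A.Ins"
      have "corner k (\<phi> (arr Q b * arr Q a))" using phi_Cor [OF A.corner_arr2 [OF a b]] by simp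
      then have "?B (\<phi> (arr Q b * arr Q a)) * ?B (?C a c) = ?B (\<phi> (arr Q b * arr Q a) * ?C a c)"
        by (simp only: bracket_corner_mult)
      also have "\<phi> (arr Q b * arr Q a) * ?C a c
            = \<phi> (arr Q b) * \<phi> (arr Q a * la Q a (\<phi>' (arr Q' c)))"
        using a b In_matrix(3) [OF a c] by (simp add: P.hom_mult A.arr_path_series mult.assoc)
      finally show "?B (\<phi> (arr Q b * arr Q a)) * ?B (?C a c)
            = ?B (\<phi> (arr Q b) * \<phi> (arr Q a * la Q a (\<phi>' (arr Q' c))))" .
    qed
    also have "\<dots> = ?B (\<phi> (arr Q b) * (\<Sum>a\<in>A.Ins. \<phi> (arr Q a * la Q a (\<phi>' (arr Q' c)))))"
      by (simp only: bracket_sum sum_distrib_left)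
    also have "(\<Sum>a\<in>A.Ins. \<phi> (arr Q a * la Q a (\<phi>' (arr Q' c))))
          = \<phi> (\<Sum>a\<in>A.Ins. arr Q a * la Q a (\<phi>' (arr Q' c)))"
      using In_matrix(3) [OF _ c]
        by (intro P.hom_sum [symmetric] mult_path_series) (auto simp: A.arr_path_series)
    also have "\<dots> = arr Q' c" using In_matrix_sum [OF c] c by (simp add: inv2 B.arr_path_series)
    finally show ?thesis .
  qed
  have "\<Psi> (starpot Q k)
        = (\<Sum>b\<in>A.Outs. \<Sum>a\<in>A.Ins. ?B (\<phi> (arr Q b * arr Q a)) * (\<Sum>c\<in>B.Ins. ?B (?C a c) * ?S c)
        * (\<Sum>d\<in>B.Outs. ?S d * ?W b d))"
  proof -
    have "\<Psi> (starpot Q k)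
          = (\<Sum>b\<in>A.Outs. \<Psi> (\<Sum>a\<in>A.Ins. arr (mquiver Q k) (Comp b a) * arr (mquiver Q k) (Star a)
          * arr (mquiver Q k) (Star b)))"
      unfolding starpot_def by (intro H.hom_sum sum_path_series mult_path_series PC PI PO)
    also have "\<dots>
          = (\<Sum>b\<in>A.Outs. \<Sum>a\<in>A.Ins. \<Psi> (arr (mquiver Q k) (Comp b a) * arr (mquiver Q k) (Star a)
          * arr (mquiver Q k) (Star b)))"
      by (intro sum.cong refl H.hom_sum mult_path_series PC PI PO)
    also have "\<dots>
          = (\<Sum>b\<in>A.Outs. \<Sum>a\<in>A.Ins. ?B (\<phi> (arr Q b * arr Q a)) * (\<Sum>c\<in>B.Ins. ?B (?C a c) * ?S c)
          * (\<Sum>d\<in>B.Outs. ?S d * ?W b d))"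
    proof (intro sum.cong refl)
      fix a b assume a: "a \<in> A.Ins" and b: "b \<in> A.Outs"
      have "\<Psi> (arr (mquiver Q k) (Comp b a)) = ?B (\<phi> (arr Q b * arr Q a))"
        using a b by (subst Psi_arr) auto
      then show "\<Psi> (arr (mquiver Q k) (Comp b a) * arr (mquiver Q k) (Star a)
            * arr (mquiver Q k) (Star b))
        = ?B (\<phi> (arr Q b * arr Q a)) * (\<Sum>c\<in>B.Ins. ?B (?C a c) * ?S c) * (\<Sum>d\<in>B.Outs. ?S d * ?W b d)"
        by (simp only: H.hom_mult mult_path_series PC [OF a b] PI [OF a] PO [OF b] SI [OF a] SO [OF b])
    qed
    finally show ?thesis .
  qed
  also have "\<dots>
        = (\<Sum>b\<in>A.Outs. (\<Sum>a\<in>A.Ins. \<Sum>c\<in>B.Ins. ?B (\<phi> (arr Q b * arr Q a)) * ?B (?C a c) * ?S c)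
        * (\<Sum>d\<in>B.Outs. ?S d * ?W b d))"
    by (rule sum.cong [OF refl], subst sum_distrib_right, rule sum.cong [OF refl], rule arg_cong [where f = "\<lambda>z. z * _"])
      (simp only: sum_distrib_left mult.assoc)
  also have "\<dots>
        = (\<Sum>b\<in>A.Outs. (\<Sum>c\<in>B.Ins. ?B (\<phi> (arr Q b) * arr Q' c) * ?S c) * (\<Sum>d\<in>B.Outs. ?S d * ?W b d))"
  proof (rule sum.cong [OF refl])
    fix b assume b: "b \<in> A.Outs"
    have "(\<Sum>a\<in>A.Ins. \<Sum>c\<in>B.Ins. ?B (\<phi> (arr Q b * arr Q a)) * ?B (?C a c) * ?S c)
      = (\<Sum>c\<in>B.Ins. ?B (\<phi> (arr Q b) * arr Q' c) * ?S c)"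
      by (subst sum.swap) (simp only: sum_distrib_right [symmetric] key [OF b] cong: sum.cong)
    then show "(\<Sum>a\<in>A.Ins. \<Sum>c\<in>B.Ins. ?B (\<phi> (arr Q b * arr Q a)) * ?B (?C a c) * ?S c)
          * (\<Sum>d\<in>B.Outs. ?S d * ?W b d)
      = (\<Sum>c\<in>B.Ins. ?B (\<phi> (arr Q b) * arr Q' c) * ?S c) * (\<Sum>d\<in>B.Outs. ?S d * ?W b d)" by (simp only:)
  qed
  also have "\<dots> = (\<Sum>b\<in>A.Outs. \<Sum>c\<in>B.Ins. \<Sum>d\<in>B.Outs. ?Z b c d * ?W b d)"
    by (simp only: sum_product mult.assoc)
  finally have 1: "\<Psi> (starpot Q k) = (\<Sum>b\<in>A.Outs. \<Sum>c\<in>B.Ins. \<Sum>d\<in>B.Outs. ?Z b c d * ?W b d)" .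
  \<comment> \<open>Only with the last factor moved to the front does the entry D stand next to
    \<phi>(b), so that the sum over b recombines to \<open>d\<close>; this is why the starred terms
    match only up to cyclic equivalence.\<close>
  have key2: "(\<Sum>b\<in>A.Outs. ?W b d * ?Z b c d) = arr (mquiver Q' k) (Comp d c) * ?S c * ?S d"
    if c: "c \<in> B.Ins" and d: "d \<in> B.Outs" for c d
  proof -
    have "(\<Sum>b\<in>A.Outs. ?W b d * ?Z b c d)
          = (\<Sum>b\<in>A.Outs. ?B (\<phi> (ra Q b (\<phi>' (arr Q' d)) * arr Q b) * arr Q' c) * ?S c * ?S d)"
    proof (rule sum.cong [OF refl])
      fix b assume b: "b \<in> A.Outs"
      have "corner k (?D b d)" using phi_Cor [OF Out_matrix(2) [OF b d]] by simp
      then have "?W b d * ?B (\<phi> (arr Q b) * arr Q' c) = ?B (?D b d * (\<phi> (arr Q b) * arr Q' c))"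
        by (simp only: bracket_corner_mult)
      also have "?D b d * (\<phi> (arr Q b) * arr Q' c)
            = \<phi> (ra Q b (\<phi>' (arr Q' d)) * arr Q b) * arr Q' c"
        using Out_matrix(3) [OF b d] b by (simp add: P.hom_mult A.arr_path_series mult.assoc)
      finally show "?W b d * ?Z b c d
            = ?B (\<phi> (ra Q b (\<phi>' (arr Q' d)) * arr Q b) * arr Q' c) * ?S c * ?S d"
        by (simp only: mult.assoc [symmetric])
    qed
    also have "\<dots> = ?B ((\<Sum>b\<in>A.Outs. \<phi> (ra Q b (\<phi>' (arr Q' d)) * arr Q b)) * arr Q' c) * ?S c * ?S d"
      by (simp only: bracket_sum sum_distrib_right)
    also have "(\<Sum>b\<in>A.Outs. \<phi> (ra Q b (\<phi>' (arr Q' d)) * arr Q b))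
          = \<phi> (\<Sum>b\<in>A.Outs. ra Q b (\<phi>' (arr Q' d)) * arr Q b)"
      using Out_matrix(3) [OF _ d]
        by (intro P.hom_sum [symmetric] mult_path_series) (auto simp: A.arr_path_series)
    also have "\<dots> = arr Q' d" using Out_matrix_sum [OF d] d by (simp add: inv2 B.arr_path_series)
    also have "?B (arr Q' d * arr Q' c) = arr (mquiver Q' k) (Comp d c)"
      by (rule B.bracket_Comp [OF c d])
    finally show ?thesis .
  qed
  have 2: "starpot Q' k = (\<Sum>b\<in>A.Outs. \<Sum>c\<in>B.Ins. \<Sum>d\<in>B.Outs. ?W b d * ?Z b c d)"
  proof -
    have "(\<Sum>b\<in>A.Outs. \<Sum>c\<in>B.Ins. \<Sum>d\<in>B.Outs. ?W b d * ?Z b c d)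
          = (\<Sum>c\<in>B.Ins. \<Sum>b\<in>A.Outs. \<Sum>d\<in>B.Outs. ?W b d * ?Z b c d)"
      by (rule sum.swap)
    also have "\<dots> = (\<Sum>c\<in>B.Ins. \<Sum>d\<in>B.Outs. \<Sum>b\<in>A.Outs. ?W b d * ?Z b c d)"
      by (rule sum.cong [OF refl], rule sum.swap)
    also have "\<dots> = (\<Sum>c\<in>B.Ins. \<Sum>d\<in>B.Outs. arr (mquiver Q' k) (Comp d c) * ?S c * ?S d)"
      by (intro sum.cong refl key2)
    also have "\<dots> = starpot Q' k" unfolding starpot_def by (rule sum.swap)
    finally show ?thesis by simp
  qed
  \<comment> \<open>The two factors run in opposite directions between the heads of b and d, as the
    commutator criterion demands.\<close>
  have "cyc_null (?Z b c d * ?W b d - ?W b d * ?Z b c d)" if b: "b \<in> A.Outs" and c: "c \<in> B.Ins"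
    and d: "d \<in> B.Outs" for b c d
  proof (rule cyc_null_commutator)
    have 1: "between (qhead Q b) (qtail Q' c) (\<phi> (arr Q b) * arr Q' c)"
      using P.between_image_arr [of b] between_arr [of Q' c] b c
        by (intro between_mult [where j = k]) auto
    have 2: "between (qtail Q' c) k (?S c)" "between k (qhead Q' d) (?S d)"
      using c d B.no_loop [of d] between_arr [of "mquiver Q' k" "Star c"] between_arr [of "mquiver Q' k" "Star d"] by auto
    show "between (qhead Q b) (qhead Q' d) (?Z b c d)"
      by (rule between_mult [OF between_mult [OF between_bracket [OF 1] 2(1)] 2(2)])
    show "between (qhead Q' d) (qhead Q b) (?W b d)"
      using b d Out_matrix [OF b d] A.ends_in [of b] B.ends_in [of d] verts_eq
        by (intro between_bracket P.hom_between) auto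
  qed
  then have "cyc_null (\<Sum>b\<in>A.Outs. \<Sum>c\<in>B.Ins. \<Sum>d\<in>B.Outs. (?Z b c d * ?W b d - ?W b d * ?Z b c d))"
    by (intro cyc_null_sum)
  then show ?thesis unfolding 1 2 by (simp only: sum_subtractf)
qed

text \<open>The bracket part reduces by \<open>intertwine\<close> to the bracket of \<phi> S - S',
  so the given cyclic equivalence only has to pass through the bracket.\<close>

lemma Psi_potential:
  assumes S: "S \<in> A.Cor" and S': "S' \<in> B.Cor" and eq: "cyc_null (\<phi> S - S')"
  shows "cyc_null (\<Psi> (bracket Q k S + starpot Q k) - (bracket Q' k S' + starpot Q' k))"
proof -
  have st: "starpot Q k \<in> (path_series (mquiver Q k) :: ('v, 'a marrow, 'k) pser set)"
    by (rule A.starpot_path_series)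
  have "\<Psi> (bracket Q k S + starpot Q k) = bracket Q' k (\<phi> S) + \<Psi> (starpot Q k)"
    using S st intertwine [OF S] by (simp add: H.hom_add A.bracket_path_series)
  then have "\<Psi> (bracket Q k S + starpot Q k) - (bracket Q' k S' + starpot Q' k)
    = bracket Q' k (\<phi> S - S') + (\<Psi> (starpot Q k) - starpot Q' k)" by (simp add: bracket_minus)
  moreover have "cyc_null (bracket Q' k (\<phi> S - S'))"
    using phi_Cor [OF S] S' by (intro cyc_null_bracket eq) (simp add: corner_start)
  ultimately show ?thesis by (simp only: cyc_null_add Psi_starpot)
qed

end

section \<open>Path series and coefficient functions on paths\<close>

definition labelled :: "('v, 'a) quiver \<Rightarrow> 'a list \<Rightarrow> ('a \<times> 'v) list" where
  "labelled Q l = map (\<lambda>a. (a, qhead Q a)) l"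

lemma labelled_simps [simp]:
  "labelled Q [] = []" "labelled Q (a # l) = (a, qhead Q a) # labelled Q l"
  "length (labelled Q l) = length l" "map fst (labelled Q l) = l" "labelled Q l = [] \<longleftrightarrow> l = []"
  by (simp_all add: labelled_def comp_def)

lemma qpath_labelled: "qpath Q i w \<Longrightarrow> labelled Q (map fst w) = w"
  by (induction w) auto

lemma valid_path_iff: "valid_path Q (i, l) \<longleftrightarrow> qpath Q i (labelled Q l)"
proof (induction l)
  case Nil
  show ?case by (simp add: valid_path_def)
next
  case (Cons a l)
  have "valid_path Q (i, a # l) \<longleftrightarrow> a \<in> qarrs Q \<and> qtail Q a
        = wend i (labelled Q l) \<and> valid_path Q (i, l)"
    by (cases l) (auto simp: valid_path_def)
  then show ?case using Cons by auto
qed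

lemma path_end_eq: "path_end Q (i, l) = wend i (labelled Q l)"
  by (cases l) (auto simp: path_end_def)

definition to_pser :: "('v, 'a) quiver \<Rightarrow> (('v, 'a) path \<Rightarrow> 'k::field) \<Rightarrow> ('v, 'a, 'k) pser" where
  "to_pser Q f = Pser (\<lambda>i w. if qpath Q i w then f (i, map fst w) else 0)"

definition from_pser :: "('v, 'a) quiver \<Rightarrow> ('v, 'a, 'k::field) pser \<Rightarrow> ('v, 'a) path \<Rightarrow> 'k" where
  "from_pser Q F = (\<lambda>(i, l). if valid_path Q (i, l) then coeff F i (labelled Q l) else 0)"

lemma coeff_to_pser: "coeff (to_pser Q f) i w = (if qpath Q i w then f (i, map fst w) else 0)"
  by (simp add: to_pser_def)

lemma to_pser_path_series: "to_pser Q f \<in> path_series Q"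
  by (simp add: path_series_def coeff_to_pser)
lemma from_pser_cpa: "from_pser Q F \<in> cpa Q" by (auto simp: cpa_def from_pser_def)

lemma to_pser_from_pser: "F \<in> path_series Q \<Longrightarrow> to_pser Q (from_pser Q F) = F"
  by (rule pser_eqI) (auto
    simp: coeff_to_pser from_pser_def valid_path_iff qpath_labelled path_series_def)

lemma from_pser_to_pser: "f \<in> cpa Q \<Longrightarrow> from_pser Q (to_pser Q f) = f"
  by (auto simp: fun_eq_iff from_pser_def coeff_to_pser valid_path_iff cpa_def)

lemma to_pser_add: "to_pser Q (\<lambda>p. f p + g p) = to_pser Q f + to_pser Q g"
  by (rule pser_eqI) (simp add: coeff_to_pser)
lemma to_pser_diff: "to_pser Q (\<lambda>p. f p - g p) = to_pser Q f - to_pser Q g"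
  by (rule pser_eqI) (simp add: coeff_to_pser)
lemma from_pser_add: "from_pser Q (F + G) = (\<lambda>p. from_pser Q F p + from_pser Q G p)"
  by (auto simp: from_pser_def fun_eq_iff)

lemma cpa_add: "f \<in> cpa Q \<Longrightarrow> g \<in> cpa Q \<Longrightarrow> (\<lambda>p. f p + g p) \<in> cpa Q" by (simp add: cpa_def)
lemma cpa_diff: "f \<in> cpa Q \<Longrightarrow> g \<in> cpa Q \<Longrightarrow> (\<lambda>p. f p - g p) \<in> cpa Q" by (simp add: cpa_def)
lemma cpa_mult_cpa: "cpa_mult Q f g \<in> cpa Q" by (simp add: cpa_def cpa_mult_def)
lemma cpa_R_cpa: "cpa_R Q r \<in> cpa Q" by (auto simp: cpa_def cpa_R_def valid_path_def)

lemma to_pser_R: "finite (qverts Q) \<Longrightarrow> to_pser Q (cpa_R Q r) = (\<Sum>i\<in>qverts Q. smul (r i) (vtx i))"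
proof (rule pser_eqI)
  fix i and w :: "('b \<times> 'a) list" assume fin: "finite (qverts Q)"
  have "coeff (\<Sum>i\<in>qverts Q. smul (r i) (vtx i)) i w = (\<Sum>j\<in>qverts Q. if j = i then (if w
        = [] then r i else 0) else 0)"
    unfolding coeff_sum by (rule sum.cong) (auto simp: coeff_vtx)
  then show "coeff (to_pser Q (cpa_R Q r)) i w = coeff (\<Sum>i\<in>qverts Q. smul (r i) (vtx i)) i w"
    using fin by (simp add: coeff_to_pser cpa_R_def)
qed

lemma (in loopfree) qpath_appendD: "qpath Q i (u @ v) \<Longrightarrow> qpath Q i v \<and> qpath Q (wend i v) u"
proof (induction u)
  case Nil
  then show ?case by (cases v) (auto simp: ends_in)
qed (auto simp: wend_append)

lemma (in loopfree) to_pser_mult: "to_pser Q (cpa_mult Q f g) = to_pser Q f * to_pser Q g"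
proof (rule pser_eqI)
  fix i w
  show "coeff (to_pser Q (cpa_mult Q f g)) i w = coeff (to_pser Q f * to_pser Q g) i w"
  proof (cases "qpath Q i w")
    case False
    then show ?thesis
      using path_series_D [OF mult_path_series [OF to_pser_path_series to_pser_path_series], of Q f g i w] by (auto simp: coeff_to_pser)
  next
    case True
    let ?l = "map fst w"
    have "valid_path Q (i, ?l)" using True by (simp add: valid_path_iff qpath_labelled)
    then have "coeff (to_pser Q (cpa_mult Q f g)) i w = (\<Sum>n\<le>length w.
        f (if n < length w then qhead Q (?l ! n) else i, take n ?l) * g (i, drop n ?l))"
      using True by (simp add: coeff_to_pser cpa_mult_def atMost_atLeast0 cong: if_cong)
    also have "\<dots>
          = (\<Sum>n\<le>length w. coeff (to_pser Q f) (wend i (drop n w)) (take n w)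
          * coeff (to_pser Q g) i (drop n w))"
    proof (rule sum.cong [OF refl])
      fix n assume "n \<in> {..length w}"
      have q: "qpath Q i (drop n w)" "qpath Q (wend i (drop n w)) (take n w)"
        using qpath_appendD [of i "take n w" "drop n w"] True by auto
      \<comment> \<open>At n = length w the right factor is the trivial path at i, and there is no
        next letter to supply the vertex.\<close>
      have "(if n < length w then qhead Q (?l ! n) else i) = wend i (drop n w)"
      proof (cases "n < length w")
        case nl: True
        have "labelled Q ?l ! n = w ! n" using qpath_labelled [OF True] by simp
        then have "qhead Q (?l ! n) = snd (w ! n)" using nl unfolding labelled_def
          by (metis length_map nth_map snd_conv)
        then show ?thesis using nl by (simp add: wend_def hd_drop_conv_nth)
      qed simp
      then show "f (if n < length w then qhead Q (?l ! n) else i, take n ?l) * g (i, drop n ?l)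
          = coeff (to_pser Q f) (wend i (drop n w)) (take n w) * coeff (to_pser Q g) i (drop n w)"
        using q by (simp add: coeff_to_pser take_map drop_map)
    qed
    finally show ?thesis by (simp add: coeff_times conv_def)
  qed
qed

lemma from_pser_svtx:
  assumes "i \<in> qverts Q"
  shows "from_pser Q (smul c (vtx i)) = cpa_R Q (\<lambda>j. if j = i then c else 0)"
  using assms by (auto simp: fun_eq_iff from_pser_def cpa_R_def coeff_vtx valid_path_def)

lemma (in loopfree) from_pser_mult:
  assumes "F \<in> path_series Q" "G \<in> path_series Q"
    shows "from_pser Q (F * G) = cpa_mult Q (from_pser Q F) (from_pser Q G)"
proof -
  have "to_pser Q (cpa_mult Q (from_pser Q F) (from_pser Q G)) = F * G" using assms
    by (simp add: to_pser_mult to_pser_from_pser)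
  then show ?thesis using from_pser_to_pser [OF cpa_mult_cpa] by metis
qed

lemma (in loopfree) to_pser_svtx: "i \<in> qverts Q \<Longrightarrow>
      to_pser Q (cpa_R Q (\<lambda>j. if j = i then c else 0)) = smul c (vtx i)"
  by (metis from_pser_svtx smul_path_series to_pser_from_pser vtx_path_series)

lemma pa_hom_to_pser:
  assumes Q: "loopfree Q" "loopfree Q'" "qverts Q = qverts Q'"
    and iso: "alg_iso_R Q Q' \<phi>"
  shows "pa_hom Q Q' (\<lambda>F. to_pser Q' (\<phi> (from_pser Q F)))"
proof -
  interpret A: loopfree Q by fact
  interpret B: loopfree Q' by fact
  have m: "\<And>f. f \<in> cpa Q \<Longrightarrow> \<phi> f \<in> cpa Q'" using iso by (auto simp: alg_iso_R_def bij_betw_def)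
  show ?thesis unfolding pa_hom_def
  proof (intro conjI ballI allI)
    fix F G :: "('a, 'b, 'd) pser" assume FG: "F \<in> path_series Q" "G \<in> path_series Q"
    have "\<phi> (from_pser Q (F + G)) = (\<lambda>p. \<phi> (from_pser Q F) p + \<phi> (from_pser Q G) p)"
      using iso from_pser_cpa unfolding alg_iso_R_def from_pser_add by blast
    then show "to_pser Q' (\<phi> (from_pser Q (F + G)))
          = to_pser Q' (\<phi> (from_pser Q F)) + to_pser Q' (\<phi> (from_pser Q G))"
      by (simp add: to_pser_add)
    have "\<phi> (from_pser Q (F * G)) = cpa_mult Q' (\<phi> (from_pser Q F)) (\<phi> (from_pser Q G))"
      using iso from_pser_cpa unfolding alg_iso_R_def A.from_pser_mult [OF FG] by blast
    then show "to_pser Q' (\<phi> (from_pser Q (F * G)))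
          = to_pser Q' (\<phi> (from_pser Q F)) * to_pser Q' (\<phi> (from_pser Q G))"
      by (simp add: B.to_pser_mult)
  next
    fix c i assume "i \<in> qverts Q"
    then show "to_pser Q' (\<phi> (from_pser Q (smul c (vtx i)))) = smul c (vtx i)"
      using iso Q(3) by (simp add: from_pser_svtx alg_iso_R_def B.to_pser_svtx)
  qed (rule to_pser_path_series)
qed

lemma alg_iso_R_inv:
  assumes iso: "alg_iso_R Q Q' \<phi>"
  shows "alg_iso_R Q' Q (inv_into (cpa Q) \<phi>)"
proof -
  let ?i = "inv_into (cpa Q) \<phi>"
  have b: "bij_betw \<phi> (cpa Q) (cpa Q')" using iso by (simp add: alg_iso_R_def)
  have l: "\<And>f. f \<in> cpa Q \<Longrightarrow> ?i (\<phi> f) = f" using b by (simp add: bij_betw_inv_into_left)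
  have r: "\<And>g. g \<in> cpa Q' \<Longrightarrow> \<phi> (?i g) = g" using b by (simp add: bij_betw_inv_into_right)
  have bi: "bij_betw ?i (cpa Q') (cpa Q)" using b by (rule bij_betw_inv_into)
  then have m: "\<And>g. g \<in> cpa Q' \<Longrightarrow> ?i g \<in> cpa Q" by (auto simp: bij_betw_def)
  show ?thesis unfolding alg_iso_R_def
  proof (intro conjI ballI allI bi)
    fix f g :: "('a, 'c) path \<Rightarrow> 'd" assume fg: "f \<in> cpa Q'" "g \<in> cpa Q'"
    have "\<phi> (\<lambda>p. ?i f p + ?i g p) = (\<lambda>p. \<phi> (?i f) p + \<phi> (?i g) p)" using iso m fg
      by (simp add: alg_iso_R_def)
    then have "\<phi> (\<lambda>p. ?i f p + ?i g p) = (\<lambda>p. f p + g p)" by (simp add: r fg)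
    then show "?i (\<lambda>p. f p + g p) = (\<lambda>p. ?i f p + ?i g p)"
      using l [OF cpa_add [OF m [OF fg(1)] m [OF fg(2)]]] by simp
    have "\<phi> (cpa_mult Q (?i f) (?i g)) = cpa_mult Q' f g" using iso m fg r
      by (simp add: alg_iso_R_def)
    then show "?i (cpa_mult Q' f g) = cpa_mult Q (?i f) (?i g)"
      using l [OF cpa_mult_cpa, of "?i f" "?i g"] by simp
  next
    fix r show "?i (cpa_R Q' r) = cpa_R Q r" using l [OF cpa_R_cpa, of r] iso
      by (simp add: alg_iso_R_def)
  qed
qed

section \<open>Cyclic words, and cyclic equivalence as vanishing of class sums\<close>

definition cycw :: "('v, 'a) quiver \<Rightarrow> ('a \<times> 'v) list \<Rightarrow> bool" where
  "cycw Q w \<longleftrightarrow> w \<noteq> [] \<and> qpath Q (snd (hd w)) w"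

text \<open>The base vertex of a closed path is the head of its leftmost arrow, so a cyclic word
  determines the path, and \<open>rot\<close> on paths becomes \<open>rotate1\<close> on
  words.\<close>

definition word_path :: "('a \<times> 'v) list \<Rightarrow> ('v, 'a) path" where
  "word_path w = (snd (hd w), map fst w)"

lemma cyclic_word_path: "cycw Q w \<Longrightarrow> cyclic_path Q (word_path w)"
  by (auto simp: cycw_def word_path_def cyclic_path_def valid_path_iff qpath_labelled path_end_eq)
    (simp add: wend_def)

lemma word_path_inj: "cycw Q w \<Longrightarrow> cycw Q u \<Longrightarrow> word_path w = word_path u \<Longrightarrow> w = u"
  unfolding cycw_def word_path_def using qpath_labelled by (metis prod.inject)

lemma cyclic_path_labelled:
  assumes "cyclic_path Q q" shows "cycw Q (labelled Q (snd q)) \<and> word_path (labelled Q (snd q)) = q"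
proof -
  obtain i l where q: "q = (i, l)" by (cases q)
  then have "l \<noteq> []" "qpath Q i (labelled Q l)" "wend i (labelled Q l) = i"
    using assms by (auto simp: cyclic_path_def valid_path_iff path_end_eq)
  then show ?thesis using q by (cases l) (auto simp: cycw_def word_path_def comp_def)
qed

context loopfree
begin

lemma cycw_append: "cycw Q (u @ v) \<Longrightarrow> cycw Q (v @ u)"
proof -
  assume c: "cycw Q (u @ v)"
  show ?thesis
  proof (cases "u = [] \<or> v = []")
    case False
    then have "qpath Q (snd (hd u)) v" "qpath Q (snd (hd v)) u"
      using c qpath_appendD [of "snd (hd u)" u v] by (auto simp: cycw_def wend_def)
    then show ?thesis using False qpath_append [of Q "snd (hd v)" u v]
      by (simp add: cycw_def wend_def)
  qed (use c in auto)
qed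

lemma cycw_rotations: "cycw Q w \<Longrightarrow> u \<in> rotations w \<Longrightarrow> cycw Q u"
  by (erule rotationsE) (simp add: cycw_append)

lemma rot_word_path: "cycw Q w \<Longrightarrow> rot Q (word_path w) = word_path (rotate1 w)"
proof (cases w)
  case (Cons x u)
  assume "cycw Q w"
  then have "qtail Q (fst x) = snd (hd (u @ [x]))" using Cons by (cases u) (auto simp: cycw_def)
  then show ?thesis using Cons by (simp add: word_path_def)
qed (simp add: cycw_def)

lemma cycsum_to_pser:
  assumes "cycw Q w"
  shows "cycsum (to_pser Q h) w = (\<Sum>u\<in>rotations w. h (word_path u))"
  unfolding cycsum_def using cycw_rotations [OF assms]
    by (intro sum.cong) (auto simp: coeff_to_pser word_path_def cycw_def)

text \<open>A class sum involves paths of a single length, so one approximating combination computes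
  it exactly, and it vanishes on each q - rot q because both paths lie in the same class.\<close>

lemma cyc_equiv_imp_cyc_null:
  fixes f g :: "('v, 'a) path \<Rightarrow> 'k::field"
  assumes eq: "cyc_equiv Q f g"
  shows "cyc_null (to_pser Q f - to_pser Q g)"
proof -
  let ?h = "\<lambda>p. f p - g p"
  have d: "\<exists>F c. finite F \<and> F \<subseteq> {q. cyclic_path Q q} \<and>
      (\<forall>p. length (snd p) < n \<longrightarrow> ?h p = (\<Sum>q\<in>F. c q * (delta q p - delta (rot Q q) p)))" for n
    using eq by (simp add: cyc_equiv_def)
  have rc: "cyclic_path Q (rot Q q)" if "cyclic_path Q q" for q
  proof -
    have q: "cycw Q (labelled Q (snd q))" "word_path (labelled Q (snd q)) = q"
      using cyclic_path_labelled [OF that] by auto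
    have "cycw Q (rotate1 (labelled Q (snd q)))"
      by (rule cycw_rotations [OF q(1)]) (use rotations_rotate [OF rotations_refl, of 1] in simp)
    then show ?thesis using rot_word_path [OF q(1)] q(2) cyclic_word_path by metis
  qed
  have "cyc_null (to_pser Q ?h)" unfolding cyc_null_def
  proof (intro conjI allI impI)
    fix i and w :: "('a \<times> 'v) list" assume *: "w = [] \<or> wend i w \<noteq> i"
    show "coeff (to_pser Q ?h) i w = 0"
    proof (cases "qpath Q i w")
      case True
      let ?p = "(i, map fst w)"
      have nc: "\<not> cyclic_path Q ?p" using * True
        by (auto simp: cyclic_path_def path_end_eq qpath_labelled)
      obtain F c where F: "F \<subseteq> {q. cyclic_path Q q}"
        "\<forall>p. length (snd p) < Suc (length w) \<longrightarrow> ?h p = (\<Sum>q\<in>F. c q * (delta q p - delta (rot Q q) p))"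
        using d [of "Suc (length w)"] by blast
      have "?h ?p = (\<Sum>q\<in>F. c q * (delta q ?p - delta (rot Q q) ?p))" using F(2) by simp
      also have "\<dots> = 0"
      proof (rule sum.neutral, rule ballI)
        fix q assume "q \<in> F"
        then have "cyclic_path Q q" "cyclic_path Q (rot Q q)" using F(1) rc [of q] by auto
        then have "?p \<noteq> q" "?p \<noteq> rot Q q" using nc by auto
        then show "c q * (delta q ?p - delta (rot Q q) ?p) = 0" by (simp add: delta_def)
      qed
      finally show ?thesis using True by (simp add: coeff_to_pser)
    qed (simp add: coeff_to_pser)
  next
    fix w :: "('a \<times> 'v) list" assume w: "w \<noteq> []"
    show "cycsum (to_pser Q ?h) w = 0"
    proof (cases "cycw Q w")
      case False
      have "coeff (to_pser Q ?h) (snd (hd u)) u = 0" if "u \<in> rotations w" for u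
      proof -
        have "\<not> cycw Q u" using False cycw_rotations rotations_sym [OF that] by blast
        moreover have "u \<noteq> []" using that w by (auto simp: rotations_def)
        ultimately show ?thesis by (simp add: cycw_def coeff_to_pser)
      qed
      then show ?thesis by (simp add: cycsum_def)
    next
      case True
      \<comment> \<open>The bound is strict, hence the successor: all rotations of w have length
        \<open>length w\<close>.\<close>
      obtain F c where F: "finite F" "F \<subseteq> {q. cyclic_path Q q}"
        "\<forall>p. length (snd p) < Suc (length w) \<longrightarrow> ?h p = (\<Sum>q\<in>F. c q * (delta q p - delta (rot Q q) p))"
        using d [of "Suc (length w)"] by blast
      have "cycsum (to_pser Q ?h) w
            = (\<Sum>u\<in>rotations w. \<Sum>q\<in>F. c q * (delta q (word_path u) - delta (rot Q q) (word_path u)))"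
        unfolding cycsum_to_pser [OF True]
        by (rule sum.cong [OF refl]) (use F(3) in \<open>auto simp: rotations_def word_path_def\<close>)
      also have "\<dots>
            = (\<Sum>q\<in>F. c q * ((\<Sum>u\<in>rotations w. delta q (word_path u))
            - (\<Sum>u\<in>rotations w. delta (rot Q q) (word_path u))))"
        by (subst sum.swap) (simp only: sum_distrib_left [symmetric] sum_subtractf)
      also have "\<dots> = 0"
      proof (rule sum.neutral, rule ballI)
        fix q assume "q \<in> F"
        then have cq: "cyclic_path Q q" using F(2) by auto
        let ?v = "labelled Q (snd q)"
        have q: "cycw Q ?v" "word_path ?v = q" using cyclic_path_labelled [OF cq] by auto
        have v1: "cycw Q (rotate1 ?v)"
          by (rule cycw_rotations [OF q(1)]) (use rotations_rotate [OF rotations_refl, of 1] in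
          simp)
        have ind: "(\<Sum>u\<in>rotations w. delta (word_path v) (word_path u)) = (if v
              \<in> rotations w then 1 else (0 :: 'k))" if "cycw Q v" for v
        proof -
          have "(\<Sum>u\<in>rotations w. delta (word_path v) (word_path u)) = (\<Sum>u\<in>rotations w. if u
                = v then 1 else (0 :: 'k))"
            using word_path_inj [OF cycw_rotations [OF True] that]
              by (intro sum.cong) (auto simp: delta_def)
          then show ?thesis by (simp add: finite_rotations)
        qed
        have "?v \<in> rotations w \<longleftrightarrow> rotate1 ?v \<in> rotations w"
        proof
          show "?v \<in> rotations w \<Longrightarrow> rotate1 ?v \<in> rotations w" using rotations_rotate [of ?v w 1]
            by simp
          have "?v \<in> rotations (rotate1 ?v)"
            using rotations_sym rotations_rotate [OF rotations_refl, of 1 ?v] by simp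
          then show "rotate1 ?v \<in> rotations w \<Longrightarrow> ?v \<in> rotations w" by (rule rotations_trans)
        qed
        then have "(\<Sum>u\<in>rotations w. delta q (word_path u))
              = (\<Sum>u\<in>rotations w. delta (rot Q q) (word_path u) :: 'k)"
          using ind [OF q(1)] ind [OF v1] rot_word_path [OF q(1)] q(2) by simp
        then show "c q * ((\<Sum>u\<in>rotations w. delta q (word_path u))
              - (\<Sum>u\<in>rotations w. delta (rot Q q) (word_path u))) = 0" by simp
      qed
      finally show ?thesis .
    qed
  qed
  then show ?thesis by (simp only: to_pser_diff)
qed

text \<open>Below degree n, write h as the sum of h(q) (q - rep q) plus the sum of h(q) rep q, with
  one representative for each rotation class. The second sum collects class sums and vanishes; each
  q - rep q telescopes along successive rotations.\<close>

lemma cyc_null_imp_cyc_equiv: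
  fixes f g :: "('v, 'a) path \<Rightarrow> 'k::field"
  assumes f: "f \<in> cpa Q" "g \<in> cpa Q" and c0: "cyc_null (to_pser Q f - to_pser Q g)"
  shows "cyc_equiv Q f g"
  unfolding cyc_equiv_def
proof
  fix n
  define h where "h = (\<lambda>p. f p - g p)"
  have hc: "h \<in> cpa Q" unfolding h_def by (rule cpa_diff [OF f])
  have h0: "cyc_null (to_pser Q h)" using c0 by (simp add: h_def to_pser_diff)
  define F where "F = {q. cyclic_path Q q \<and> length (snd q) < n}"
  have finF: "finite F"
  proof -
    have "F \<subseteq> qverts Q \<times> {l. set l \<subseteq> qarrs Q \<and> length l \<le> n}"
      by (auto simp: F_def cyclic_path_def valid_path_def)
    then show ?thesis
      by (rule finite_subset) (simp add: finite_verts finite_lists_length_le [OF finite_arrs])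
  qed
  \<comment> \<open>With the index set fixed as all cyclic paths shorter than n, combinations are
    added coefficientwise.\<close>
  define S :: "(('v, 'a) path \<Rightarrow> 'k) set" where
    "S = {t. \<exists>c. \<forall>p. length (snd p) < n \<longrightarrow> t p = (\<Sum>q\<in>F. c q * (delta q p - delta (rot Q q) p))}"
  have S0: "(\<lambda>_. 0) \<in> S" unfolding S_def by (auto intro!: exI [of _ "\<lambda>_. 0"])
  have Sadd: "(\<lambda>p. s p + t p) \<in> S" if st: "s \<in> S" "t \<in> S" for s t
  proof -
    obtain c d where "\<forall>p. length (snd p) < n \<longrightarrow> s p = (\<Sum>q\<in>F. c q * (delta q p - delta (rot Q q) p))"
      "\<forall>p. length (snd p) < n \<longrightarrow> t p = (\<Sum>q\<in>F. d q * (delta q p - delta (rot Q q) p))"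
      using st unfolding S_def by blast
    then have "\<forall>p. length (snd p) < n \<longrightarrow>
          s p + t p = (\<Sum>q\<in>F. (c q + d q) * (delta q p - delta (rot Q q) p))"
      by (simp add: distrib_right sum.distrib)
    then show ?thesis unfolding S_def by (intro CollectI exI)
  qed
  have Sscale: "(\<lambda>p. a * s p) \<in> S" if st: "s \<in> S" for a s
  proof -
    obtain c where "\<forall>p. length (snd p) < n \<longrightarrow> s p = (\<Sum>q\<in>F. c q * (delta q p - delta (rot Q q) p))"
      using st unfolding S_def by blast
    then have "\<forall>p. length (snd p) < n \<longrightarrow>
          a * s p = (\<Sum>q\<in>F. (a * c q) * (delta q p - delta (rot Q q) p))"
      by (simp add: sum_distrib_left mult.assoc)
    then show ?thesis unfolding S_def by (intro CollectI exI)
  qed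
  have Ssum: "(\<lambda>p. \<Sum>x\<in>X. s x p) \<in> S" if "finite X" "\<forall>x\<in>X. s x \<in> S" for X :: "('v, 'a) path set"
    and s
    using that by (induction X rule: finite_induct) (auto simp: S0 Sadd)
  have S1: "(\<lambda>p. delta q p - delta (rot Q q) p) \<in> S" if "q \<in> F" for q
  proof -
    have "(\<Sum>q'\<in>F. (if q' = q then 1 else 0) * (delta q' p - delta (rot Q q') p))
          = (delta q p - delta (rot Q q) p :: 'k)" for p
    proof -
      have "(\<Sum>q'\<in>F. (if q' = q then 1 else 0) * (delta q' p - delta (rot Q q') p))
        = (\<Sum>q'\<in>F.
          if q' = q then delta q p - delta (rot Q q) p else (0 :: 'k))" by (rule sum.cong) auto
      then show ?thesis using that finF by simp
    qed
    then have "\<forall>p. length (snd p) < n \<longrightarrow> delta q p - delta (rot Q q) p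
        = (\<Sum>q'\<in>F. (if q' = q then 1 else 0) * (delta q' p - delta (rot Q q') p) :: 'k)" by simp
    then show ?thesis unfolding S_def by (intro CollectI exI)
  qed
  have Sm: "(\<lambda>p. delta (word_path w) p - delta (word_path (rotate m w)) p) \<in> S"
    if "cycw Q w" "length w < n" for w m
  proof (induction m)
    case 0
    show ?case using S0 by simp
  next
    case (Suc m)
    let ?u = "rotate m w"
    have u: "cycw Q ?u" using cycw_rotations [OF that(1)] by (simp add: rotations_def)
    then have "word_path ?u \<in> F" using cyclic_word_path [OF u] that(2)
      by (simp add: F_def word_path_def)
    then have "(\<lambda>p. delta (word_path ?u) p - delta (word_path (rotate1 ?u)) p) \<in> S"
      using S1 rot_word_path [OF u] by metis
    from Sadd [OF Suc this] show ?case by simp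
  qed
  \<comment> \<open>Rotations of a word have equal rotation sets, so the choice returns the same
    representative for the whole class.\<close>
  define rep :: "('a \<times> 'v) list \<Rightarrow> ('a \<times> 'v) list" where "rep w = (SOME u. u \<in> rotations w)" for w
  have rep_in: "rep w \<in> rotations w" for w unfolding rep_def by (rule someI) (rule rotations_refl)
  have rotations_eq: "rotations u = rotations w" if "u \<in> rotations w" for u w :: "('a \<times> 'v) list"
    using that rotations_trans rotations_sym by blast
  have rep_eq: "rep u = rep w" if "u \<in> rotations w" for u w
    unfolding rep_def rotations_eq [OF that] ..
  let ?w = "\<lambda>q. labelled Q (snd q)"
  let ?t = "\<lambda>p. \<Sum>q\<in>F. h q * (delta q p - delta (word_path (rep (?w q))) p)"
  have "?t \<in> S"
  proof (rule Ssum [OF finF], rule ballI, rule Sscale)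
    fix q assume q: "q \<in> F"
    then have c: "cycw Q (?w q)" "word_path (?w q) = q" "length (?w q) < n"
      using cyclic_path_labelled [of Q q] by (auto simp: F_def)
    obtain m where "rep (?w q) = rotate m (?w q)" using rep_in [of "?w q"]
      by (auto simp: rotations_def)
    then show "(\<lambda>p. delta q p - delta (word_path (rep (?w q))) p) \<in> S"
      using Sm [OF c(1,3), of m] c(2) by simp
  qed
  moreover have "h p = ?t p" if len: "length (snd p) < n" for p
  proof -
    have 1: "(\<Sum>q\<in>F. h q * delta q p) = h p"
    proof -
      have "(\<Sum>q\<in>F. h q * delta q p) = (\<Sum>q\<in>F. if q = p then h p else 0)"
        by (rule sum.cong) (auto simp: delta_def)
      also have "\<dots> = (if p \<in> F then h p else 0)" using finF by simp
      also have "\<dots> = h p"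
      proof (cases "cyclic_path Q p")
        case True then show ?thesis using len by (simp add: F_def)
      next
        case False
        have "h p = 0"
        proof (cases "valid_path Q p")
          case True
          obtain i l where p: "p = (i, l)" by (cases p)
          have "labelled Q l = [] \<or> wend i (labelled Q l) \<noteq> i" using False True p
            by (auto simp: cyclic_path_def path_end_eq)
          then have "coeff (to_pser Q h) i (labelled Q l) = 0" using h0 unfolding cyc_null_def
            by blast
          then show ?thesis using True p by (simp add: coeff_to_pser valid_path_iff comp_def)
        qed (use hc in \<open>cases p; simp add: cpa_def\<close>)
        then show ?thesis by simp
      qed
      finally show ?thesis .
    qed
    \<comment> \<open>For p the representative of a class, the terms that survive are those with q
      in this class, and they add up to its class sum.\<close>
    have 2: "(\<Sum>q\<in>F. h q * delta (word_path (rep (?w q))) p) = 0"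
    proof (cases "\<exists>q0\<in>F. p = word_path (rep (?w q0))")
      case False
      then show ?thesis by (intro sum.neutral) (auto simp: delta_def)
    next
      case True
      then obtain q0 where q0: "q0 \<in> F" "p = word_path (rep (?w q0))" by blast
      let ?wz = "?w q0"
      have c0: "cycw Q ?wz" "length ?wz < n" using q0 cyclic_path_labelled [of Q q0]
        by (auto simp: F_def)
      have "(\<Sum>q\<in>F. h q * delta (word_path (rep (?w q))) p) = (\<Sum>q\<in>word_path ` rotations ?wz. h q)"
      proof (rule sum.mono_neutral_cong_right [OF finF])
        show "word_path ` rotations ?wz \<subseteq> F"
        proof
          fix q assume "q \<in> word_path ` rotations ?wz"
          then obtain u where u: "u \<in> rotations ?wz" "q = word_path u" by auto
          have "length u = length ?wz" using u(1) by (auto simp: rotations_def)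
          then show "q \<in> F" using cyclic_word_path [OF cycw_rotations [OF c0(1) u(1)]] u(2) c0(2)
            by (simp add: F_def word_path_def)
        qed
        have key: "p = word_path (rep (?w q)) \<longleftrightarrow> q \<in> word_path ` rotations ?wz" if q: "q \<in> F" for q
        proof -
          have c: "cycw Q (?w q)" "word_path (?w q) = q" using q cyclic_path_labelled [of Q q]
            by (auto simp: F_def)
          show ?thesis
          proof
            assume "p = word_path (rep (?w q))"
            then have "rep (?w q) = rep ?wz"
              using q0(2) word_path_inj [OF cycw_rotations [OF c(1) rep_in] cycw_rotations [OF c0(1) rep_in]] by simp
            then have "rep ?wz \<in> rotations (?w q)" using rep_in [of "?w q"] by simp
            then have "?w q \<in> rotations ?wz" using rotations_sym rotations_trans rep_in by blast
            then show "q \<in> word_path ` rotations ?wz" using c(2) by (metis image_eqI)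
          next
            assume "q \<in> word_path ` rotations ?wz"
            then obtain u where u: "u \<in> rotations ?wz" "q = word_path u" by auto
            then have "u = ?w q" using word_path_inj [OF cycw_rotations [OF c0(1) u(1)] c(1)] c(2)
              by simp
            then show "p = word_path (rep (?w q))" using q0(2) rep_eq [OF u(1)] by simp
          qed
        qed
        show "\<forall>q\<in>F - word_path ` rotations ?wz. h q * delta (word_path (rep (?w q))) p = 0"
          using key by (auto simp: delta_def)
        show "h q * delta (word_path (rep (?w q))) p = h q" if "q \<in> word_path ` rotations ?wz" for q
          using key [of q] that \<open>word_path ` rotations ?wz \<subseteq> F\<close> by (auto simp: delta_def)
      qed
      also have "\<dots> = (\<Sum>u\<in>rotations ?wz. h (word_path u))"
        by (rule sum.reindex [unfolded comp_def])
          (auto intro!: inj_onI word_path_inj [OF cycw_rotations [OF c0(1)] cycw_rotations [OF c0(1)]])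
      also have "\<dots> = 0" using h0 c0(1) unfolding cycsum_to_pser [OF c0(1), symmetric]
        by (simp add: cyc_null_def cycw_def)
      finally show ?thesis .
    qed
    show ?thesis using 1 2 by (simp add: right_diff_distrib sum_subtractf)
  qed
  ultimately obtain c
    where "\<forall>p. length (snd p) < n \<longrightarrow> h p = (\<Sum>q\<in>F. c q * (delta q p - delta (rot Q q) p))"
    unfolding S_def by auto
  then show "\<exists>F c. finite F \<and> F \<subseteq> {q. cyclic_path Q q} \<and>
        (\<forall>p. length (snd p) < n \<longrightarrow> f p - g p = (\<Sum>q\<in>F. c q * (delta q p - delta (rot Q q) p)))"
    using finF by (intro exI [of _ F] exI [of _ c]) (auto simp: F_def h_def)
qed

end

section \<open>The mutated potential\<close>

context mutable_quiver
begin

text \<open>With both ends off k, each visit to k is flanked by an arrow entering and an arrow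
  leaving, and without loops such pairs cannot overlap; so the greedy scan leaves no arrow at k
  over. A pair consumes two letters, hence the induction on length.\<close>

lemma msub_unbracket:
  "qpath Q i (labelled Q l) \<Longrightarrow> i \<noteq> k \<Longrightarrow> wend i (labelled Q l) \<noteq> k \<Longrightarrow>
     list_all (ok_letter Q k) (labelled (mquiver Q k) (msub Q k l)) \<and> unbracket k (labelled
       (mquiver Q k) (msub Q k l)) = labelled Q l"
proof (induction l rule: length_induct)
  case (1 l)
  show ?case
  proof (cases l)
    case Nil
    then show ?thesis by simp
  next
    case (Cons b l')
    note l = this
    have b: "b \<in> qarrs Q" "qtail Q b
          = wend i (labelled Q l')" "qpath Q i (labelled Q l')" "qhead Q b \<noteq> k"
      using 1(2,4) l by auto
    show ?thesis
    proof (cases l')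
      case Nil
      then show ?thesis using b 1(3) l by simp
    next
      case (Cons a r)
      have a: "a \<in> qarrs Q" "qtail Q a
            = wend i (labelled Q r)" "qpath Q i (labelled Q r)" "qtail Q b = qhead Q a"
        using b Cons by auto
      show ?thesis
      proof (cases "qhead Q a = k")
        case True
        \<comment> \<open>The rest ends at the tail of a, which is off k as a is no loop; this
          restores the hypothesis behind the pair.\<close>
        then have "wend i (labelled Q r) \<noteq> k" using a no_loop [of a] by auto
        then have "list_all (ok_letter Q k) (labelled (mquiver Q k) (msub Q k r))
              \<and> unbracket k (labelled (mquiver Q k) (msub Q k r)) = labelled Q r"
          using 1(1) a(3) 1(3) l Cons by simp
        then show ?thesis using l Cons True a(4) by simp
      next
        case False
        then have "list_all (ok_letter Q k) (labelled (mquiver Q k) (msub Q k l'))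
              \<and> unbracket k (labelled (mquiver Q k) (msub Q k l')) = labelled Q l'"
          using 1(1) b(3) 1(3) l Cons by simp
        then show ?thesis using l Cons False a(4) b(4) by simp
      qed
    qed
  qed
qed

text \<open>The substitution is injective on paths with ends off k, so the defining sum has at most
  one term: the expansion of q, if that is a path.\<close>

lemma bracket_pot_eq:
  assumes pot: "potential Q S" and k: "\<forall>p. cyclic_path Q p \<and> S p \<noteq> 0 \<longrightarrow> fst p \<noteq> k"
  shows "bracket_pot Q S k = from_pser (mquiver Q k) (bracket Q k (to_pser Q S))"
proof (rule ext)
  fix q :: "('v, 'a marrow) path"
  obtain i m where q: "q = (i, m)" by (cases q)
  let ?M = "mquiver Q k"
  let ?u = "unbracket k (labelled ?M m)"
  let ?p = "(i, map fst ?u)"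
  let ?X = "{p. cyclic_path Q p \<and> fst p \<noteq> k \<and> (fst p, msub Q k (snd p)) = q}"
  let ?ok = "list_all (ok_letter Q k) (labelled ?M m) \<and> qpath Q i ?u"
  have msub: "list_all (ok_letter Q k) (labelled ?M (msub Q k l))
        \<and> unbracket k (labelled ?M (msub Q k l)) = labelled Q l \<and> qpath Q j (labelled Q l)"
    if "cyclic_path Q (j, l)" "j \<noteq> k" for j l
    using that msub_unbracket [of j l] by (auto simp: cyclic_path_def valid_path_iff path_end_eq)
  have X1: "p = ?p \<and> ?ok" if "p \<in> ?X" for p
  proof -
    obtain j l where p: "p = (j, l)" by (cases p)
    then have "cyclic_path Q (j, l)" "j \<noteq> k" "j = i" "msub Q k l = m" using that q by auto
    then show ?thesis using msub [of j l] p by auto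
  qed
  have X2: "?X = {} \<or> ?X = {?p}"
    by (rule subset_singletonD, rule subsetI) (simp only: X1 singleton_iff)
  have rhs: "from_pser ?M (bracket Q k (to_pser Q S)) q = (if ?ok then S ?p else 0)"
    using qpath_unbracket [of "labelled ?M m" i]
      by (auto simp: q from_pser_def coeff_bracket coeff_to_pser valid_path_iff)
  show "bracket_pot Q S k q = from_pser ?M (bracket Q k (to_pser Q S)) q"
  proof (cases "?p \<in> ?X")
    case True
    then have "?X \<noteq> {}" by (metis empty_iff)
    then have "?X = {?p}" using X2 by (simp only: simp_thms)
    then show ?thesis using X1 [OF True] rhs by (simp add: bracket_pot_def)
  next
    case False
    have "?X \<noteq> {?p}" using False singletonI [of ?p] by metis
    then have E: "?X = {}" using X2 by (simp only: simp_thms)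
    \<comment> \<open>If the coefficient were nonzero, \<open>?p\<close> would be cyclic and based
      off k; expansion being injective, substituting in it would give back m, and \<open>?p\<close>
      would be in the index set.\<close>
    have "S ?p = 0" if ok: ?ok
    proof (rule ccontr)
      assume "S ?p \<noteq> 0"
      then have c: "cyclic_path Q ?p" using pot by (auto simp: potential_def)
      then have "i \<noteq> k" using k \<open>S ?p \<noteq> 0\<close> by auto
      then have u: "unbracket k (labelled ?M (msub Q k (map fst ?u)))
            = ?u" "list_all (ok_letter Q k) (labelled ?M (msub Q k (map fst ?u)))"
        using msub [OF c] ok qpath_labelled [of Q i ?u] by auto
      have "labelled ?M (msub Q k (map fst ?u)) = labelled ?M m"
        by (rule unbracket_inj [OF u(2) conjunct1 [OF ok] u(1)])
      then have "map fst (labelled ?M (msub Q k (map fst ?u))) = map fst (labelled ?M m)" by simp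
      then have "msub Q k (map fst ?u) = m" by simp
      then show False using False c \<open>i \<noteq> k\<close> q by simp
    qed
    then show ?thesis unfolding bracket_pot_def E rhs by simp
  qed
qed

lemma coeff_arr3: "coeff (arr Q' x * arr Q' y * arr Q' z) i w =
   (if i = qtail Q' z \<and> w = [(x, qhead Q' x), (y, qhead Q' y), (z, qhead Q' z)]
       \<and> qtail Q' y = qhead Q' z \<and> qtail Q' x = qhead Q' y then 1 else 0)"
proof (cases w)
  case (Cons x1 w1)
  then show ?thesis unfolding mult.assoc
    by (cases w1) (auto simp: coeff_arr_times_Cons coeff_arr)
qed (simp add: mult.assoc)

text \<open>The letters of the word determine a and b, so the double sum has at most one nonzero
  term; the coefficient stays 1 in every characteristic.\<close>

lemma starpot_eq:
  "from_pser (mquiver Q k) (starpot Q k :: ('v, 'a marrow, 'k::field) pser) q =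
     (if \<exists>a\<in>qarrs Q. \<exists>b\<in>qarrs Q. qhead Q a = k \<and> qtail Q b = k \<and>
            q = (qhead Q b, [Comp b a, Star a, Star b]) then 1 else 0)"
proof -
  obtain i m where q: "q = (i, m)" by (cases q)
  let ?M = "mquiver Q k"
  let ?T = "\<lambda>a b. (i, m) = (qhead Q b, [Comp b a, Star a, Star b])"
  have v: "valid_path ?M (i, m)" if "a \<in> Ins" "b \<in> Outs" "?T a b" for a b
    using that no_loop [of a] no_loop [of b] ends_in [of b] by (auto simp: valid_path_iff)
  have "from_pser ?M (starpot Q k :: ('v, 'a marrow, 'k) pser) q
        = (if valid_path ?M (i, m) then (\<Sum>b\<in>Outs. \<Sum>a\<in>Ins. if ?T a b then 1 else 0) else 0)"
  proof -
    have "coeff (starpot Q k :: ('v, 'a marrow, 'k) pser) i (labelled ?M m)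
          = (\<Sum>b\<in>Outs. \<Sum>a\<in>Ins. if ?T a b then 1 else 0)"
      unfolding starpot_def coeff_sum
    proof (intro sum.cong refl)
      fix a b assume ab: "a \<in> Ins" "b \<in> Outs"
      have "labelled ?M m
            = [(Comp b a, qhead ?M (Comp b a)), (Star a, qhead ?M (Star a)), (Star b, qhead ?M (Star b))]
          \<longleftrightarrow> labelled ?M m = labelled ?M [Comp b a, Star a, Star b]" by simp
      also have "\<dots> \<longleftrightarrow> m = [Comp b a, Star a, Star b]" by (metis labelled_simps(4))
      finally show "coeff (arr ?M (Comp b a) * arr ?M (Star a) * arr ?M (Star b)) i (labelled ?M m)
            = (if ?T a b then 1 else 0)"
        using ab no_loop [of b] unfolding coeff_arr3 by auto
    qed
    then show ?thesis by (simp add: q from_pser_def)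
  qed
  also have "\<dots> = (if \<exists>a\<in>Ins. \<exists>b\<in>Outs. ?T a b then 1 else 0)"
  proof (cases "\<exists>a\<in>Ins. \<exists>b\<in>Outs. ?T a b")
    case False
    then have "(\<Sum>b\<in>Outs. \<Sum>a\<in>Ins. if ?T a b then 1 else (0 :: 'k)) = 0"
      by (intro sum.neutral ballI) auto
    then show ?thesis using False by (simp only: if_False if_cancel)
  next
    case True
    then obtain a0 b0 where ab: "a0 \<in> Ins" "b0 \<in> Outs" "?T a0 b0" by blast
    have "(\<Sum>b\<in>Outs. \<Sum>a\<in>Ins. if ?T a b then 1 else 0) = (\<Sum>b\<in>Outs. if b = b0 then (\<Sum>a\<in>Ins. if a
          = a0 then 1 else 0) else (0 :: 'k))"
      using ab(3) by (intro sum.cong refl) (auto intro!: sum.cong)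
    also have "\<dots> = 1" using ab by (simp add: finite_arrs)
    finally show ?thesis using True v [OF ab] by simp
  qed
  finally show ?thesis unfolding q by (auto intro!: if_cong)
qed

lemma mut_pot_eq:
  assumes "potential Q S" "\<forall>p. cyclic_path Q p \<and> S p \<noteq> 0 \<longrightarrow> fst p \<noteq> k"
  shows "mut_pot Q S k = from_pser (mquiver Q k) (bracket Q k (to_pser Q S) + starpot Q k)"
  unfolding mut_pot_def from_pser_add starpot_eq bracket_pot_eq [OF assms] by (rule refl)

text \<open>A cyclic path ends where it starts, so the condition on starting vertices keeps both
  ends off k.\<close>

lemma to_pser_Cor:
  assumes "potential Q S" "\<forall>p. cyclic_path Q p \<and> S p \<noteq> 0 \<longrightarrow> fst p \<noteq> k"
  shows "to_pser Q S \<in> Cor"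
proof -
  have "i \<noteq> k \<and> wend i w \<noteq> k" if nz: "coeff (to_pser Q S) i w \<noteq> 0" for i w
  proof -
    have w: "qpath Q i w" "S (i, map fst w) \<noteq> 0" using nz
      by (auto simp: coeff_to_pser split: if_splits)
    then have c: "cyclic_path Q (i, map fst w)" using assms(1) by (auto simp: potential_def)
    then have "i \<noteq> k" using assms(2) w(2) by auto
    then show ?thesis using c w(1) by (simp add: cyclic_path_def path_end_eq qpath_labelled)
  qed
  then show ?thesis by (simp add: to_pser_path_series corner_def)
qed

end

lemma QP_mutable_quiver:
  assumes "QP Q S" "mut_conds Q S k"
  shows "mutable_quiver Q k"
proof
  show "qtail Q a \<noteq> qhead Q b" if "a \<in> qarrs Q" "b \<in> qarrs Q" "qhead Q a = k" "qtail Q b = k"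
    for a b
    using assms that unfolding QP_def mut_conds_def by metis
qed (use assms in \<open>auto simp: QP_def mut_conds_def\<close>)

theorem theorem5p2:
  fixes Q :: "('v, 'a) quiver" and Q' :: "('v, 'b) quiver"
    and S :: "('v, 'a) path \<Rightarrow> 'k::field" and S' :: "('v, 'b) path \<Rightarrow> 'k"
    and k :: 'v
  assumes "QP Q S" and "mut_conds Q S k"
    and "QP Q' S'" and "mut_conds Q' S' k"
    and "right_equiv Q S Q' S'"
  shows "right_equiv (mquiver Q k) (mut_pot Q S k) (mquiver Q' k) (mut_pot Q' S' k)"
proof -
  interpret A: mutable_quiver Q k by (rule QP_mutable_quiver) fact+
  interpret B: mutable_quiver Q' k by (rule QP_mutable_quiver) fact+
  interpret MA: loopfree "mquiver Q k" by (rule A.loopfree_mquiver)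
  interpret MB: loopfree "mquiver Q' k" by (rule B.loopfree_mquiver)
  obtain \<phi> where V: "qverts Q = qverts Q'" and iso: "alg_iso_R Q Q' \<phi>"
    and ce: "cyc_equiv Q' (\<phi> S) S'"
    using assms(5) by (auto simp: right_equiv_def)
  let ?i = "inv_into (cpa Q) \<phi>"
  \<comment> \<open>The isomorphism acts on coefficient functions; conjugation by the two
    translations moves it to series, and its inverse on \<open>cpa Q\<close> supplies the other half
    of the pair.\<close>
  define \<Phi> where "\<Phi> = (\<lambda>F. to_pser Q' (\<phi> (from_pser Q F)))"
  define \<Phi>' where "\<Phi>' = (\<lambda>F. to_pser Q (?i (from_pser Q' F)))"
  have bij: "bij_betw \<phi> (cpa Q) (cpa Q')" using iso by (simp add: alg_iso_R_def)
  have m: "\<phi> f \<in> cpa Q'" if "f \<in> cpa Q" for f using bij that by (auto simp: bij_betw_def)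
  have m': "?i f \<in> cpa Q" if "f \<in> cpa Q'" for f using bij_betw_inv_into [OF bij] that
    by (auto simp: bij_betw_def)
  interpret mutable_pair Q Q' k \<Phi> \<Phi>'
  proof
    show "qverts Q' = qverts Q" using V by simp
    show "pa_hom Q Q' \<Phi>" unfolding \<Phi>_def
      by (rule pa_hom_to_pser [OF A.loopfree_axioms B.loopfree_axioms V iso])
    show "pa_hom Q' Q \<Phi>'" unfolding \<Phi>'_def
      by (rule pa_hom_to_pser [OF B.loopfree_axioms A.loopfree_axioms V [symmetric] alg_iso_R_inv [OF iso]])
    show "\<Phi>' (\<Phi> F) = F" if "F \<in> path_series Q" for F
      using that m [OF from_pser_cpa] from_pser_cpa [of Q F]
      by (simp add: \<Phi>_def \<Phi>'_def from_pser_to_pser to_pser_from_pser bij_betw_inv_into_left [OF bij])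
    show "\<Phi> (\<Phi>' F) = F" if "F \<in> path_series Q'" for F
      using that m' [OF from_pser_cpa] from_pser_cpa [of Q' F]
      by (simp add: \<Phi>_def \<Phi>'_def from_pser_to_pser to_pser_from_pser bij_betw_inv_into_right [OF bij])
  qed
  interpret R: mutable_pair Q' Q k \<Phi>' \<Phi> by (rule flip)
  let ?M = "mquiver Q k" and ?M' = "mquiver Q' k"
  let ?\<psi> = "\<lambda>f. from_pser ?M' (\<Psi> (to_pser ?M f))"
  have PM: "\<Psi> F \<in> path_series ?M'" if "F \<in> path_series ?M" for F
    using H.hom_in_path_series [OF that] .
  have S: "potential Q S" "\<forall>p. cyclic_path Q p \<and> S p \<noteq> 0 \<longrightarrow> fst p \<noteq> k"
    using assms(1,2) by (simp_all add: QP_def mut_conds_def)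
  have S': "potential Q' S'" "\<forall>p. cyclic_path Q' p \<and> S' p \<noteq> 0 \<longrightarrow> fst p \<noteq> k"
    using assms(3,4) by (simp_all add: QP_def mut_conds_def)
  have "alg_iso_R ?M ?M' ?\<psi>" unfolding alg_iso_R_def
  proof (intro conjI ballI allI)
    show "bij_betw ?\<psi> (cpa ?M) (cpa ?M')"
    proof (rule bij_betw_byWitness [where f' = "\<lambda>f. from_pser ?M (\<Psi>' (to_pser ?M' f))"])
      show "\<forall>f\<in>cpa ?M. from_pser ?M (\<Psi>' (to_pser ?M' (?\<psi> f))) = f"
        by (simp add: to_pser_from_pser PM to_pser_path_series Psi_inverse from_pser_to_pser)
      show "\<forall>f\<in>cpa ?M'. ?\<psi> (from_pser ?M (\<Psi>' (to_pser ?M' f))) = f"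
        by (simp add: to_pser_from_pser R.H.hom_in_path_series to_pser_path_series R.Psi_inverse from_pser_to_pser)
    qed (auto simp: from_pser_cpa)
    fix f g :: "('v, 'a marrow) path \<Rightarrow> 'k"
    show "?\<psi> (\<lambda>p. f p + g p) = (\<lambda>p. ?\<psi> f p + ?\<psi> g p)"
      by (simp only: to_pser_add H.hom_add to_pser_path_series from_pser_add)
    show "?\<psi> (cpa_mult ?M f g) = cpa_mult ?M' (?\<psi> f) (?\<psi> g)"
      by (simp only: MA.to_pser_mult H.hom_mult to_pser_path_series MB.from_pser_mult PM)
  next
    fix r :: "'v \<Rightarrow> 'k"
    have "\<Psi> (to_pser ?M (cpa_R ?M r)) = (\<Sum>i\<in>qverts Q. smul (r i) (vtx i))"
      using A.finite_verts
        by (simp add: to_pser_R H.hom_sum H.hom_svtx smul_path_series vtx_path_series)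
    also have "\<dots> = to_pser ?M' (cpa_R ?M' r)" using B.finite_verts V by (simp add: to_pser_R)
    finally show "?\<psi> (cpa_R ?M r) = cpa_R ?M' r" by (simp add: from_pser_to_pser cpa_R_cpa)
  qed
  moreover have "cyc_equiv ?M' (?\<psi> (mut_pot Q S k)) (mut_pot Q' S' k)"
  proof -
    have Sc: "S \<in> cpa Q" "S' \<in> cpa Q'" using S S' by (auto simp: potential_def)
    have "cyc_null (to_pser Q' (\<phi> S) - to_pser Q' S')" using B.cyc_equiv_imp_cyc_null [OF ce] .
    then have "cyc_null (\<Phi> (to_pser Q S) - to_pser Q' S')" by (simp add: \<Phi>_def from_pser_to_pser Sc)
    then have c: "cyc_null (\<Psi> (bracket Q k (to_pser Q S) + starpot Q k)
          - (bracket Q' k (to_pser Q' S') + starpot Q' k))"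
      by (intro Psi_potential A.to_pser_Cor B.to_pser_Cor S S')
    have PA1: "bracket Q k (to_pser Q S) + starpot Q k \<in> path_series ?M"
      by (intro add_path_series A.bracket_path_series to_pser_path_series A.starpot_path_series)
    have PA2: "bracket Q' k (to_pser Q' S') + starpot Q' k \<in> path_series ?M'"
      by (intro add_path_series B.bracket_path_series to_pser_path_series B.starpot_path_series)
    \<comment> \<open>Both mutated potentials translate to the series just compared, so the
      vanishing class sums turn back into the closure condition.\<close>
    show ?thesis unfolding A.mut_pot_eq [OF S] B.mut_pot_eq [OF S']
      by (rule MB.cyc_null_imp_cyc_equiv)
        (simp_all only: from_pser_cpa to_pser_from_pser PA1 PA2 PM c)
  qed
  ultimately show ?thesis using V by (auto simp: right_equiv_def)
qed

end
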